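(* Let $\mu$, $\nu$, $B$, $\tilde\tau$ be as in the context, and suppose that $B\cap B^*=\emptyset$, where $B^*=\{\ell-1-\epsilon:\epsilon\in B\}$. For a probability measure $m$ on $[0,1]$ put $D_m=\{\alpha : E_\alpha(m)\ne\emptyset\}$. Then: (i) $$D_\mu=D_\nu\cup\left[-\log_\ell\left(\max_{i\in B}p_i\right),\,-\log_\ell\left(\min_{i\in B}p_i\right)\right],$$ where by convention the interval on the right is empty if $B=\emptyset$. (ii) For every $\alpha\in D_\mu$, $$\dim(E_\alpha(\mu))=\max\left(\dim(E_\alpha(\nu)),\,\tilde\tau^*(\alpha)\right).$$
   Context: Let $\ell\ge 2$ be an integer. For $0\le i\le \ell-1$ define $S_i,S_{i+\ell}:[0,1]\to[0,1]$ by $S_i(x)=\frac{x}{\ell}+\frac{i}{\ell}$ and $S_{i+\ell}(x)=-\frac{x}{\ell}+\frac{i+1}{\ell}$. Let $(p_i)_{0\le i\le 2\ell-1}$ be a probability weight ($p_i\ge 0$, $\sum_i p_i=1$) with $p_i>0$ for every $0\le i\le\ell-1$, and let $\mu$ be the unique Borel probability measure on $[0,1]$ with $\mu=\sum_{i=0}^{2\ell-1}p_i\,\mu\circ S_i^{-1}$. Let $T(x)=1-x$, $\nu=(\mu+\mu\circ T)/2$, $B=\{0\le i\le\ell-1: p_{i+\ell}=0\}$ and $\tilde\tau(q)=\log_\ell\left(\sum_{i\in B}p_i^{\,q}\right)$ (with $\tilde\tau=-\infty$ if $B=\emptyset$). $\mathcal{F}_n$ is the set of $\ell$-adic intervals $[k/\ell^n,(k+1)/\ell^n)$,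 $0\le k<\ell^n$; $I_n(x)$ is the element of $\mathcal{F}_n$ containing $x$ (with $I_n(1)$ the last interval, $k=\ell^n-1$). For a probability measure $m$ on $[0,1]$, $E_\alpha(m)=\left\{x\in[0,1]: \lim_{n\to\infty}-\frac{\log m(I_n(x))}{n\log\ell}=\alpha\right\}$. For a function $g$, $g^*(\alpha)=\inf_{q\in\mathbb{R}}(\alpha q+g(q))$. $\dim$ is Hausdorff dimension. *)

theory Defs
  imports "HOL-Analysis.Analysis"
begin

section \<open>Hausdorff dimension\<close>

text \<open>The convention \<open>0\<^sup>0 = 1\<close> for nonempty sets makes the case \<open>s = 0\<close> the counting measure; note that
  \<open>0 powr 0 = 0\<close> in Isabelle.\<close>

definition diam_power :: "real \<Rightarrow> 'a::metric_space set \<Rightarrow> ennreal" where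
  "diam_power s U =
     (if U = {} then 0 else if s = 0 then 1 else ennreal (diameter U powr s))"

definition hausdorff_premeasure :: "real \<Rightarrow> real \<Rightarrow> 'a::metric_space set \<Rightarrow> ennreal" where
  "hausdorff_premeasure s \<delta> A =
     (INF U \<in> {U :: nat \<Rightarrow> 'a set. A \<subseteq> (\<Union>i. U i) \<and> (\<forall>i. bounded (U i) \<and> diameter (U i) \<le> \<delta>)}.
        \<Sum>i. diam_power s (U i))"

definition hausdorff_measure :: "real \<Rightarrow> 'a::metric_space set \<Rightarrow> ennreal" where
  "hausdorff_measure s A = (SUP \<delta> \<in> {0<..}. hausdorff_premeasure s \<delta> A)"

text \<open>With this definition the empty set has dimension 0.\<close>

definition hausdorff_dim :: "'a::metric_space set \<Rightarrow> ereal" where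
  "hausdorff_dim A = (INF s \<in> {s. 0 \<le> s \<and> hausdorff_measure s A = 0}. ereal s)"

section \<open>Adic intervals and level sets of the local dimension\<close>

definition adic_intervals :: "nat \<Rightarrow> nat \<Rightarrow> real set set" where
  "adic_intervals l n = (\<lambda>k. {real k / real l ^ n ..< (real k + 1) / real l ^ n}) ` {..<l ^ n}"

definition adic_interval :: "nat \<Rightarrow> nat \<Rightarrow> real \<Rightarrow> real set" where
  "adic_interval l n x =
     (if x = 1 then {(real l ^ n - 1) / real l ^ n ..< 1}
      else (THE J. J \<in> adic_intervals l n \<and> x \<in> J))"

lemma adic_interval_unique:
  assumes "l \<ge> 2" "x \<in> {0..<1}"
  shows "\<exists>!J. J \<in> adic_intervals l n \<and> x \<in> J"
proof -
  define N where "N = l ^ n"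
  have N: "real l ^ n = real N" "N > 0" using assms(1) by (auto simp: N_def)
  define k where "k = nat \<lfloor>x * real N\<rfloor>"
  have *: "real j \<le> x * real N \<and> x * real N < real j + 1 \<longleftrightarrow> j = k" for j
  proof -
    have "0 \<le> x * real N" using assms(2) by simp
    then have "real k = of_int \<lfloor>x * real N\<rfloor>" by (simp add: k_def)
    then show ?thesis by linarith
  qed
  have mem: "x \<in> {real j / real N ..< (real j + 1) / real N} \<longleftrightarrow> j = k" for j
    using *[of j] N(2) by (simp add: field_simps)
  have "x * real N < real N" using assms(2) N(2) by simp
  with *[of k] have "k < N" by linarith
  show ?thesis
  proof (rule ex1I[of _ "{real k / real N ..< (real k + 1) / real N}"])
    show "{real k / real N ..< (real k + 1) / real N} \<in> adic_intervals l n \<and>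
        x \<in> {real k / real N ..< (real k + 1) / real N}"
      unfolding adic_intervals_def N N_def[symmetric] mem using \<open>k < N\<close> by simp
  next
    fix J assume "J \<in> adic_intervals l n \<and> x \<in> J"
    then obtain j where "J = {real j / real N ..< (real j + 1) / real N}" "x \<in> J"
      unfolding adic_intervals_def N N_def[symmetric] by blast
    then show "J = {real k / real N ..< (real k + 1) / real N}"
      using mem[of j] by simp
  qed
qed

text \<open>The value of \<open>- log m(I\<^sub>n(x)) / (n log l)\<close> is \<open>\<infinity>\<close> when the interval is a null set;
  this case is separated because \<open>ln 0 = 0\<close> in Isabelle.\<close>

definition local_exponent :: "nat \<Rightarrow> real measure \<Rightarrow> real \<Rightarrow> nat \<Rightarrow> ereal" where
  "local_exponent l m x n =
     (let w = measure m (adic_interval l n x)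
      in if w = 0 then \<infinity> else ereal (- ln w / (real n * ln (real l))))"

definition level_set :: "nat \<Rightarrow> real measure \<Rightarrow> real \<Rightarrow> real set" where
  "level_set l m \<alpha> = {x \<in> {0..1}. local_exponent l m x \<longlonglongrightarrow> ereal \<alpha>}"

definition level_domain :: "nat \<Rightarrow> real measure \<Rightarrow> real set" where
  "level_domain l m = {\<alpha>. level_set l m \<alpha> \<noteq> {}}"

section \<open>The self-similar measure and its symmetrization\<close>

definition ifs_map :: "nat \<Rightarrow> nat \<Rightarrow> real \<Rightarrow> real" where
  "ifs_map l i x =
     (if i < l then x / real l + real i / real l
      else - (x / real l) + (real (i - l) + 1) / real l)"

definition probability_weight :: "nat \<Rightarrow> (nat \<Rightarrow> real) \<Rightarrow> bool" where
  "probability_weight l p \<longleftrightarrow> (\<forall>i<2 * l. p i \<ge> 0) \<and> (\<Sum>i<2 * l. p i) = 1"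

definition borel_prob_unit :: "real measure \<Rightarrow> bool" where
  "borel_prob_unit m \<longleftrightarrow> sets m = sets (restrict_space borel {0..1}) \<and> emeasure m (space m) = 1"

text \<open>Hutchinson's theorem provides exactly one such measure for each weight.\<close>

definition self_similar_measure :: "nat \<Rightarrow> (nat \<Rightarrow> real) \<Rightarrow> real measure \<Rightarrow> bool" where
  "self_similar_measure l p \<mu> \<longleftrightarrow> borel_prob_unit \<mu> \<and>
     (\<forall>A \<in> sets \<mu>. measure \<mu> A =
        (\<Sum>i<2 * l. p i * measure \<mu> {x \<in> {0..1}. ifs_map l i x \<in> A}))"

definition flip :: "real \<Rightarrow> real" where
  "flip x = 1 - x"

definition symmetrized :: "real measure \<Rightarrow> real measure" where
  "symmetrized \<mu> =
     measure_of (space \<mu>) (sets \<mu>) (\<lambda>A. (emeasure \<mu> A + emeasure \<mu> (flip ` A)) / 2)"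

lemma space_borel_prob_unit: "borel_prob_unit m \<Longrightarrow> space m = {0..1}"
  unfolding borel_prob_unit_def by (metis inf_top.right_neutral sets_eq_imp_space_eq space_borel space_restrict_space)

lemma emeasure_symmetrized:
  assumes "borel_prob_unit \<mu>" "A \<in> sets \<mu>"
  shows "emeasure (symmetrized \<mu>) A = (emeasure \<mu> A + emeasure \<mu> (flip ` A)) / 2"
proof -
  have sp: "space \<mu> = {0..1}" using assms(1) by (rule space_borel_prob_unit)
  have st: "sets \<mu> = sets (restrict_space borel {0..1})"
    using assms(1) by (simp add: borel_prob_unit_def)
  have "flip \<in> measurable (restrict_space borel {0..1}) (restrict_space borel {0..1})"
    by (intro measurable_restrict_space3) (auto simp: flip_def[abs_def])
  then have meas: "flip \<in> measurable \<mu> \<mu>"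
    using st measurable_cong_sets by blast
  have im: "flip ` A = flip -` A \<inter> space \<mu>" if "A \<in> sets \<mu>" for A
  proof -
    have "A \<subseteq> {0..1}" using sets.sets_into_space[OF that] sp by simp
    then show ?thesis unfolding sp flip_def by (force simp: image_iff)
  qed
  have d: "emeasure \<mu> (flip ` A) = emeasure (distr \<mu> \<mu> flip) A" if "A \<in> sets \<mu>" for A
    using that meas by (simp add: emeasure_distr im)
  show ?thesis
  proof (rule emeasure_measure_of[OF symmetrized_def])
    show "sets \<mu> \<subseteq> Pow (space \<mu>)" by (rule sets.space_closed)
    show "A \<in> sets (symmetrized \<mu>)" using assms(2) by (simp add: symmetrized_def)
    show "positive (sets (symmetrized \<mu>)) (\<lambda>A. (emeasure \<mu> A + emeasure \<mu> (flip ` A)) / 2)"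
      by (simp add: positive_def)
    show "countably_additive (sets (symmetrized \<mu>)) (\<lambda>A. (emeasure \<mu> A + emeasure \<mu> (flip ` A)) / 2)"
    proof (rule countably_additiveI)
      fix F :: "nat \<Rightarrow> real set"
      assume "range F \<subseteq> sets (symmetrized \<mu>)" and dj: "disjoint_family F"
      then have F: "range F \<subseteq> sets \<mu>" by (simp add: symmetrized_def)
      then have Fi: "F i \<in> sets \<mu>" for i by auto
      have U: "(\<Union>i. F i) \<in> sets \<mu>" using F by auto
      have "(\<Sum>i. (emeasure \<mu> (F i) + emeasure \<mu> (flip ` F i)) / 2)
          = (\<Sum>i. emeasure \<mu> (F i) + emeasure (distr \<mu> \<mu> flip) (F i)) / 2"
        by (simp add: d[OF Fi] divide_ennreal_def)
      also have "\<dots> = ((\<Sum>i. emeasure \<mu> (F i)) + (\<Sum>i. emeasure (distr \<mu> \<mu> flip) (F i))) / 2"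
        by (simp add: suminf_add)
      also have "\<dots> = (emeasure \<mu> (\<Union>i. F i) + emeasure (distr \<mu> \<mu> flip) (\<Union>i. F i)) / 2"
        using F dj by (simp add: suminf_emeasure)
      finally show "(\<Sum>i. (emeasure \<mu> (F i) + emeasure \<mu> (flip ` F i)) / 2)
          = (emeasure \<mu> (\<Union> (range F)) + emeasure \<mu> (flip ` \<Union> (range F))) / 2"
        by (simp add: d[OF U])
    qed
  qed
qed

section \<open>Digits without flipped branch\<close>

definition unflipped :: "nat \<Rightarrow> (nat \<Rightarrow> real) \<Rightarrow> nat set" where
  "unflipped l p = {i. i < l \<and> p (i + l) = 0}"

definition reflected :: "nat \<Rightarrow> nat set \<Rightarrow> nat set" where
  "reflected l B = (\<lambda>\<epsilon>. l - 1 - \<epsilon>) ` B"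

definition tau_tilde :: "nat \<Rightarrow> (nat \<Rightarrow> real) \<Rightarrow> real \<Rightarrow> ereal" where
  "tau_tilde l p q =
     (if unflipped l p = {} then -\<infinity>
      else ereal (log (real l) (\<Sum>i \<in> unflipped l p. p i powr q)))"

definition legendre :: "(real \<Rightarrow> ereal) \<Rightarrow> real \<Rightarrow> ereal" where
  "legendre g \<alpha> = (INF q. ereal (\<alpha> * q) + g q)"

definition exponent_range :: "nat \<Rightarrow> (nat \<Rightarrow> real) \<Rightarrow> nat set \<Rightarrow> real set" where
  "exponent_range l p B =
     (if B = {} then {}
      else {- log (real l) (Max (p ` B)) .. - log (real l) (Min (p ` B))})"

end

theory Submission
  imports Defs "HOL-Probability.Probability"
begin

text \<open>
  Both measures are determined by the masses of the \<open>l\<close>-adic intervals. Self-similarity gives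
  \<open>\<mu>(I\<^sub>j\<^sub>w) = p\<^sub>j \<mu>(I\<^sub>w) + p\<^bsub>j+l\<^esub> \<mu>(T I\<^sub>w)\<close> (lemma \<open>measure_cylinder\<close>), where \<open>T I\<^sub>w\<close> is the interval of the
  reflected word up to an endpoint of mass zero. If \<open>j \<notin> B\<close>, both weights are positive, so \<open>\<mu>(I\<^sub>j\<^sub>w)\<close> is
  comparable to \<open>\<nu>(I\<^sub>w)\<close>; if \<open>j \<in> B\<close>, the second term is absent. Since \<open>B\<close> and \<open>B\<^sup>*\<close> are disjoint, for
  every \<open>j\<close> at least one of \<open>j\<close> and its reflection lies outside \<open>B\<close>, and therefore \<open>\<nu>(I\<^sub>j\<^sub>w)\<close> is always
  comparable to \<open>\<nu>(I\<^sub>w)\<close> (\<open>sym_mass_Cons\<close>).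

  Let \<open>K\<close> be the set of points all of whose digits lie in \<open>B\<close> (\<open>unflipped_points\<close>). Off \<open>K\<close> some digit
  is outside \<open>B\<close>, hence for large \<open>n\<close> the ratio of \<open>\<mu>(I\<^sub>n(x))\<close> and \<open>\<nu>(I\<^sub>n(x))\<close> is bounded above and below, and
  \<open>E\<^sub>\<alpha>(\<mu>) - K = E\<^sub>\<alpha>(\<nu>) - K\<close> (\<open>level_sets_agree\<close>). Prepending a digit outside \<open>B\<close> is a similarity that
  moves \<open>E\<^sub>\<alpha>(\<nu>)\<close>, apart from the point 1, into \<open>E\<^sub>\<alpha>(\<nu>) - K\<close>, so that removing \<open>K\<close> does not change the
  dimension of \<open>E\<^sub>\<alpha>(\<nu>)\<close> (\<open>hausdorff_dim_level_set_nu\<close>).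

  On \<open>K\<close> the mass of \<open>I\<^sub>n(x)\<close> is the product of the weights of the first \<open>n\<close> digits, so \<open>E\<^sub>\<alpha>(\<mu>) \<inter> K\<close> is a
  set of prescribed digit averages. It is empty unless \<open>\<alpha>\<close> lies in the stated interval
  (\<open>unflipped_level_set_exponent_range\<close>). For \<open>\<alpha>\<close> in that interval its dimension is the Legendre
  transform of \<open>tau_tilde l p\<close>. The upper bound counts, for each \<open>q\<close>, the words whose average is close to the
  prescribed one (\<open>null_unflipped_deviation_set\<close>). For the lower bound one chooses digits
  independently with the Gibbs weights \<open>\<rho>\<^sub>i = p\<^sub>i\<^sup>q / (\<Sum>\<^sub>j p\<^sub>j\<^sup>q)\<close> for the minimising \<open>q\<close> (\<open>gibbs_weights\<close>;
  at the ends of the interval \<open>q\<close> is infinite and \<open>\<rho>\<close> is uniform on the extremal digits). By the law of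
  large numbers almost every random point lies in \<open>E\<^sub>\<alpha>(\<mu>) \<inter> K\<close>, and the mass distribution principle
  bounds the dimension from below by the entropy of \<open>\<rho>\<close> divided by \<open>ln l\<close>, which equals the Legendre
  transform.
\<close>

section \<open>Hausdorff null sets and Hausdorff dimension\<close>

text \<open>Only the vanishing of Hausdorff measures matters for the dimension, and it has a description by
  covers of small total cost.\<close>

lemma hausdorff_measure_eq_0_iff:
  "hausdorff_measure s A = 0 \<longleftrightarrow>
    (\<forall>\<delta>>0. \<forall>e>0. \<exists>U::nat \<Rightarrow> 'a::metric_space set. A \<subseteq> (\<Union>i. U i) \<and>
       (\<forall>i. bounded (U i) \<and> diameter (U i) \<le> \<delta>) \<and> (\<Sum>i. diam_power s (U i)) \<le> ennreal e)"
  (is "?L \<longleftrightarrow> ?R")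
proof
  assume L: ?L
  show ?R
  proof (intro allI impI)
    fix \<delta> e :: real assume "\<delta> > 0" "e > 0"
    have "hausdorff_premeasure s \<delta> A \<le> hausdorff_measure s A"
      unfolding hausdorff_measure_def using \<open>\<delta> > 0\<close> by (intro SUP_upper) auto
    with L have "hausdorff_premeasure s \<delta> A < ennreal e" using \<open>e > 0\<close> by simp
    then show "\<exists>U. A \<subseteq> (\<Union>i. U i) \<and> (\<forall>i. bounded (U i) \<and> diameter (U i) \<le> \<delta>) \<and>
        (\<Sum>i. diam_power s (U i)) \<le> ennreal e"
      unfolding hausdorff_premeasure_def INF_less_iff by (auto intro: less_imp_le)
  qed
next
  assume R: ?R
  have *: "hausdorff_premeasure s \<delta> A \<le> ennreal e" if "\<delta> > 0" "e > 0" for \<delta> e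
  proof -
    from R that obtain U where U: "A \<subseteq> (\<Union>i. U i)" "\<forall>i. bounded (U i) \<and> diameter (U i) \<le> \<delta>"
        "(\<Sum>i. diam_power s (U i)) \<le> ennreal e" by blast
    show ?thesis unfolding hausdorff_premeasure_def
      by (rule INF_lower2[of U]) (use U in auto)
  qed
  have "hausdorff_premeasure s \<delta> A \<le> 0" if "\<delta> > 0" for \<delta>
  proof (rule ennreal_le_epsilon)
    fix e :: real assume "0 < e"
    with *[OF that] show "hausdorff_premeasure s \<delta> A \<le> 0 + ennreal e" by simp
  qed
  then have "hausdorff_measure s A \<le> 0" unfolding hausdorff_measure_def by (intro SUP_least) auto
  then show ?L by simp
qed

lemma hausdorff_null_mono:
  assumes "hausdorff_measure s B = 0" "A \<subseteq> B"
  shows "hausdorff_measure s A = 0"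
  using assms unfolding hausdorff_measure_eq_0_iff by (meson order_trans)

lemma hausdorff_null_exponent_mono:
  assumes "hausdorff_measure s A = 0" "0 \<le> s" "s \<le> t"
  shows "hausdorff_measure t A = 0"
  unfolding hausdorff_measure_eq_0_iff
proof (intro allI impI)
  fix \<delta> e :: real assume "\<delta> > 0" "e > 0"
  with assms(1) obtain U where U: "A \<subseteq> (\<Union>i. U i)" 
      "\<And>i. bounded (U i)" "\<And>i. diameter (U i) \<le> min \<delta> 1"
      "(\<Sum>i. diam_power s (U i)) \<le> ennreal e"
    unfolding hausdorff_measure_eq_0_iff by (metis min_less_iff_conj zero_less_one)
  have "diam_power t (U i) \<le> diam_power s (U i)" for i
  proof -
    have *: "0 \<le> diameter (U i)" "diameter (U i) \<le> 1"
      using U(2,3)[of i] by (auto simp: diameter_ge_0)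
    have "diameter (U i) powr t \<le> diameter (U i) powr s"
    proof (cases "diameter (U i) = 0")
      case False
      then show ?thesis using * assms(3) by (intro powr_mono') auto
    qed auto
    moreover have "diameter (U i) powr t \<le> 1"
      using * assms(2,3) by (intro powr_le1) auto
    ultimately show ?thesis using assms(2,3) by (auto simp: diam_power_def ennreal_le_1)
  qed
  then have "(\<Sum>i. diam_power t (U i)) \<le> (\<Sum>i. diam_power s (U i))" by (intro suminf_le) auto
  with U show "\<exists>U. A \<subseteq> (\<Union>i. U i) \<and> (\<forall>i. bounded (U i) \<and> diameter (U i) \<le> \<delta>) \<and>
      (\<Sum>i. diam_power t (U i)) \<le> ennreal e"
    by (intro exI[of _ U]) auto
qed

lemma hausdorff_null_UN:
  fixes A :: "nat \<Rightarrow> 'a::metric_space set"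
  assumes "\<And>n. hausdorff_measure s (A n) = 0"
  shows "hausdorff_measure s (\<Union>n. A n) = 0"
  unfolding hausdorff_measure_eq_0_iff
proof (intro allI impI)
  fix \<delta> e :: real assume "\<delta> > 0" "e > 0"
  have "\<exists>U::nat \<Rightarrow> 'a set. A n \<subseteq> (\<Union>i. U i) \<and> (\<forall>i. bounded (U i) \<and> diameter (U i) \<le> \<delta>) \<and>
      (\<Sum>i. diam_power s (U i)) \<le> ennreal (e * (1/2) ^ Suc n)" for n
  proof -
    \<comment> \<open>The \<open>n\<close>-th set gets the share \<open>e / 2\<^bsup>n+1\<^esup>\<close> of the cost.\<close>
    have "0 < e * (1/2) ^ Suc n" using \<open>e > 0\<close> by simp
    then show ?thesis using assms[of n] \<open>\<delta> > 0\<close> unfolding hausdorff_measure_eq_0_iff by blast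
  qed
  then obtain U where U: "\<And>n. A n \<subseteq> (\<Union>i. U n i)"
      "\<And>n i. bounded (U n i) \<and> diameter (U n i) \<le> \<delta>"
      "\<And>n. (\<Sum>i. diam_power s (U n i)) \<le> ennreal (e * (1/2) ^ Suc n)" by metis
  define V where "V = (\<lambda>i. case_prod U (prod_decode i))"
  have "(\<Union>n. A n) \<subseteq> (\<Union>i. V i)"
  proof
    fix x assume "x \<in> (\<Union>n. A n)"
    then obtain n i where "x \<in> U n i" using U(1) by blast
    then show "x \<in> (\<Union>i. V i)" unfolding V_def by (intro UN_I[of "prod_encode (n, i)"]) auto
  qed
  moreover have "bounded (V i) \<and> diameter (V i) \<le> \<delta>" for i
    using U(2) by (simp add: V_def split: prod.split)
  moreover have "(\<Sum>i. diam_power s (V i)) \<le> ennreal e"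
  proof -
    have "(\<Sum>i. diam_power s (V i)) = (\<Sum>n. \<Sum>i. diam_power s (U n i))"
      unfolding V_def
      by (rule suminf_ennreal_2dimen[of _ "\<lambda>x. diam_power s (case_prod U x)"]) simp
    also have "\<dots> \<le> (\<Sum>n. ennreal (e * (1/2) ^ Suc n))"
      by (intro suminf_le U(3)) auto
    also have "\<dots> = ennreal e"
      using sums_mult[OF power_half_series, of e] \<open>e > 0\<close>
      by (intro suminf_ennreal_eq) auto
    finally show ?thesis .
  qed
  ultimately show "\<exists>U. (\<Union>n. A n) \<subseteq> (\<Union>i. U i) \<and> (\<forall>i. bounded (U i) \<and> diameter (U i) \<le> \<delta>) \<and>
      (\<Sum>i. diam_power s (U i)) \<le> ennreal e" by (intro exI[of _ V]) simp
qed

lemma hausdorff_null_Un: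
  assumes "hausdorff_measure s A = 0" "hausdorff_measure s B = 0"
  shows "hausdorff_measure s (A \<union> B) = 0"
proof -
  have "hausdorff_measure s (\<Union>n::nat. if n = 0 then A else B) = 0"
    by (rule hausdorff_null_UN) (use assms in auto)
  moreover have "(\<Union>n::nat. if n = 0 then A else B) = A \<union> B" by (auto split: if_splits)
  ultimately show ?thesis by simp
qed

lemma hausdorff_null_finite_covers:
  fixes A :: "'a::metric_space set"
  assumes "\<And>\<delta> e. \<delta> > 0 \<Longrightarrow> e > 0 \<Longrightarrow> \<exists>\<F>. finite \<F> \<and> A \<subseteq> \<Union>\<F> \<and>
      (\<forall>U\<in>\<F>. bounded U \<and> diameter U \<le> \<delta>) \<and> (\<Sum>U\<in>\<F>. diam_power s U) \<le> ennreal e"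
  shows "hausdorff_measure s A = 0"
  unfolding hausdorff_measure_eq_0_iff
proof (intro allI impI)
  fix \<delta> e :: real assume "\<delta> > 0" "e > 0"
  then obtain \<F> where F: "finite \<F>" "A \<subseteq> \<Union>\<F>" "\<And>U. U \<in> \<F> \<Longrightarrow> bounded U \<and> diameter U \<le> \<delta>"
      "(\<Sum>U\<in>\<F>. diam_power s U) \<le> ennreal e" using assms by meson
  obtain h where h: "bij_betw h {0..<card \<F>} \<F>" using ex_bij_betw_nat_finite F(1) by blast
  define V where "V = (\<lambda>i. if i < card \<F> then h i else {})"
  have "\<Union>\<F> \<subseteq> (\<Union>i. V i)"
  proof
    fix x assume "x \<in> \<Union>\<F>"
    then obtain i where "i < card \<F>" "x \<in> h i" using h unfolding bij_betw_def
      by (metis UnionE atLeastLessThan_iff imageE)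
    then show "x \<in> (\<Union>i. V i)" by (intro UN_I[of i]) (auto simp: V_def)
  qed
  moreover have "bounded (V i) \<and> diameter (V i) \<le> \<delta>" for i
    using F(3)[of "h i"] bij_betwE[OF h] \<open>\<delta> > 0\<close> by (cases "i < card \<F>") (auto simp: V_def)
  moreover have "(\<Sum>i. diam_power s (V i)) \<le> ennreal e"
  proof -
    have "(\<Sum>i. diam_power s (V i)) = (\<Sum>i\<in>{0..<card \<F>}. diam_power s (V i))"
      by (rule suminf_finite) (auto simp: V_def diam_power_def)
    also have "\<dots> = (\<Sum>i\<in>{0..<card \<F>}. diam_power s (h i))"
      by (intro sum.cong) (auto simp: V_def)
    also have "\<dots> = (\<Sum>U\<in>\<F>. diam_power s U)" by (rule sum.reindex_bij_betw[OF h])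
    finally show ?thesis using F(4) by simp
  qed
  ultimately show "\<exists>U. A \<subseteq> (\<Union>i. U i) \<and> (\<forall>i. bounded (U i) \<and> diameter (U i) \<le> \<delta>) \<and>
      (\<Sum>i. diam_power s (U i)) \<le> ennreal e" using F(2) by (intro exI[of _ V]) (simp add: order_trans)
qed

lemma hausdorff_null_lipschitz_image:
  fixes g :: "'a::metric_space \<Rightarrow> 'b::metric_space"
  assumes lip: "\<And>x y. x \<in> A \<Longrightarrow> y \<in> A \<Longrightarrow> dist (g x) (g y) \<le> L * dist x y" and "L > 0" "0 \<le> s"
    and "hausdorff_measure s A = 0"
  shows "hausdorff_measure s (g ` A) = 0"
  unfolding hausdorff_measure_eq_0_iff
proof (intro allI impI)
  fix \<delta> e :: real assume "\<delta> > 0" "e > 0"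
  have "\<delta> / L > 0" "e / L powr s > 0" using \<open>\<delta> > 0\<close> \<open>e > 0\<close> \<open>L > 0\<close> by auto
  with assms(4) obtain U where U: "A \<subseteq> (\<Union>i. U i)" 
      "\<And>i. bounded (U i)" "\<And>i. diameter (U i) \<le> \<delta> / L"
      "(\<Sum>i. diam_power s (U i)) \<le> ennreal (e / L powr s)"
    unfolding hausdorff_measure_eq_0_iff by meson
  define V where "V = (\<lambda>i. g ` (U i \<inter> A))"
  have le: "dist x y \<le> L * diameter (U i)" if "x \<in> V i" "y \<in> V i" for x y i
  proof -
    from that obtain x' y' where *: "x' \<in> U i" "x' \<in> A" "y' \<in> U i" "y' \<in> A" "x = g x'" "y = g y'"
      by (auto simp: V_def)
    then have "dist x y \<le> L * dist x' y'" using lip by simp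
    also have "\<dots> \<le> L * diameter (U i)"
      using diameter_bounded_bound[OF U(2)] * \<open>L > 0\<close> by (intro mult_left_mono) auto
    finally show ?thesis .
  qed
  have bd: "bounded (V i)" for i
    unfolding bounded_two_points using le by blast
  have d: "diameter (V i) \<le> L * diameter (U i)" for i
    using le[of _ i] \<open>L > 0\<close> diameter_ge_0[OF U(2)[of i]] unfolding diameter_def[of "V i"]
    by (auto intro!: cSUP_least)
  have "A \<subseteq> (\<Union>i. U i \<inter> A)" using U(1) by auto
  then have "g ` A \<subseteq> (\<Union>i. V i)" unfolding V_def by blast
  moreover have "diameter (V i) \<le> \<delta>" for i
    using d[of i] U(3)[of i] \<open>L > 0\<close> by (simp add: field_simps)
  moreover have "(\<Sum>i. diam_power s (V i)) \<le> ennreal e"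
  proof -
    have "diam_power s (V i) \<le> ennreal (L powr s) * diam_power s (U i)" for i
    proof (cases "U i = {} \<or> V i = {} \<or> s = 0")
      case True
      then show ?thesis using \<open>L > 0\<close> by (auto simp: diam_power_def V_def)
    next
      case False
      have "diameter (V i) powr s \<le> (L * diameter (U i)) powr s"
        using d[of i] \<open>0 \<le> s\<close> by (intro powr_mono2) (auto intro: diameter_ge_0 bd)
      also have "\<dots> = L powr s * diameter (U i) powr s"
        by (rule powr_mult)
      finally show ?thesis using False by (auto simp: diam_power_def ennreal_mult[symmetric] ennreal_leI)
    qed
    then have "(\<Sum>i. diam_power s (V i)) \<le> (\<Sum>i. ennreal (L powr s) * diam_power s (U i))"
      by (intro suminf_le) auto
    also have "\<dots> = ennreal (L powr s) * (\<Sum>i. diam_power s (U i))" by simp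
    also have "\<dots> \<le> ennreal (L powr s) * ennreal (e / L powr s)" by (intro mult_left_mono U(4)) auto
    also have "\<dots> = ennreal e" using \<open>L > 0\<close> \<open>e > 0\<close> by (simp add: ennreal_mult[symmetric])
    finally show ?thesis .
  qed
  ultimately show "\<exists>U. g ` A \<subseteq> (\<Union>i. U i) \<and> (\<forall>i. bounded (U i) \<and> diameter (U i) \<le> \<delta>) \<and>
      (\<Sum>i. diam_power s (U i)) \<le> ennreal e" using bd by (intro exI[of _ V]) simp
qed

lemma hausdorff_dim_le: "0 \<le> s \<Longrightarrow> hausdorff_measure s A = 0 \<Longrightarrow> hausdorff_dim A \<le> ereal s"
  unfolding hausdorff_dim_def by (intro INF_lower) auto

lemma hausdorff_dim_nonneg: "0 \<le> hausdorff_dim A"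
  unfolding hausdorff_dim_def by (intro INF_greatest) auto

lemma hausdorff_dim_transfer:
  assumes "\<And>s. 0 \<le> s \<Longrightarrow> hausdorff_measure s B = 0 \<Longrightarrow> hausdorff_measure s A = 0"
  shows "hausdorff_dim A \<le> hausdorff_dim B"
  unfolding hausdorff_dim_def by (rule INF_superset_mono) (use assms in auto)

lemma hausdorff_dim_mono: "A \<subseteq> B \<Longrightarrow> hausdorff_dim A \<le> hausdorff_dim B"
  by (rule hausdorff_dim_transfer) (rule hausdorff_null_mono)

lemma hausdorff_dim_lipschitz_image:
  assumes "\<And>x y. x \<in> A \<Longrightarrow> y \<in> A \<Longrightarrow> dist (g x) (g y) \<le> L * dist x y" and "L > 0"
  shows "hausdorff_dim (g ` A) \<le> hausdorff_dim A"
  by (rule hausdorff_dim_transfer) (rule hausdorff_null_lipschitz_image[OF assms])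

lemma hausdorff_dim_Un: "hausdorff_dim (A \<union> B) = max (hausdorff_dim A) (hausdorff_dim B)"
proof (rule antisym)
  show "max (hausdorff_dim A) (hausdorff_dim B) \<le> hausdorff_dim (A \<union> B)"
    by (auto intro: hausdorff_dim_mono)
  show "hausdorff_dim (A \<union> B) \<le> max (hausdorff_dim A) (hausdorff_dim B)"
  proof (rule ccontr)
    assume "\<not> ?thesis"
    then have "hausdorff_dim A < hausdorff_dim (A \<union> B)" "hausdorff_dim B < hausdorff_dim (A \<union> B)"
      by (simp_all add: not_le)
    then obtain s t where st: "0 \<le> s" "hausdorff_measure s A = 0" "ereal s < hausdorff_dim (A \<union> B)"
        "0 \<le> t" "hausdorff_measure t B = 0" "ereal t < hausdorff_dim (A \<union> B)"
      unfolding hausdorff_dim_def[of A] hausdorff_dim_def[of B] INF_less_iff by auto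
    have "hausdorff_measure (max s t) (A \<union> B) = 0"
      using st by (intro hausdorff_null_Un) (auto intro: hausdorff_null_exponent_mono)
    then have "hausdorff_dim (A \<union> B) \<le> ereal (max s t)" using st by (intro hausdorff_dim_le) auto
    with st show False by (auto simp: max_def split: if_splits)
  qed
qed

lemma hausdorff_dim_empty: "hausdorff_dim {} = 0"
proof (rule antisym)
  have "hausdorff_measure 0 {} = 0"
    by (rule hausdorff_null_finite_covers) (auto intro!: exI[of _ "{}"])
  then show "hausdorff_dim {} \<le> 0" using hausdorff_dim_le[of 0] by (simp add: zero_ereal_def)
qed (rule hausdorff_dim_nonneg)

lemma hausdorff_dim_singleton: "hausdorff_dim {x} = 0"
proof (rule antisym)
  have "hausdorff_measure s {x} = 0" if "s > 0" for s
    by (rule hausdorff_null_finite_covers)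
       (use that in \<open>auto intro!: exI[of _ "{{x}}"] simp: diam_power_def\<close>)
  then have "hausdorff_dim {x} \<le> ereal s" if "s > 0" for s
    using that by (intro hausdorff_dim_le) auto
  then show "hausdorff_dim {x} \<le> 0"
    by - (rule ereal_le_epsilon2, simp)
qed (rule hausdorff_dim_nonneg)

text \<open>The mass distribution principle, for the image of a finite measure under \<open>f\<close>. The preimages of
  covering sets only have to be contained in measurable sets of small measure, so neither \<open>f\<close> nor \<open>A\<close>
  is required to be measurable.\<close>

lemma mass_distribution_principle:
  fixes f :: "'a \<Rightarrow> 'b::metric_space"
  assumes "finite_measure M" "G \<in> sets M" "emeasure M G > 0" "AE \<omega> in M. \<omega> \<in> G \<longrightarrow> f \<omega> \<in> A"
    and "t > 0" "\<delta>\<^sub>0 > 0" "C > 0"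
    and dom: "\<And>U d. bounded U \<Longrightarrow> diameter U \<le> d \<Longrightarrow> 0 < d \<Longrightarrow> d \<le> \<delta>\<^sub>0 \<Longrightarrow>
      \<exists>V\<in>sets M. {\<omega> \<in> G. f \<omega> \<in> U} \<subseteq> V \<and> emeasure M V \<le> ennreal (C * d powr t)"
  shows "ereal t \<le> hausdorff_dim A"
proof -
  interpret finite_measure M by fact
  have notnull: "hausdorff_measure t A \<noteq> 0"
  proof
    assume null: "hausdorff_measure t A = 0"
    have "emeasure M G \<le> ennreal (C * 2 * e)" if e: "e > 0" "2 * e \<le> \<delta>\<^sub>0 powr t" for e
    proof -
      obtain U where U: "A \<subseteq> (\<Union>i. U i)" "\<And>i. bounded (U i)"
          "(\<Sum>i. diam_power t (U i)) \<le> ennreal e"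
        using null e(1) \<open>\<delta>\<^sub>0 > 0\<close> unfolding hausdorff_measure_eq_0_iff by meson
      define h where "h i = (if U i = {} then 0 else diameter (U i) powr t)" for i
      have h0: "h i \<ge> 0" for i by (simp add: h_def)
      have hU: "diam_power t (U i) = ennreal (h i)" for i
        using \<open>t > 0\<close> by (simp add: h_def diam_power_def)
      have hsum: "(\<Sum>i. ennreal (h i)) \<le> ennreal e" using U(3) by (simp add: hU)
      have he: "h i \<le> e" for i
      proof -
        have "ennreal (h i) = (\<Sum>j\<in>{i}. ennreal (h j))" by simp
        also have "\<dots> \<le> (\<Sum>j. ennreal (h j))" by (rule sum_le_suminf) auto
        also note hsum
        finally show ?thesis using e(1) by simp
      qed
      define k where "k i = h i + e * (1/2) ^ Suc i" for i
      have k0: "k i > 0" for i using h0[of i] e(1) by (simp add: k_def add_nonneg_pos)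
      have kle: "k i \<le> \<delta>\<^sub>0 powr t" for i
      proof -
        have "e * (1/2) ^ Suc i \<le> e * 1" using e(1) by (intro mult_left_mono power_le_one) auto
        with he[of i] e(2) show ?thesis unfolding k_def by linarith
      qed
      \<comment> \<open>Sets of diameter 0 are enlarged: \<open>d i\<close> is positive, bounds the diameter of \<open>U i\<close>, and
        \<open>\<Sum>i. (d i)\<^sup>t\<close> is at most \<open>2 * e\<close>.\<close>
      define d where "d i = k i powr (1 / t)" for i
      have dk: "d i powr t = k i" for i using k0[of i] \<open>t > 0\<close> by (simp add: d_def powr_powr)
      have d0: "d i > 0" for i using k0[of i] by (simp add: d_def)
      have dle: "d i \<le> \<delta>\<^sub>0" for i
      proof -
        have "d i \<le> (\<delta>\<^sub>0 powr t) powr (1 / t)"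
          unfolding d_def using kle[of i] k0[of i] \<open>t > 0\<close> by (intro powr_mono2) auto
        then show ?thesis using \<open>t > 0\<close> \<open>\<delta>\<^sub>0 > 0\<close> by (simp add: powr_powr)
      qed
      have diam: "diameter (U i) \<le> d i" for i
      proof (cases "U i = {}")
        case False
        have "0 \<le> diameter (U i)" using U(2) by (rule diameter_ge_0)
        then have "diameter (U i) = h i powr (1 / t)"
          using False \<open>t > 0\<close> by (cases "diameter (U i) = 0") (auto simp: h_def powr_powr)
        also have "\<dots> \<le> d i" unfolding d_def k_def
          using h0[of i] e(1) \<open>t > 0\<close> by (intro powr_mono2) auto
        finally show ?thesis .
      qed (use d0[of i] in simp)
      have "\<exists>V\<in>sets M. {\<omega> \<in> G. f \<omega> \<in> U i} \<subseteq> V \<and> emeasure M V \<le> ennreal (C * k i)" for i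
        using dom[OF U(2) diam d0 dle, of i] unfolding dk .
      then obtain V where V: "\<And>i. V i \<in> sets M" "\<And>i. {\<omega> \<in> G. f \<omega> \<in> U i} \<subseteq> V i"
          "\<And>i. emeasure M (V i) \<le> ennreal (C * k i)" by metis
      have "emeasure M G \<le> emeasure M (\<Union>i. V i)"
      proof (rule emeasure_mono_AE)
        show "AE x in M. x \<in> G \<longrightarrow> x \<in> (\<Union>i. V i)"
          using assms(4) by eventually_elim (use U(1) V(2) in blast)
        show "(\<Union>i. V i) \<in> sets M" using V(1) by auto
      qed
      also have "\<dots> \<le> (\<Sum>i. emeasure M (V i))"
        by (rule emeasure_subadditive_countably) (use V(1) in auto)
      also have "\<dots> \<le> (\<Sum>i. ennreal (C * k i))" by (intro suminf_le V(3)) auto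
      also have "\<dots> = (\<Sum>i. ennreal C * (ennreal (h i) + ennreal (e * (1/2) ^ Suc i)))"
        using h0 e(1) \<open>C > 0\<close>
        by (intro suminf_cong) (simp add: k_def ennreal_mult[symmetric] ennreal_plus[symmetric] del: ennreal_plus power_Suc)
      also have "\<dots> = ennreal C * ((\<Sum>i. ennreal (h i)) + (\<Sum>i. ennreal (e * (1/2) ^ Suc i)))"
        by (simp add: suminf_add[symmetric] del: power_Suc)
      also have "(\<Sum>i. ennreal (e * (1/2) ^ Suc i)) = ennreal e"
        using sums_mult[OF power_half_series, of e] e(1) by (intro suminf_ennreal_eq) auto
      also have "ennreal C * ((\<Sum>i. ennreal (h i)) + ennreal e) \<le> ennreal C * (ennreal e + ennreal e)"
        by (intro mult_left_mono add_mono hsum) auto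
      also have "\<dots> = ennreal (C * 2 * e)"
        using e(1) \<open>C > 0\<close> by (simp add: ennreal_mult[symmetric] ennreal_plus[symmetric] del: ennreal_plus)
      finally show ?thesis .
    qed
    note bound = this
    have pos: "measure M G > 0" using assms(3) by (simp add: emeasure_eq_measure)
    define e where "e = min (\<delta>\<^sub>0 powr t / 2) (measure M G / (4 * C))"
    have "e > 0" "2 * e \<le> \<delta>\<^sub>0 powr t" using pos \<open>\<delta>\<^sub>0 > 0\<close> \<open>C > 0\<close> by (auto simp: e_def)
    from bound[OF this] have "measure M G \<le> C * 2 * e"
      using \<open>e > 0\<close> \<open>C > 0\<close> by (simp add: emeasure_eq_measure)
    also have "\<dots> \<le> C * 2 * (measure M G / (4 * C))"
      unfolding e_def using \<open>C > 0\<close> by (intro mult_left_mono) auto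
    also have "\<dots> = measure M G / 2" using \<open>C > 0\<close> by simp
    finally show False using pos by simp
  qed
  show ?thesis unfolding hausdorff_dim_def
  proof (rule INF_greatest)
    fix s assume "s \<in> {s. 0 \<le> s \<and> hausdorff_measure s A = 0}"
    then show "ereal t \<le> ereal s"
      using notnull hausdorff_null_exponent_mono[of s A t] by (cases "s \<le> t") auto
  qed
qed

section \<open>The strong law of large numbers for finitely many values\<close>

text \<open>By Hoeffding's inequality the probability of a fixed deviation of the average decays exponentially,
  hence is summable, and the Borel--Cantelli lemma applies.\<close>

lemma AE_average_tendsto_expectation:
  fixes R :: "'a pmf" and g :: "'a \<Rightarrow> real"
  assumes "finite (set_pmf R)"
  shows "AE \<omega> in PiM (UNIV :: nat set) (\<lambda>_. measure_pmf R).
    (\<lambda>n. (\<Sum>k<n. g (\<omega> k)) / real n) \<longlonglongrightarrow> measure_pmf.expectation R g"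
proof -
  interpret product_prob_space "\<lambda>_. measure_pmf R" "UNIV :: nat set" ..
  let ?M = "PiM (UNIV :: nat set) (\<lambda>_. measure_pmf R)"
  define b where "b = (\<Sum>x\<in>set_pmf R. \<bar>g x\<bar>) + 1"
  have gb: "\<bar>g x\<bar> < b" if "x \<in> set_pmf R" for x
    using member_le_sum[OF that, of "\<lambda>x. \<bar>g x\<bar>"] assms by (simp add: b_def)
  have "b \<ge> 1" unfolding b_def by (simp add: sum_nonneg)
  have comp: "(\<lambda>\<omega>. \<omega> i) \<in> measurable ?M (measure_pmf R)" for i
    by (rule measurable_component_singleton) simp
  have X[measurable]: "(\<lambda>\<omega>. g (\<omega> i)) \<in> borel_measurable ?M" for i
    by (rule measurable_compose[OF comp]) simp
  have indep: "P.indep_vars (\<lambda>_. borel) (\<lambda>i \<omega>. g (\<omega> i)) {..<n}" for n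
  proof (cases "n = 0")
    case True
    then show ?thesis by (simp add: P.indep_vars_def P.indep_sets_def)
  next
    case False
    have "P.indep_vars (\<lambda>_. measure_pmf R) (\<lambda>i \<omega>. \<omega> i) {..<n}"
    proof (subst P.indep_vars_iff_distr_eq_PiM)
      show "distr ?M (PiM {..<n} (\<lambda>_. measure_pmf R)) (\<lambda>\<omega>. \<lambda>i\<in>{..<n}. \<omega> i) =
          PiM {..<n} (\<lambda>i. distr ?M (measure_pmf R) (\<lambda>\<omega>. \<omega> i))"
        using distr_PiM_restrict_finite[of "{..<n}"] by (simp add: PiM_component)
    qed (use False comp in auto)
    then show ?thesis by (rule P.indep_vars_compose2) simp
  qed
  define E where "E = measure_pmf.expectation R g"
  have distr_eq: "distr ?M borel (\<lambda>\<omega>. g (\<omega> i)) = distr (measure_pmf R) borel g" for i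
  proof -
    have "distr ?M borel (\<lambda>\<omega>. g (\<omega> i)) = distr (distr ?M (measure_pmf R) (\<lambda>\<omega>. \<omega> i)) borel g"
      by (subst distr_distr) (use comp in \<open>auto simp: comp_def\<close>)
    then show ?thesis by (simp add: PiM_component)
  qed
  have E: "P.expectation (\<lambda>\<omega>. g (\<omega> 0)) = E"
  proof -
    have "P.expectation (\<lambda>\<omega>. g (\<omega> 0)) = (\<integral>x. x \<partial>distr ?M borel (\<lambda>\<omega>. g (\<omega> 0)))"
      by (subst integral_distr) auto
    also have "\<dots> = E" unfolding distr_eq E_def by (subst integral_distr) auto
    finally show ?thesis .
  qed
  define S where "S = (\<lambda>n \<omega>. (\<Sum>k<n. g (\<omega> k)) / real n)"
  have bound: "P.prob {\<omega> \<in> space ?M. \<epsilon> \<le> \<bar>S n \<omega> - E\<bar>} \<le> 2 * exp (-2 * real n * \<epsilon>\<^sup>2 / (b - - b)\<^sup>2)"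
    if "\<epsilon> > 0" "n > 0" for \<epsilon> n
  proof -
    interpret Hoeffding_ineq_iid ?M "{..<n}" "\<lambda>i \<omega>. g (\<omega> i)" "\<lambda>\<omega>. g (\<omega> 0)" "- b" b E
    proof unfold_locales
      show "AE x in ?M. g (x 0) \<in> {- b..b}"
        by (rule AE_component) (use gb in \<open>force simp: AE_measure_pmf_iff\<close>)+
    qed (use indep in \<open>auto simp: distr_eq E\<close>)
    have "- b < b" using \<open>b \<ge> 1\<close> by simp
    then show ?thesis using Hoeffding_ineq_abs_ge'[of \<epsilon>] that by (auto simp: S_def lessThan_empty_iff)
  qed
  have "AE \<omega> in ?M. eventually (\<lambda>n. \<omega> \<in> space ?M - {\<omega> \<in> space ?M. \<epsilon> \<le> \<bar>S n \<omega> - E\<bar>}) sequentially"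
    if "\<epsilon> > 0" for \<epsilon>
  proof (rule borel_cantelli_AE1)
    show "{\<omega> \<in> space ?M. \<epsilon> \<le> \<bar>S n \<omega> - E\<bar>} \<in> sets ?M" for n unfolding S_def by measurable
    define c where "c = 2 * \<epsilon>\<^sup>2 / (b - - b)\<^sup>2"
    have "c > 0" using that \<open>b \<ge> 1\<close> by (simp add: c_def)
    have "summable (\<lambda>n. 2 * exp (- c) ^ n)"
      using \<open>c > 0\<close> by (intro summable_mult summable_geometric) auto
    then show "summable (\<lambda>n. P.prob {\<omega> \<in> space ?M. \<epsilon> \<le> \<bar>S n \<omega> - E\<bar>})"
    proof (rule summable_comparison_test'[of _ 1])
      fix n :: nat assume "1 \<le> n"
      have "exp (-2 * real n * \<epsilon>\<^sup>2 / (b - - b)\<^sup>2) = exp (- c) ^ n"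
        by (simp add: exp_of_nat_mult[symmetric] c_def)
      then show "norm (P.prob {\<omega> \<in> space ?M. \<epsilon> \<le> \<bar>S n \<omega> - E\<bar>}) \<le> 2 * exp (- c) ^ n"
        using bound[OF that, of n] \<open>1 \<le> n\<close> by simp
    qed
  qed (simp add: P.emeasure_eq_measure)
  then have "AE \<omega> in ?M. \<forall>m. eventually (\<lambda>n. \<bar>S n \<omega> - E\<bar> < 1 / real (Suc m)) sequentially"
    unfolding AE_all_countable
  proof (intro allI)
    fix m assume "\<And>\<epsilon>. 0 < \<epsilon> \<Longrightarrow> AE \<omega> in ?M. eventually
        (\<lambda>n. \<omega> \<in> space ?M - {\<omega> \<in> space ?M. \<epsilon> \<le> \<bar>S n \<omega> - E\<bar>}) sequentially"
    from this[of "1 / real (Suc m)"]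
    show "AE \<omega> in ?M. eventually (\<lambda>n. \<bar>S n \<omega> - E\<bar> < 1 / real (Suc m)) sequentially"
      by (auto elim!: eventually_mono)
  qed
  then show ?thesis
  proof eventually_elim
    case (elim \<omega>)
    have "(\<lambda>n. S n \<omega>) \<longlonglongrightarrow> E"
    proof (rule tendstoI)
      fix e :: real assume "e > 0"
      then obtain m where "1 / real (Suc m) < e" using nat_approx_posE by metis
      with elim have "eventually (\<lambda>n. \<bar>S n \<omega> - E\<bar> < 1 / real (Suc m)) sequentially" by blast
      then show "eventually (\<lambda>n. dist (S n \<omega>) E < e) sequentially"
        by eventually_elim (use \<open>1 / real (Suc m) < e\<close> in \<open>simp add: dist_real_def\<close>)
    qed
    then show ?case by (simp add: S_def E_def)
  qed
qed

section \<open>Gibbs weights\<close>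

text \<open>The sum is the derivative of \<open>\<Sum>i. exp (q * u i)\<close> in \<open>q\<close>.\<close>

lemma exp_weighted_sum_pos:
  fixes u :: "'a \<Rightarrow> real"
  assumes "finite Z" "m \<in> Z" "u m > 0"
  shows "\<exists>q\<ge>0. (\<Sum>i\<in>Z. u i * exp (q * u i)) > 0"
proof -
  define s where "s = (\<Sum>i\<in>Z - {m}. \<bar>u i\<bar>)"
  have "s \<ge> 0" unfolding s_def by (intro sum_nonneg) auto
  \<comment> \<open>For this \<open>q\<close> the term of \<open>m\<close>, bounded below by \<open>u m * (1 + q * u m) = u m + s\<close>, outweighs the
    possible negative terms.\<close>
  define q where "q = s / (u m)\<^sup>2"
  have "q \<ge> 0" using \<open>s \<ge> 0\<close> by (simp add: q_def)
  have "u i * exp (q * u i) \<ge> - \<bar>u i\<bar>" for i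
  proof (cases "u i \<ge> 0")
    case True
    then have "u i * exp (q * u i) \<ge> 0" by simp
    with True show ?thesis by linarith
  next
    case False
    have "exp (q * u i) \<le> 1" using False \<open>q \<ge> 0\<close> by (simp add: mult_nonneg_nonpos)
    then have "u i * exp (q * u i) \<ge> u i * 1" using False by (intro mult_left_mono_neg) auto
    with False show ?thesis by simp
  qed
  then have "(\<Sum>i\<in>Z - {m}. u i * exp (q * u i)) \<ge> (\<Sum>i\<in>Z - {m}. - \<bar>u i\<bar>)"
    by (intro sum_mono) auto
  moreover have "u m * exp (q * u m) \<ge> u m * (1 + q * u m)"
    using assms(3) exp_ge_add_one_self by (intro mult_left_mono) auto
  moreover have "u m * (1 + q * u m) = u m + s"
    using assms(3) by (simp add: q_def field_simps power2_eq_square)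
  ultimately have "(\<Sum>i\<in>Z. u i * exp (q * u i)) \<ge> u m"
    using assms(1,2) by (simp add: sum.remove[of Z m] sum_negf s_def)
  with assms(3) \<open>q \<ge> 0\<close> show ?thesis by (intro exI[of _ q]) auto
qed

text \<open>The degenerate case, where the infimum over \<open>q\<close> is approached as \<open>q\<close> tends to infinity: only the
  indices with \<open>u i = 0\<close> survive in the limit.\<close>

lemma uniform_weights_entropy:
  fixes u :: "'a \<Rightarrow> real"
  assumes "finite Z" "\<And>i. i \<in> Z \<Longrightarrow> u i \<le> 0" "m \<in> Z" "u m = 0"
  defines "\<rho> \<equiv> \<lambda>i. if i \<in> Z \<and> u i = 0 then 1 / real (card {i\<in>Z. u i = 0}) else 0"
  shows "(\<forall>i\<in>Z. \<rho> i \<ge> 0) \<and> sum \<rho> Z = 1 \<and> (\<Sum>i\<in>Z. \<rho> i * u i) = 0 \<and>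
    (\<forall>r. (\<forall>q. r \<le> ln (\<Sum>i\<in>Z. exp (q * u i))) \<longrightarrow> r \<le> - (\<Sum>i\<in>Z. \<rho> i * ln (\<rho> i)))"
proof (intro conjI allI impI)
  define N where "N = card {i\<in>Z. u i = 0}"
  have "N > 0" unfolding N_def using assms(1,3,4) by (auto simp: card_gt_0_iff)
  have sum_eq: "(\<Sum>i\<in>Z. if i \<in> Z \<and> u i = 0 then c else 0) = real N * c" for c
    using assms(1) by (simp add: N_def sum.If_cases Int_def conj_commute)
  show "\<forall>i\<in>Z. \<rho> i \<ge> 0" by (simp add: \<rho>_def)
  show "sum \<rho> Z = 1" unfolding \<rho>_def sum_eq using \<open>N > 0\<close> by (simp add: N_def)
  show "(\<Sum>i\<in>Z. \<rho> i * u i) = 0" by (rule sum.neutral) (simp add: \<rho>_def)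
  have ent: "- (\<Sum>i\<in>Z. \<rho> i * ln (\<rho> i)) = ln (real N)"
  proof -
    have "(\<Sum>i\<in>Z. \<rho> i * ln (\<rho> i)) = (\<Sum>i\<in>Z. if i \<in> Z \<and> u i = 0 then 1 / real N * ln (1 / real N) else 0)"
      by (intro sum.cong) (auto simp: \<rho>_def N_def)
    also have "\<dots> = ln (1 / real N)" unfolding sum_eq using \<open>N > 0\<close> by simp
    finally show ?thesis using \<open>N > 0\<close> by (simp add: ln_div)
  qed
  fix r assume r: "\<forall>q. r \<le> ln (\<Sum>i\<in>Z. exp (q * u i))"
  have "(\<lambda>n. \<Sum>i\<in>Z. exp (real n * u i)) \<longlonglongrightarrow> (\<Sum>i\<in>Z. if i \<in> Z \<and> u i = 0 then 1 else 0)"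
  proof (intro tendsto_sum)
    fix i assume "i \<in> Z"
    show "(\<lambda>n. exp (real n * u i)) \<longlonglongrightarrow> (if i \<in> Z \<and> u i = 0 then 1 else 0)"
    proof (cases "u i = 0")
      case False
      then have "exp (u i) < 1" using assms(2)[OF \<open>i \<in> Z\<close>] by simp
      then have "(\<lambda>n. exp (u i) ^ n) \<longlonglongrightarrow> 0" by (intro LIMSEQ_realpow_zero) auto
      then show ?thesis using False by (simp add: exp_of_nat_mult)
    qed (use \<open>i \<in> Z\<close> in auto)
  qed
  then have "(\<lambda>n. ln (\<Sum>i\<in>Z. exp (real n * u i))) \<longlonglongrightarrow> ln (real N)"
    unfolding sum_eq using \<open>N > 0\<close> by (intro tendsto_ln) auto
  then have "r \<le> ln (real N)" by (rule LIMSEQ_le_const) (use r in auto)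
  then show "r \<le> - (\<Sum>i\<in>Z. \<rho> i * ln (\<rho> i))" by (simp add: ent)
qed

text \<open>If 0 lies between the extreme values of \<open>u\<close>, some probability vector \<open>\<rho>\<close> gives \<open>u\<close> the mean 0 and has
  entropy at least the infimum over \<open>q\<close> of \<open>ln (\<Sum>i. exp (q * u i))\<close>. Quantifying over the lower bounds
  \<open>r\<close> avoids any assumption on that infimum. If \<open>u\<close> takes both signs, the intermediate value theorem
  yields a critical point \<open>q\<close>, and \<open>\<rho> i\<close> is proportional to \<open>exp (q * u i)\<close>.\<close>

lemma gibbs_weights:
  fixes u :: "'a \<Rightarrow> real"
  assumes fin: "finite Z" and "m \<in> Z" "u m \<ge> 0" "n \<in> Z" "u n \<le> 0"
  shows "\<exists>\<rho>. (\<forall>i\<in>Z. \<rho> i \<ge> 0) \<and> sum \<rho> Z = 1 \<and> (\<Sum>i\<in>Z. \<rho> i * u i) = 0 \<and>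
    (\<forall>r. (\<forall>q. r \<le> ln (\<Sum>i\<in>Z. exp (q * u i))) \<longrightarrow> r \<le> - (\<Sum>i\<in>Z. \<rho> i * ln (\<rho> i)))"
    (is "\<exists>\<rho>. ?P u \<rho>")
proof -
  consider "\<forall>i\<in>Z. u i \<le> 0" | "\<forall>i\<in>Z. - u i \<le> 0" | i j where "i \<in> Z" "j \<in> Z" "u i > 0" "u j < 0"
    by force
  then show ?thesis
  proof cases
    case 1
    then have "u m = 0" using assms by force
    with 1 assms show ?thesis by (intro exI) (rule uniform_weights_entropy[of Z u m], auto)
  next
    case 2
    then have "- u n = 0" using assms by force
    with 2 assms have "\<exists>\<rho>. ?P (\<lambda>i. - u i) \<rho>"
      by (intro exI) (rule uniform_weights_entropy[of Z "\<lambda>i. - u i" n], auto)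
    then obtain \<rho> where \<rho>: "?P (\<lambda>i. - u i) \<rho>" ..
    have "r \<le> - (\<Sum>i\<in>Z. \<rho> i * ln (\<rho> i))" if "\<forall>q. r \<le> ln (\<Sum>i\<in>Z. exp (q * u i))" for r
    proof -
      have "r \<le> ln (\<Sum>i\<in>Z. exp (q * - u i))" for q using that[rule_format, of "- q"] by simp
      with \<rho>[THEN conjunct2, THEN conjunct2, THEN conjunct2, rule_format, of r] show ?thesis by simp
    qed
    moreover have "(\<Sum>i\<in>Z. \<rho> i * u i) = 0" using \<rho> by (simp add: sum_negf)
    ultimately show ?thesis using \<rho> by (intro exI[of _ \<rho>] conjI allI impI) simp_all
  next
    case (3 i j)
    define D where "D q = (\<Sum>i\<in>Z. u i * exp (q * u i))" for q
    obtain q1 where q1: "q1 \<ge> 0" "D q1 > 0"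
      using exp_weighted_sum_pos[of Z i u] 3 fin unfolding D_def by blast
    obtain q2 where q2: "q2 \<ge> 0" "(\<Sum>i\<in>Z. - u i * exp (q2 * - u i)) > 0"
      using exp_weighted_sum_pos[of Z j "\<lambda>i. - u i"] 3 fin by auto
    have "D (- q2) = - (\<Sum>i\<in>Z. - u i * exp (q2 * - u i))"
      unfolding D_def by (simp add: sum_negf)
    then have "D (- q2) < 0" using q2 by simp
    moreover have "continuous_on {- q2..q1} D" unfolding D_def by (intro continuous_intros)
    ultimately obtain q where q: "D q = 0"
      using IVT'[of D "- q2" 0 q1] q1 q2 by auto
    define F where "F = (\<Sum>i\<in>Z. exp (q * u i))"
    have "F > 0" unfolding F_def using fin 3(1) by (intro sum_pos) auto
    define \<rho> where "\<rho> i = exp (q * u i) / F" for i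
    have s1: "sum \<rho> Z = 1"
      using \<open>F > 0\<close> by (simp add: \<rho>_def sum_divide_distrib[symmetric] F_def[symmetric])
    have "(\<Sum>i\<in>Z. \<rho> i * u i) = D q / F"
      by (simp add: \<rho>_def D_def sum_divide_distrib mult.commute)
    then have s2: "(\<Sum>i\<in>Z. \<rho> i * u i) = 0" using q by simp
    have "(\<Sum>i\<in>Z. \<rho> i * ln (\<rho> i)) = (\<Sum>i\<in>Z. q * (\<rho> i * u i) - \<rho> i * ln F)"
      by (intro sum.cong refl) (use \<open>F > 0\<close> in \<open>simp add: \<rho>_def ln_div algebra_simps diff_divide_distrib\<close>)
    also have "\<dots> = q * (\<Sum>i\<in>Z. \<rho> i * u i) - sum \<rho> Z * ln F"
      by (simp add: sum_subtractf sum_distrib_left sum_distrib_right)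
    finally have "- (\<Sum>i\<in>Z. \<rho> i * ln (\<rho> i)) = ln F" using s1 s2 by simp
    then have "r \<le> - (\<Sum>i\<in>Z. \<rho> i * ln (\<rho> i))" if "\<forall>q. r \<le> ln (\<Sum>i\<in>Z. exp (q * u i))" for r
      using that[rule_format, of q] by (simp add: F_def)
    moreover have "\<forall>i\<in>Z. \<rho> i \<ge> 0" using \<open>F > 0\<close> by (simp add: \<rho>_def)
    ultimately show ?thesis using s1 s2 by (intro exI[of _ \<rho>] conjI allI impI) simp_all
  qed
qed

lemma pmf_of_weights:
  fixes \<rho> :: "'a \<Rightarrow> real"
  assumes "finite Z" "\<And>i. i \<in> Z \<Longrightarrow> \<rho> i \<ge> 0" "sum \<rho> Z = 1"
  obtains R where "set_pmf R \<subseteq> Z" "\<And>i. i \<in> Z \<Longrightarrow> pmf R i = \<rho> i"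
proof -
  define f where "f i = (if i \<in> Z then \<rho> i else 0)" for i
  have nn: "0 \<le> f i" for i using assms(2) by (simp add: f_def)
  have "(\<integral>\<^sup>+ x. ennreal (f x) \<partial>count_space UNIV) = (\<Sum>x\<in>Z. ennreal (f x))"
    by (rule nn_integral_count_space'[OF assms(1)]) (auto simp: f_def)
  also have "\<dots> = 1" using assms by (simp add: f_def sum_ennreal)
  finally have one: "(\<integral>\<^sup>+ x. ennreal (f x) \<partial>count_space UNIV) = 1" .
  show thesis
  proof
    show "set_pmf (embed_pmf f) \<subseteq> Z" using set_embed_pmf[of f, OF nn one] by (auto simp: f_def split: if_splits)
    show "pmf (embed_pmf f) i = \<rho> i" if "i \<in> Z" for i
      using pmf_embed_pmf[of f, OF nn one] that by (simp add: f_def)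
  qed
qed

section \<open>Adic digits\<close>

text \<open>The number \<open>k\<close> of the \<open>l\<close>-adic interval \<open>[k / l\<^sup>n, (k + 1) / l\<^sup>n)\<close> of level \<open>n\<close> that represents \<open>x\<close>; the
  point 1 is represented by the last interval.\<close>

definition adic_index :: "nat \<Rightarrow> nat \<Rightarrow> real \<Rightarrow> nat" where
  "adic_index l n x = (if x = 1 then l ^ n - 1 else nat \<lfloor>x * real l ^ n\<rfloor>)"

text \<open>The digits of \<open>x\<close>, numbered from 0. All digits of 1 are \<open>l - 1\<close>, and no other point of the unit
  interval has digits that are eventually \<open>l - 1\<close>.\<close>

definition adic_digit :: "nat \<Rightarrow> real \<Rightarrow> nat \<Rightarrow> nat" where
  "adic_digit l x n = adic_index l (Suc n) x mod l"

text \<open>The first \<open>n\<close> digits, the most significant one at the head of the list.\<close>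

definition adic_word :: "nat \<Rightarrow> real \<Rightarrow> nat \<Rightarrow> nat list" where
  "adic_word l x n = map (adic_digit l x) [0..<n]"

text \<open>The integer with the given digits in base \<open>l\<close>, most significant digit first.\<close>

primrec word_index :: "nat \<Rightarrow> nat list \<Rightarrow> nat" where
  "word_index l [] = 0"
| "word_index l (j # w) = j * l ^ length w + word_index l w"

text \<open>The point with the given sequence of digits.\<close>

definition digit_sum :: "nat \<Rightarrow> (nat \<Rightarrow> nat) \<Rightarrow> real" where
  "digit_sum l \<omega> = (\<Sum>k. real (\<omega> k) / real l ^ Suc k)"

lemma adic_index_bounds:
  assumes "l \<ge> 2" "x \<in> {0..1}"
  shows "real (adic_index l n x) \<le> x * real l ^ n" "x * real l ^ n \<le> real (adic_index l n x) + 1"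
    "x \<noteq> 1 \<Longrightarrow> x * real l ^ n < real (adic_index l n x) + 1" "adic_index l n x < l ^ n"
proof -
  have N: "real (l ^ n - 1) = real l ^ n - 1" "l ^ n > 0" using assms by (auto simp: of_nat_diff)
  have fl: "real (adic_index l n x) = of_int \<lfloor>x * real l ^ n\<rfloor>" if "x \<noteq> 1"
    using that assms by (simp add: adic_index_def)
  show 1: "real (adic_index l n x) \<le> x * real l ^ n"
    using fl N by (cases "x = 1") (auto simp: adic_index_def)
  have 2: "x * real l ^ n < real (adic_index l n x) + 1" if "x \<noteq> 1"
    unfolding fl[OF that] by (rule real_of_int_floor_add_one_gt)
  then show "x \<noteq> 1 \<Longrightarrow> x * real l ^ n < real (adic_index l n x) + 1" .
  show "x * real l ^ n \<le> real (adic_index l n x) + 1"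
    using 2 N by (cases "x = 1") (auto simp: adic_index_def)
  show "adic_index l n x < l ^ n"
  proof (cases "x = 1")
    case False
    then have "x * real l ^ n < 1 * real l ^ n" using assms by (intro mult_strict_right_mono) auto
    with 1 have "real (adic_index l n x) < real l ^ n" by linarith
    then show ?thesis by simp
  qed (use N in \<open>auto simp: adic_index_def\<close>)
qed

lemma adic_index_unique:
  assumes "x \<noteq> 1" "real k \<le> x * real l ^ n" "x * real l ^ n < real k + 1"
  shows "adic_index l n x = k"
proof -
  have "\<lfloor>x * real l ^ n\<rfloor> = int k" using assms by (intro floor_unique) auto
  then show ?thesis using assms(1) by (simp add: adic_index_def)
qed

lemma adic_interval_eq:
  assumes "l \<ge> 2" "x \<in> {0..1}"
  shows "adic_interval l n x =
    {real (adic_index l n x) / real l ^ n ..< (real (adic_index l n x) + 1) / real l ^ n}"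
    (is "_ = {real ?k / _ ..< _}")
proof (cases "x = 1")
  case True
  have "real (l ^ n - 1) = real l ^ n - 1" "real l ^ n \<noteq> 0" using assms(1) by (auto simp: of_nat_diff)
  then show ?thesis using True assms(1) by (simp add: adic_interval_def adic_index_def)
next
  case False
  have pos: "real l ^ n > 0" using assms(1) by simp
  have mem: "x \<in> {real ?k / real l ^ n ..< (real ?k + 1) / real l ^ n}"
    using adic_index_bounds(1,3)[OF assms(1,2), of n] False pos by (simp add: field_simps)
  have "{real ?k / real l ^ n ..< (real ?k + 1) / real l ^ n} \<in> adic_intervals l n"
    using adic_index_bounds(4)[OF assms(1,2)] by (auto simp: adic_intervals_def)
  moreover have "x \<in> {0..<1}" using assms(2) False by auto
  ultimately show ?thesis
    using adic_interval_unique[OF assms(1), of x n] mem False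
    by (auto simp: adic_interval_def intro!: the1_equality)
qed

lemma adic_index_Suc:
  assumes "l \<ge> 2" "x \<in> {0..1}"
  shows "adic_index l (Suc n) x = l * adic_index l n x + adic_digit l x n"
proof -
  have "adic_index l (Suc n) x div l = adic_index l n x"
  proof (rule div_nat_eqI)
    have l: "real l > 0" using assms(1) by simp
    have "real (l * adic_index l n x) \<le> x * real l ^ Suc n"
      using mult_left_mono[OF adic_index_bounds(1)[OF assms, of n], of "real l"] l by (simp add: mult_ac)
    note le = this
    have "l * (l ^ n - 1) = l ^ Suc n - l" by (simp add: diff_mult_distrib2)
    then have le1: "l * (l ^ n - 1) \<le> l ^ Suc n - 1" using assms(1) by (simp add: mult.commute)
    show "l * adic_index l n x \<le> adic_index l (Suc n) x"
    proof (cases "x = 1")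
      case False
      then have "real (l * adic_index l n x) < real (adic_index l (Suc n) x) + 1"
        using le adic_index_bounds(3)[OF assms, of "Suc n"] by linarith
      then have "real (l * adic_index l n x) < real (adic_index l (Suc n) x + 1)" by simp
      then have "l * adic_index l n x < adic_index l (Suc n) x + 1" by (simp only: of_nat_less_iff)
      then show ?thesis by (simp add: mult.commute)
    qed (use le1 in \<open>simp add: adic_index_def\<close>)
    show "adic_index l (Suc n) x < l * Suc (adic_index l n x)"
    proof (cases "x = 1")
      case True
      have "l ^ n > 0" using assms(1) by simp
      then show ?thesis using True assms(1) by (simp add: adic_index_def mult.commute)
    next
      case False
      have "real (adic_index l (Suc n) x) \<le> x * real l ^ Suc n"
        by (rule adic_index_bounds(1)[OF assms])
      also have "\<dots> < real l * (real (adic_index l n x) + 1)"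
        using mult_strict_left_mono[OF adic_index_bounds(3)[OF assms False, of n] l] by (simp add: mult_ac)
      finally have "real (adic_index l (Suc n) x) < real (l * Suc (adic_index l n x))"
        by (simp add: algebra_simps)
      then show ?thesis by linarith
    qed
  qed
  then show ?thesis unfolding adic_digit_def by (metis mult_div_mod_eq)
qed

lemma adic_digit_less: "l \<ge> 2 \<Longrightarrow> adic_digit l x n < l"
  by (simp add: adic_digit_def)

lemma set_adic_word: "l \<ge> 2 \<Longrightarrow> set (adic_word l x n) \<subseteq> {..<l}"
  by (auto simp: adic_word_def adic_digit_less)

lemma word_index_snoc: "word_index l (w @ [d]) = l * word_index l w + d"
  by (induction w) (auto simp: algebra_simps)

lemma word_index_less: "set w \<subseteq> {..<l} \<Longrightarrow> word_index l w < l ^ length w"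
proof (induction w)
  case (Cons j w)
  then have "word_index l w < l ^ length w" "Suc j \<le> l" by auto
  then have "j * l ^ length w + word_index l w < Suc j * l ^ length w" by simp
  also have "\<dots> \<le> l * l ^ length w" using \<open>Suc j \<le> l\<close> by (rule mult_le_mono1)
  finally show ?case by simp
qed simp

lemma word_index_adic_word:
  assumes "l \<ge> 2" "x \<in> {0..1}"
  shows "word_index l (adic_word l x n) = adic_index l n x"
proof (induction n)
  case 0
  have "adic_index l 0 x < l ^ 0" by (rule adic_index_bounds(4)[OF assms])
  then show ?case by (simp add: adic_word_def)
next
  case (Suc n)
  then show ?case
    using adic_index_Suc[OF assms, of n] by (simp add: adic_word_def word_index_snoc)
qed

lemma word_index_reflect:
  assumes "set w \<subseteq> {..<l}"
  shows "word_index l (map (\<lambda>d. l - Suc d) w) + word_index l w + 1 = l ^ length w"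
  using assms
proof (induction w)
  case (Cons j w)
  then have j: "l = (l - Suc j) + j + 1" by auto
  have "l ^ length (j # w) = ((l - Suc j) + j + 1) * l ^ length w" using j by simp
  also have "\<dots> = (l - Suc j) * l ^ length w + j * l ^ length w + l ^ length w"
    by (simp add: algebra_simps)
  finally show ?case using Cons by simp
qed simp

lemma adic_word_one: "l \<ge> 2 \<Longrightarrow> adic_word l 1 n = replicate n (l - 1)"
proof -
  assume l: "l \<ge> 2"
  have "adic_digit l 1 = (\<lambda>_. l - 1)"
  proof
    fix k
    have "l ^ Suc k - 1 = l * (l ^ k - 1) + (l - 1)"
    proof -
      have "l ^ k > 0" using l by simp
      then obtain m where "l ^ k = Suc m" by (metis gr0_implies_Suc)
      then show ?thesis using l by simp
    qed
    then have "adic_index l (Suc k) 1 = l * (l ^ k - 1) + (l - 1)" by (simp add: adic_index_def)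
    then have "adic_digit l 1 k = (l * (l ^ k - 1) + (l - 1)) mod l"
      unfolding adic_digit_def by (rule arg_cong)
    then show "adic_digit l 1 k = l - 1" using l by (simp only: mod_mult_self4) simp
  qed
  then show ?thesis by (simp add: adic_word_def map_replicate_const)
qed

lemma adic_word_zero: "adic_word l 0 n = replicate n 0"
proof -
  have "adic_digit l 0 = (\<lambda>_. 0)" by (simp add: adic_digit_def adic_index_def fun_eq_iff)
  then show ?thesis by (simp add: adic_word_def map_replicate_const)
qed

text \<open>Prepending a digit is an inverse branch of \<open>x \<mapsto> l x mod 1\<close>.\<close>

lemma adic_word_prepend:
  assumes "l \<ge> 2" "x \<in> {0..<1}" "j < l"
  defines "y \<equiv> (x + real j) / real l"
  shows "y \<in> {0..<1}" "adic_word l y (Suc n) = j # adic_word l x n"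
proof -
  have "x + real j < real l" using assms(2,3) by auto
  then show y: "y \<in> {0..<1}" using assms(1,2) by (auto simp: y_def)
  have idx: "adic_index l (Suc m) y = j * l ^ m + adic_index l m x" for m
  proof (rule adic_index_unique)
    show "y \<noteq> 1" using y by auto
    have e: "y * real l ^ Suc m = real j * real l ^ m + x * real l ^ m"
      using assms(1) by (simp add: y_def field_simps)
    show "real (j * l ^ m + adic_index l m x) \<le> y * real l ^ Suc m"
      unfolding e using adic_index_bounds(1)[of l x m] assms(1,2) by simp
    show "y * real l ^ Suc m < real (j * l ^ m + adic_index l m x) + 1"
      unfolding e using adic_index_bounds(3)[of l x m] assms(1,2) by simp
  qed
  have "adic_index l 0 x = 0" using adic_index_bounds(4)[of l x 0] assms(1,2) by simp
  then have "adic_digit l y 0 = j" using idx[of 0] assms(3) by (simp add: adic_digit_def)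
  moreover have "adic_digit l y (Suc k) = adic_digit l x k" for k
  proof -
    have "j * l ^ Suc k = l * (j * l ^ k)" by simp
    then show ?thesis unfolding adic_digit_def idx by (metis mod_mult_self4)
  qed
  ultimately show "adic_word l y (Suc n) = j # adic_word l x n"
    by (simp add: adic_word_def upt_conv_Cons map_Suc_upt[symmetric] del: upt_Suc)
qed

lemma summable_digit_sum:
  assumes "l \<ge> 2" "\<And>k. \<omega> k < l"
  shows "summable (\<lambda>k. real (\<omega> k) / real l ^ Suc k)"
proof (rule summable_comparison_test')
  show "summable (\<lambda>k. (1 / real l) ^ k)" using assms(1) by (intro summable_geometric) auto
  fix k :: nat
  have "real (\<omega> k) / real l ^ Suc k \<le> real l / real l ^ Suc k"
    using assms(2)[of k] by (intro divide_right_mono) auto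
  also have "\<dots> = (1 / real l) ^ k" using assms(1) by (simp add: power_one_over)
  finally show "norm (real (\<omega> k) / real l ^ Suc k) \<le> (1 / real l) ^ k" by simp
qed

lemma digit_sum_bounds:
  assumes l: "l \<ge> 2" and \<omega>: "\<And>k. \<omega> k < l" and "\<omega> m \<noteq> l - 1"
  shows "digit_sum l \<omega> \<in> {0..<1}"
proof -
  note sm = summable_digit_sum[of l, OF l]
  have "digit_sum l \<omega> \<ge> 0" unfolding digit_sum_def using sm[OF \<omega>] by (intro suminf_nonneg) auto
  have s1: "(\<lambda>k. real (l - 1) / real l ^ Suc k) sums 1"
  proof -
    have "(\<lambda>k. (1 / real l) ^ k) sums (1 / (1 - 1 / real l))"
      using l by (intro geometric_sums) auto
    then have "(\<lambda>k. real (l - 1) / real l * (1 / real l) ^ k) sums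
        (real (l - 1) / real l * (1 / (1 - 1 / real l)))" by (rule sums_mult)
    moreover have "real (l - 1) / real l * (1 / (1 - 1 / real l)) = 1"
      using l by (simp add: of_nat_diff field_simps)
    moreover have "(\<lambda>k. real (l - 1) / real l * (1 / real l) ^ k) = (\<lambda>k. real (l - 1) / real l ^ Suc k)"
      by (simp add: power_one_over)
    ultimately show ?thesis by (simp only:)
  qed
  have "(\<Sum>k. real (l - 1) / real l ^ Suc k - real (\<omega> k) / real l ^ Suc k) > 0"
  proof (rule suminf_pos2)
    show "summable (\<lambda>k. real (l - 1) / real l ^ Suc k - real (\<omega> k) / real l ^ Suc k)"
      using sums_summable[OF s1] sm[OF \<omega>] by (rule summable_diff)
    have "\<omega> k \<le> l - 1" for k using \<omega>[of k] by linarith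
    then show "0 \<le> real (l - 1) / real l ^ Suc k - real (\<omega> k) / real l ^ Suc k" for k
      by (simp add: divide_right_mono del: power_Suc)
    have "\<omega> m < l - 1" using assms(3) \<open>\<And>k. \<omega> k \<le> l - 1\<close>[of m] by linarith
    then show "0 < real (l - 1) / real l ^ Suc m - real (\<omega> m) / real l ^ Suc m"
      using l by (simp add: divide_strict_right_mono del: power_Suc)
  qed
  then have "digit_sum l \<omega> < 1"
    unfolding digit_sum_def
    using suminf_diff[OF sums_summable[OF s1] sm[of \<omega>, OF \<omega>]] sums_unique[OF s1]
    by (simp del: power_Suc)
  with \<open>digit_sum l \<omega> \<ge> 0\<close> show ?thesis by simp
qed

lemma digit_sum_shift:
  assumes "l \<ge> 2" "\<And>k. \<omega> k < l"
  shows "real l * digit_sum l \<omega> = real (\<omega> 0) + digit_sum l (\<lambda>k. \<omega> (Suc k))"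
proof -
  have sm: "summable (\<lambda>k. real (\<omega> k) / real l ^ Suc k)" by (rule summable_digit_sum) (use assms in auto)
  have "digit_sum l \<omega> = real (\<omega> 0) / real l + (\<Sum>k. real (\<omega> (Suc k)) / real l ^ Suc (Suc k))"
    unfolding digit_sum_def using suminf_split_head[OF sm] by simp
  also have "(\<Sum>k. real (\<omega> (Suc k)) / real l ^ Suc (Suc k)) =
      (\<Sum>k. (1 / real l) * (real (\<omega> (Suc k)) / real l ^ Suc k))" by simp
  also have "\<dots> = (1 / real l) * digit_sum l (\<lambda>k. \<omega> (Suc k))"
    unfolding digit_sum_def by (rule suminf_mult) (rule summable_digit_sum, use assms in auto)
  finally show ?thesis using assms(1) by (simp add: field_simps)
qed

lemma adic_word_digit_sum:
  assumes l: "l \<ge> 2" and \<omega>: "\<And>k. \<omega> k < l" and "\<And>n. \<exists>k\<ge>n. \<omega> k \<noteq> l - 1"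
  shows "digit_sum l \<omega> \<in> {0..<1}" "adic_word l (digit_sum l \<omega>) n = map \<omega> [0..<n]"
    "adic_index l n (digit_sum l \<omega>) = word_index l (map \<omega> [0..<n])"
proof -
  define x where "x = digit_sum l \<omega>"
  have tail: "digit_sum l (\<lambda>k. \<omega> (n + k)) \<in> {0..<1}" for n
  proof -
    obtain k where "k \<ge> n" "\<omega> k \<noteq> l - 1" using assms(3) by blast
    then show ?thesis by (intro digit_sum_bounds[of l _ "k - n"]) (use l \<omega> in auto)
  qed
  from tail[of 0] show x: "digit_sum l \<omega> \<in> {0..<1}" by simp
  \<comment> \<open>Multiplication by \<open>l\<^sup>n\<close> splits off the first \<open>n\<close> digits; the fractional part is the point of the
    shifted sequence, which is less than 1 because the digits are not eventually \<open>l - 1\<close>.\<close>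
  have eq: "x * real l ^ n = real (word_index l (map \<omega> [0..<n])) + digit_sum l (\<lambda>k. \<omega> (n + k))" for n
  proof (induction n)
    case (Suc n)
    have "x * real l ^ Suc n = real l * (x * real l ^ n)" by simp
    also have "\<dots> = real l * real (word_index l (map \<omega> [0..<n])) + real l * digit_sum l (\<lambda>k. \<omega> (n + k))"
      unfolding Suc by (rule distrib_left)
    also have "real l * digit_sum l (\<lambda>k. \<omega> (n + k)) = real (\<omega> n) + digit_sum l (\<lambda>k. \<omega> (Suc n + k))"
      using digit_sum_shift[of l "\<lambda>k. \<omega> (n + k)"] l \<omega> by simp
    finally show ?case by (simp add: word_index_snoc)
  qed (simp add: x_def)
  show idx: "adic_index l n (digit_sum l \<omega>) = word_index l (map \<omega> [0..<n])" for n
    using eq[of n] tail[of n] x unfolding x_def[symmetric] by (intro adic_index_unique) auto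
  have "adic_digit l (digit_sum l \<omega>) k = \<omega> k" for k
    unfolding adic_digit_def idx using \<omega>[of k] by (simp add: word_index_snoc)
  then show "adic_word l (digit_sum l \<omega>) n = map \<omega> [0..<n]" by (simp add: adic_word_def)
qed

section \<open>Masses of adic intervals\<close>

text \<open>The word of the mirror image of an adic interval under \<open>x \<mapsto> 1 - x\<close>.\<close>

abbreviation reflect_word :: "nat \<Rightarrow> nat list \<Rightarrow> nat list" where
  "reflect_word l \<equiv> map (\<lambda>d. l - Suc d)"

text \<open>The mass that the self-similarity relation forces on the adic interval of a word (lemma
  \<open>measure_cylinder\<close> below). The recursion removes the leading digit: the unflipped branch
  with this digit pulls the interval back to that of \<open>w\<close>, the flipped one to its mirror image.\<close>

fun word_mass :: "nat \<Rightarrow> (nat \<Rightarrow> real) \<Rightarrow> nat list \<Rightarrow> real" where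
  "word_mass l p [] = 1"
| "word_mass l p (j # w) = p j * word_mass l p w + p (j + l) * word_mass l p (reflect_word l w)"

text \<open>The corresponding mass for the symmetrized measure.\<close>

definition sym_mass :: "nat \<Rightarrow> (nat \<Rightarrow> real) \<Rightarrow> nat list \<Rightarrow> real" where
  "sym_mass l p w = (word_mass l p w + word_mass l p (reflect_word l w)) / 2"

text \<open>The interior of the adic interval of a word. For a nonempty word the preimages of this open interval
  under the maps of the system are either intervals of the same kind or disjoint from \<open>[0, 1]\<close>, without
  boundary corrections.\<close>

definition cylinder :: "nat \<Rightarrow> nat list \<Rightarrow> real set" where
  "cylinder l w = {real (word_index l w) / real l ^ length w <..< (real (word_index l w) + 1) / real l ^ length w}"

lemma reflect_reflect_word: "set w \<subseteq> {..<l} \<Longrightarrow> reflect_word l (reflect_word l w) = w"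
  by (induction w) auto

lemma set_reflect_word: "set w \<subseteq> {..<l} \<Longrightarrow> set (reflect_word l w) \<subseteq> {..<l}"
  by auto

lemma flip_image: "y \<in> flip ` I \<longleftrightarrow> 1 - y \<in> I"
  by (auto simp: flip_def intro!: rev_image_eqI[of "1 - y"])

text \<open>The self-similar measure \<open>\<mu>\<close> and the hypotheses on its weights.\<close>

locale reflected_ifs =
  fixes l :: nat and p :: "nat \<Rightarrow> real" and \<mu> :: "real measure"
  assumes l2: "l \<ge> 2"
    and weight: "probability_weight l p"
    and pos: "\<And>i. i < l \<Longrightarrow> p i > 0"
    and self_similar: "self_similar_measure l p \<mu>"
begin

abbreviation "wm \<equiv> word_mass l p"
abbreviation "sm \<equiv> sym_mass l p"
abbreviation "B \<equiv> unflipped l p"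

lemma p_nonneg: "i < 2 * l \<Longrightarrow> p i \<ge> 0"
  using weight by (auto simp: probability_weight_def)

lemma p_sum: "(\<Sum>i<2 * l. p i) = 1"
  using weight by (auto simp: probability_weight_def)

lemma p_pair_less_1: "i < l \<Longrightarrow> p i + p (i + l) < 1"
proof -
  assume i: "i < l"
  define k where "k = (if i = 0 then 1 else 0 :: nat)"
  have k: "k < l" "k \<noteq> i" using l2 i by (auto simp: k_def)
  have "(\<Sum>j\<in>{i, i + l, k}. p j) \<le> (\<Sum>j<2 * l. p j)"
    using i k p_nonneg by (intro sum_mono2) auto
  then have "p i + p (i + l) + p k \<le> 1" using i k by (simp add: p_sum)
  with pos[OF k(1)] show ?thesis by linarith
qed

lemma p_le_1: "i < 2 * l \<Longrightarrow> p i \<le> 1"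
  using member_le_sum[of i "{..<2 * l}" p] p_nonneg p_sum by auto

lemma bpu: "borel_prob_unit \<mu>"
  using self_similar by (simp add: self_similar_measure_def)

lemma space_mu: "space \<mu> = {0..1}" by (rule space_borel_prob_unit[OF bpu])

lemma prob_mu: "prob_space \<mu>"
  using bpu by (intro prob_spaceI) (simp add: borel_prob_unit_def)

lemma sets_mu: "sets \<mu> = sets (restrict_space borel {0..1})"
  using bpu by (simp add: borel_prob_unit_def)

lemma in_sets_mu: "A \<in> sets borel \<Longrightarrow> A \<subseteq> {0..1} \<Longrightarrow> A \<in> sets \<mu>"
  unfolding sets_mu by (subst sets_restrict_space_iff) auto

lemma measure_mu: "A \<in> sets borel \<Longrightarrow> A \<subseteq> {0..1} \<Longrightarrow>
    measure \<mu> A = (\<Sum>i<2 * l. p i * measure \<mu> {x \<in> {0..1}. ifs_map l i x \<in> A})"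
  by (rule self_similar[unfolded self_similar_measure_def, THEN conjunct2, rule_format, OF in_sets_mu])

lemma measure_mu_pair:
  assumes "A \<in> sets borel" "A \<subseteq> {0..1}" "j < l"
    and "\<And>i x. i < 2 * l \<Longrightarrow> x \<in> {0..1} \<Longrightarrow> ifs_map l i x \<in> A \<Longrightarrow> i = j \<or> i = j + l"
  shows "measure \<mu> A = p j * measure \<mu> {x \<in> {0..1}. ifs_map l j x \<in> A} +
      p (j + l) * measure \<mu> {x \<in> {0..1}. ifs_map l (j + l) x \<in> A}"
proof -
  have "measure \<mu> A = (\<Sum>i\<in>{j, j + l}. p i * measure \<mu> {x \<in> {0..1}. ifs_map l i x \<in> A})"
    unfolding measure_mu[OF assms(1,2)]
  proof (rule sum.mono_neutral_right)
    show "\<forall>i\<in>{..<2 * l} - {j, j + l}. p i * measure \<mu> {x \<in> {0..1}. ifs_map l i x \<in> A} = 0"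
    proof
      fix i assume "i \<in> {..<2 * l} - {j, j + l}"
      then have "{x \<in> {0..1}. ifs_map l i x \<in> A} = {}" using assms(4)[of i] by auto
      then show "p i * measure \<mu> {x \<in> {0..1}. ifs_map l i x \<in> A} = 0" by (simp only: measure_empty mult_zero_right)
    qed
  qed (use assms(3) in auto)
  then show ?thesis using l2 by simp
qed

lemma ifs_map_low: "i < l \<Longrightarrow> ifs_map l i x = (x + real i) / real l"
  by (simp add: ifs_map_def add_divide_distrib)

lemma ifs_map_high: "ifs_map l (i + l) x = (1 - x + real i) / real l"
  using l2 by (simp add: ifs_map_def add_divide_distrib diff_divide_distrib)

lemma ifs_cases:
  assumes "i < 2 * l"
  obtains "i < l" | k where "k < l" "i = k + l"
  using that(1) that(2)[of "i - l"] assms by (cases "i < l") auto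

text \<open>Each endpoint of \<open>[0, 1]\<close> has exactly one preimage under exactly two of the maps, and that preimage
  is again an endpoint.\<close>

lemma measure_endpoints: "measure \<mu> {0} = 0" "measure \<mu> {1} = 0"
proof -
  have l0: "real l > 0" using l2 by simp
  have "measure \<mu> {0} = p 0 * measure \<mu> {x \<in> {0..1}. ifs_map l 0 x \<in> {0}} +
      p (0 + l) * measure \<mu> {x \<in> {0..1}. ifs_map l (0 + l) x \<in> {0}}"
  proof (rule measure_mu_pair)
    fix i x assume "i < 2 * l" "x \<in> {0..1::real}" "ifs_map l i x \<in> {0}"
    then show "i = 0 \<or> i = 0 + l"
      by (cases rule: ifs_cases) (use l0 in \<open>auto simp: ifs_map_low ifs_map_high\<close>)
  qed (use l2 in auto)
  also have "{x \<in> {0..1}. ifs_map l 0 x \<in> {0}} = {0}" using l2 by (auto simp: ifs_map_low)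
  also have "{x \<in> {0..1}. ifs_map l (0 + l) x \<in> {0}} = {1}"
    using l2 by (auto simp: ifs_map_high[of 0, simplified])
  finally have e0: "measure \<mu> {0} = p 0 * measure \<mu> {0} + p (0 + l) * measure \<mu> {1}" .
  have "measure \<mu> {1} = p (l - 1) * measure \<mu> {x \<in> {0..1}. ifs_map l (l - 1) x \<in> {1}} +
      p (l - 1 + l) * measure \<mu> {x \<in> {0..1}. ifs_map l (l - 1 + l) x \<in> {1}}"
  proof (rule measure_mu_pair)
    fix i x assume "i < 2 * l" "x \<in> {0..1::real}" "ifs_map l i x \<in> {1}"
    then show "i = l - 1 \<or> i = l - 1 + l"
    proof (cases rule: ifs_cases)
      case 1
      then have "x + real i = real l" using \<open>ifs_map l i x \<in> {1}\<close> l0 by (simp add: ifs_map_low field_simps)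
      then have "real i + 1 \<ge> real l" using \<open>x \<in> {0..1}\<close> by simp
      then show ?thesis using 1 by linarith
    next
      case (2 k)
      then have "1 - x + real k = real l" using \<open>ifs_map l i x \<in> {1}\<close> l0 by (simp add: ifs_map_high field_simps)
      then have "real k + 1 \<ge> real l" using \<open>x \<in> {0..1}\<close> by simp
      then show ?thesis using 2 by linarith
    qed
  qed (use l2 in auto)
  also have "{x \<in> {0..1}. ifs_map l (l - 1) x \<in> {1}} = {1}"
    using l2 by (auto simp: ifs_map_low of_nat_diff field_simps)
  also have "{x \<in> {0..1}. ifs_map l (l - 1 + l) x \<in> {1}} = {0}"
    using l2 unfolding ifs_map_high by (auto simp: of_nat_diff field_simps)
  finally have e1: "measure \<mu> {1} = p (l - 1) * measure \<mu> {1} + p (l - 1 + l) * measure \<mu> {0}" .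
  define a b where "a = measure \<mu> {0}" and "b = measure \<mu> {1}"
  have ab: "a \<ge> 0" "b \<ge> 0" by (auto simp: a_def b_def)
  \<comment> \<open>Apply to the larger mass \<open>m\<close>, which is a combination of both masses with total weight less
    than 1.\<close>
  have zero: "m = 0" if "m = r * m + s * m'" "m' \<le> m" "0 \<le> m" "0 \<le> s" "r + s < 1" for m m' r s :: real
  proof (rule ccontr)
    assume "m \<noteq> 0"
    have "s * m' \<le> s * m" using that by (intro mult_left_mono) auto
    then have "m \<le> (r + s) * m" using that(1) by (simp add: algebra_simps)
    moreover have "(r + s) * m < 1 * m" using that \<open>m \<noteq> 0\<close> by (intro mult_strict_right_mono) auto
    ultimately show False by simp
  qed
  have "a = 0 \<and> b = 0"
  proof (cases "b \<le> a")
    case True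
    have "a = 0"
      by (rule zero[of a "p 0" "p (0 + l)" b])
         (use e0 True ab p_nonneg p_pair_less_1[of 0] l2 in \<open>auto simp: a_def b_def\<close>)
    with True ab show ?thesis by simp
  next
    case False
    have "b = 0"
      by (rule zero[of b "p (l - 1)" "p (l - 1 + l)" a])
         (use e1 False ab p_nonneg p_pair_less_1[of "l - 1"] l2 in \<open>auto simp: a_def b_def\<close>)
    with False ab show ?thesis by simp
  qed
  then show "measure \<mu> {0} = 0" "measure \<mu> {1} = 0" by (auto simp: a_def b_def)
qed

text \<open>Adic rationals carry no mass: their preimages are adic rationals of the previous level.\<close>

lemma measure_adic_point: "x \<in> {0..1} \<Longrightarrow> x * real l ^ n \<in> \<int> \<Longrightarrow> measure \<mu> {x} = 0"
proof (induction n arbitrary: x)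
  case 0
  then have "x = 0 \<or> x = 1" by (auto elim!: Ints_cases)
  then show ?case using measure_endpoints by auto
next
  case (Suc n)
  have l0: "real l > 0" using l2 by simp
  have "measure \<mu> {y \<in> {0..1}. ifs_map l i y \<in> {x}} = 0" if i: "i < 2 * l" for i
  proof -
    have "\<exists>y. {y \<in> {0..1}. ifs_map l i y \<in> {x}} \<subseteq> {y} \<and> y * real l ^ n \<in> \<int>"
    proof (cases rule: ifs_cases[OF i])
      case 1
      have "(x * real l - real i) * real l ^ n = x * real l ^ Suc n - of_int (int (i * l ^ n))"
        by (simp add: algebra_simps)
      moreover have "\<dots> \<in> \<int>" using Suc.prems(2) by (intro Ints_diff) auto
      moreover have "y = x * real l - real i" if "ifs_map l i y = x" for y
        using that 1 l0 by (auto simp: ifs_map_low field_simps)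
      ultimately show ?thesis by (intro exI[of _ "x * real l - real i"]) auto
    next
      case (2 k)
      have "(1 + real k - x * real l) * real l ^ n = of_int (int ((1 + k) * l ^ n)) - x * real l ^ Suc n"
        by (simp add: algebra_simps)
      moreover have "\<dots> \<in> \<int>" using Suc.prems(2) by (intro Ints_diff) auto
      moreover have "y = 1 + real k - x * real l" if "ifs_map l i y = x" for y
        using that 2 l0 by (auto simp: ifs_map_high field_simps)
      ultimately show ?thesis by (intro exI[of _ "1 + real k - x * real l"]) auto
    qed
    then obtain y where y: "{y \<in> {0..1}. ifs_map l i y \<in> {x}} \<subseteq> {y}" "y * real l ^ n \<in> \<int>" by blast
    show ?thesis
    proof (cases "{y \<in> {0..1}. ifs_map l i y \<in> {x}} = {}")
      case True
      then show ?thesis by (simp only: measure_empty)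
    next
      case False
      then have "{y \<in> {0..1}. ifs_map l i y \<in> {x}} = {y}" "y \<in> {0..1}" using y(1) by blast+
      then show ?thesis using Suc.IH[of y] y(2) by simp
    qed
  qed
  then show ?case using measure_mu[of "{x}"] Suc.prems(1) by simp
qed

lemma word_index_less_real:
  assumes "set w \<subseteq> {..<l}"
  shows "real (word_index l w) + 1 \<le> real l ^ length w"
proof -
  have "word_index l w + 1 \<le> l ^ length w" using word_index_less[OF assms] by simp
  then have "real (word_index l w + 1) \<le> real (l ^ length w)" by (simp only: of_nat_le_iff)
  then show ?thesis by simp
qed

lemma cylinder_subset:
  assumes "set w \<subseteq> {..<l}"
  shows "cylinder l w \<subseteq> {0<..<1}"
proof
  fix x assume x: "x \<in> cylinder l w"
  have "real (word_index l w) + 1 \<le> real l ^ length w"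
    by (rule word_index_less_real[OF assms])
  moreover have "real l ^ length w > 0" using l2 by simp
  ultimately have "(real (word_index l w) + 1) / real l ^ length w \<le> 1" "0 \<le> real (word_index l w) / real l ^ length w"
    by (auto simp: field_simps)
  moreover have "real (word_index l w) / real l ^ length w < x" "x < (real (word_index l w) + 1) / real l ^ length w"
    using x by (auto simp: cylinder_def)
  ultimately show "x \<in> {0<..<1}" unfolding greaterThanLessThan_iff by (meson order_le_less_trans order_less_le_trans)
qed

lemma cylinder_reflect:
  assumes "set w \<subseteq> {..<l}"
  shows "1 - x \<in> cylinder l w \<longleftrightarrow> x \<in> cylinder l (reflect_word l w)"
proof -
  define N where "N = real l ^ length w"
  have N: "N > 0" using l2 by (simp add: N_def)
  have e: "real (word_index l (reflect_word l w)) = N - 1 - real (word_index l w)"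
    using arg_cong[OF word_index_reflect[OF assms], of real] by (simp add: N_def)
  show ?thesis unfolding cylinder_def length_map e N_def[symmetric] using N by (auto simp: field_simps)
qed

lemma measure_cylinder:
  "set w \<subseteq> {..<l} \<Longrightarrow> measure \<mu> (cylinder l w) = wm w"
proof (induction "length w" arbitrary: w)
  case 0
  interpret prob_space \<mu> by (rule prob_mu)
  have [measurable]: "{0} \<in> sets \<mu>" "{1} \<in> sets \<mu>" "{0<..<1} \<in> sets \<mu>" by (auto intro!: in_sets_mu)
  have "{0<..<1} \<union> {0} \<union> {1} \<in> sets \<mu>" by (intro sets.Un) fact+
  moreover have "space \<mu> \<subseteq> {0<..<1} \<union> {0} \<union> {1}" by (auto simp: space_mu)
  ultimately have "measure \<mu> (space \<mu>) \<le> measure \<mu> ({0<..<1} \<union> {0} \<union> {1})"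
    by (intro finite_measure_mono)
  also have "\<dots> \<le> measure \<mu> ({0<..<1} \<union> {0}) + measure \<mu> {1}" by (intro measure_Un_le sets.Un) fact+
  also have "\<dots> \<le> measure \<mu> {0<..<1} + measure \<mu> {0} + measure \<mu> {1}"
    by (intro add_right_mono measure_Un_le) fact+
  finally have "measure \<mu> {0<..<1} \<ge> 1" using measure_endpoints by (simp add: prob_space)
  then have "measure \<mu> {0<..<1} = 1" using prob_le_1[of "{0<..<1}"] by simp
  then show ?case using 0 by (simp add: cylinder_def)
next
  case (Suc n v)
  then obtain j w where v: "v = j # w" "length w = n" by (metis length_Suc_conv)
  have w: "set w \<subseteq> {..<l}" "j < l" using Suc.prems v by auto
  define N where "N = real l ^ length w"
  define a where "a = real (word_index l w)"
  have N: "N > 0" using l2 by (simp add: N_def)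
  have l0: "real l > 0" using l2 by simp
  have mem: "y / real l \<in> cylinder l v \<longleftrightarrow> y - real j \<in> cylinder l w" for y
  proof -
    have c1: "cylinder l v = {(real j * N + a) / (real l * N) <..< (real j * N + a + 1) / (real l * N)}"
      by (simp add: v(1) cylinder_def N_def a_def)
    have c2: "cylinder l w = {a / N <..< (a + 1) / N}" by (simp add: cylinder_def N_def a_def)
    have lN: "real l * N > 0" using N l0 by simp
    have "y / real l * (real l * N) = y * N" using l0 by simp
    then show ?thesis
      unfolding c1 c2 greaterThanLessThan_iff pos_divide_less_eq[OF lN] pos_less_divide_eq[OF lN]
        pos_divide_less_eq[OF N] pos_less_divide_eq[OF N]
      by (auto simp: algebra_simps)
  qed
  have sub: "cylinder l v \<subseteq> {0<..<1}" by (rule cylinder_subset[OF Suc.prems])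
  have subw: "cylinder l w \<subseteq> {0<..<1}" by (rule cylinder_subset[OF w(1)])
  have "measure \<mu> (cylinder l v) = p j * measure \<mu> {x \<in> {0..1}. ifs_map l j x \<in> cylinder l v} +
      p (j + l) * measure \<mu> {x \<in> {0..1}. ifs_map l (j + l) x \<in> cylinder l v}"
  proof (rule measure_mu_pair)
    show "cylinder l v \<in> sets borel" by (simp add: cylinder_def)
    show "cylinder l v \<subseteq> {0..1}" using sub by force
    have eq: "i = j" if "x + real i - real j \<in> cylinder l w" "x \<in> {0..1}" for i and x :: real
    proof -
      have "0 < x + real i - real j" "x + real i - real j < 1" using that(1) subw by auto
      then show ?thesis using that(2) by auto
    qed
    fix i x assume i: "i < 2 * l" and x: "x \<in> {0..1::real}" and m: "ifs_map l i x \<in> cylinder l v"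
    show "i = j \<or> i = j + l" using i
    proof (cases rule: ifs_cases)
      case 1
      with m x eq[of x i] show ?thesis by (simp add: ifs_map_low mem)
    next
      case (2 k)
      with m x eq[of "1 - x" k] show ?thesis by (simp add: ifs_map_high mem)
    qed
  qed fact
  also have "{x \<in> {0..1}. ifs_map l j x \<in> cylinder l v} = cylinder l w"
    using subw w(2) by (auto simp: ifs_map_low mem)
  also have "{x \<in> {0..1}. ifs_map l (j + l) x \<in> cylinder l v} = cylinder l (reflect_word l w)"
    using cylinder_subset[OF set_reflect_word[OF w(1)]]
    by (auto simp: ifs_map_high mem cylinder_reflect[OF w(1)])
  finally show ?case
    using Suc.hyps(1)[of w] Suc.hyps(1)[of "reflect_word l w"] w set_reflect_word[OF w(1)] v by simp
qed

lemma measure_adic_interval: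
  fixes x :: real and n :: nat
  assumes "x \<in> {0..1}"
  defines "I \<equiv> adic_interval l n x"
  shows "I \<in> sets \<mu>" "measure \<mu> I = wm (adic_word l x n)"
    "measure \<mu> (flip ` I) = wm (reflect_word l (adic_word l x n))"
proof -
  interpret prob_space \<mu> by (rule prob_mu)
  define w where "w = adic_word l x n"
  have w: "set w \<subseteq> {..<l}" "length w = n" unfolding w_def by (auto simp: set_adic_word[OF l2] subset_iff adic_word_def adic_digit_less[OF l2])
  define N where "N = real l ^ n"
  have N: "N > 0" using l2 by (simp add: N_def)
  define a where "a = real (word_index l w) / N"
  define b where "b = (real (word_index l w) + 1) / N"
  have I: "I = {a..<b}"
    using adic_interval_eq[OF l2 assms(1), of n] word_index_adic_word[OF l2 assms(1), of n]
    by (simp add: I_def a_def b_def N_def w_def)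
  have cyl: "cylinder l w = {a<..<b}" by (simp add: cylinder_def a_def b_def N_def w)
  have "real (word_index l w) + 1 \<le> real l ^ n"
    using word_index_less_real[OF w(1)] w(2) by simp
  then have ab: "0 \<le> a" "a < b" "b \<le> 1" using N by (auto simp: a_def b_def N_def field_simps)
  show "I \<in> sets \<mu>" unfolding I using ab by (intro in_sets_mu) auto
  have point: "measure \<mu> ({c} \<union> cylinder l v) = measure \<mu> (cylinder l v)"
    if "c \<in> {0..1}" "c * real l ^ n \<in> \<int>" "set v \<subseteq> {..<l}" for c v
  proof (rule antisym)
    have [measurable]: "{c} \<in> sets \<mu>" "cylinder l v \<in> sets \<mu>"
      using that cylinder_subset[of v] by (auto intro!: in_sets_mu simp: cylinder_def)
    show "measure \<mu> ({c} \<union> cylinder l v) \<le> measure \<mu> (cylinder l v)"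
      using measure_Un_le[of "{c}" \<mu> "cylinder l v"] measure_adic_point[OF that(1,2)] by simp
    show "measure \<mu> (cylinder l v) \<le> measure \<mu> ({c} \<union> cylinder l v)"
      by (rule finite_measure_mono) (auto intro!: sets.Un simp del: Un_insert_left)
  qed
  have "a * real l ^ n = of_int (int (word_index l w))" using N by (simp add: a_def N_def)
  then have aint: "a * real l ^ n \<in> \<int>" by simp
  have "I = {a} \<union> cylinder l w" unfolding I cyl using ab by auto
  then have "measure \<mu> I = measure \<mu> (cylinder l w)" using point[OF _ aint w(1)] ab by (simp only:) simp
  then show "measure \<mu> I = wm (adic_word l x n)"
    unfolding measure_cylinder[OF w(1)] by (simp only: w_def)
  have "(1 - a) * real l ^ n = of_int (int (l ^ n)) - a * real l ^ n" by (simp add: algebra_simps)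
  then have aint': "(1 - a) * real l ^ n \<in> \<int>" using aint by simp
  have "flip ` I = {1 - a} \<union> cylinder l (reflect_word l w)"
  proof (rule set_eqI)
    fix y
    have "y \<in> flip ` I \<longleftrightarrow> 1 - y \<in> I" by (rule flip_image)
    also have "\<dots> \<longleftrightarrow> y \<in> {1 - a} \<union> cylinder l (reflect_word l w)"
      unfolding \<open>I = {a} \<union> cylinder l w\<close> Un_iff cylinder_reflect[OF w(1), of y] by auto
    finally show "y \<in> flip ` I \<longleftrightarrow> y \<in> {1 - a} \<union> cylinder l (reflect_word l w)" .
  qed
  then have "measure \<mu> (flip ` I) = measure \<mu> (cylinder l (reflect_word l w))"
    using point[OF _ aint' set_reflect_word[OF w(1)]] ab by (simp only:) simp
  then show "measure \<mu> (flip ` I) = wm (reflect_word l (adic_word l x n))"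
    unfolding measure_cylinder[OF set_reflect_word[OF w(1)]] by (simp only: w_def)
qed

lemma measure_symmetrized_adic_interval:
  assumes "x \<in> {0..1}"
  shows "measure (symmetrized \<mu>) (adic_interval l n x) = sm (adic_word l x n)"
proof -
  interpret prob_space \<mu> by (rule prob_mu)
  define I where "I = adic_interval l n x"
  note m = measure_adic_interval[OF assms, of n, folded I_def]
  have "emeasure (symmetrized \<mu>) I = (ennreal (measure \<mu> I) + ennreal (measure \<mu> (flip ` I))) / 2"
    using emeasure_symmetrized[OF bpu m(1)] by (simp add: emeasure_eq_measure)
  also have "\<dots> = ennreal ((measure \<mu> I + measure \<mu> (flip ` I)) / 2)"
    by (simp add: ennreal_plus[symmetric] ennreal_divide_numeral del: ennreal_plus)
  finally show ?thesis
    unfolding I_def[symmetric] sym_mass_def m(2,3)[symmetric] by (simp add: measure_def)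
qed

end

section \<open>Comparison of the measure with its symmetrization\<close>

text \<open>Sequences that are comparable up to constant factors have the same exponents.\<close>

lemma exponent_tendsto_cong:
  fixes a b :: "nat \<Rightarrow> real"
  assumes "C > 0" "D > 0" and ab: "\<And>n. n \<ge> N \<Longrightarrow> 0 < b n \<and> C * b n \<le> a n \<and> a n \<le> D * b n"
  shows "(\<lambda>n. - ln (a n) / (real n * L)) \<longlonglongrightarrow> \<alpha> \<longleftrightarrow> (\<lambda>n. - ln (b n) / (real n * L)) \<longlonglongrightarrow> \<alpha>"
proof (rule Lim_transform_eq)
  define M where "M = \<bar>ln C\<bar> + \<bar>ln D\<bar>"
  have "(\<lambda>n. (M / \<bar>L\<bar>) * (1 / real n)) \<longlonglongrightarrow> (M / \<bar>L\<bar>) * 0"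
    by (intro tendsto_mult tendsto_const lim_1_over_n)
  then have lim: "(\<lambda>n. (M / \<bar>L\<bar>) * (1 / real n)) \<longlonglongrightarrow> 0" by simp
  show "(\<lambda>n. - ln (a n) / (real n * L) - - ln (b n) / (real n * L)) \<longlonglongrightarrow> 0"
  proof (rule Lim_null_comparison[OF _ lim])
    show "\<forall>\<^sub>F n in sequentially.
        norm (- ln (a n) / (real n * L) - - ln (b n) / (real n * L)) \<le> (M / \<bar>L\<bar>) * (1 / real n)"
      using eventually_ge_at_top[of N]
    proof eventually_elim
      case (elim n)
      then have b: "0 < b n" and ca: "C * b n \<le> a n" and ad: "a n \<le> D * b n" using ab by auto
      have "0 < C * b n" using b assms(1) by simp
      then have a: "0 < a n" using ca by linarith
      have "ln (C * b n) \<le> ln (a n)" "ln (a n) \<le> ln (D * b n)"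
        using \<open>0 < C * b n\<close> a ca ad b assms by (auto intro!: ln_mono)
      then have "\<bar>ln (b n) - ln (a n)\<bar> \<le> M"
        unfolding M_def using b assms by (simp add: ln_mult)
      moreover have "- ln (a n) / (real n * L) - - ln (b n) / (real n * L) = (ln (b n) - ln (a n)) / (real n * L)"
        by (simp add: diff_divide_distrib)
      moreover have "\<bar>(ln (b n) - ln (a n)) / (real n * L)\<bar> = \<bar>ln (b n) - ln (a n)\<bar> / (real n * \<bar>L\<bar>)"
        by (simp add: abs_mult)
      moreover have "\<bar>ln (b n) - ln (a n)\<bar> / (real n * \<bar>L\<bar>) \<le> M / (real n * \<bar>L\<bar>)"
        using calculation(1) by (intro divide_right_mono) auto
      moreover have "M / (real n * \<bar>L\<bar>) = (M / \<bar>L\<bar>) * (1 / real n)" by simp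
      ultimately show ?case by (simp only: real_norm_def)
    qed
  qed
qed

lemma exponent_tendsto_Suc:
  assumes "(\<lambda>n. f (Suc n) / (real n * L)) \<longlonglongrightarrow> \<alpha>"
  shows "(\<lambda>n. f n / (real n * L)) \<longlonglongrightarrow> (\<alpha>::real)"
proof -
  have "(\<lambda>n. (real n / real (Suc n)) * (f (Suc n) / (real n * L))) \<longlonglongrightarrow> 1 * \<alpha>"
    by (intro tendsto_mult LIMSEQ_n_over_Suc_n assms)
  moreover have "eventually (\<lambda>n. (real n / real (Suc n)) * (f (Suc n) / (real n * L)) = f (Suc n) / (real (Suc n) * L)) sequentially"
    using eventually_gt_at_top[of 0]
  proof eventually_elim
    case (elim n)
    then show ?case by (cases "L = 0") (simp_all add: divide_simps del: of_nat_Suc)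
  qed
  ultimately have "(\<lambda>n. f (Suc n) / (real (Suc n) * L)) \<longlonglongrightarrow> \<alpha>"
    by (simp add: tendsto_cong del: of_nat_Suc)
  then show ?thesis by (rule LIMSEQ_imp_Suc)
qed

context reflected_ifs
begin

lemma min_weight: "\<exists>c>0. c \<le> 1 \<and> (\<forall>i<2 * l. p i > 0 \<longrightarrow> c \<le> p i)"
proof -
  define S where "S = p ` {i. i < 2 * l \<and> p i > 0}"
  have S: "finite S" "p 0 \<in> S" using l2 pos[of 0] by (auto simp: S_def)
  have "Min S \<in> S" using S by (intro Min_in) auto
  then have "Min S > 0" "Min S \<le> 1" using p_le_1 by (auto simp: S_def)
  moreover have "Min S \<le> p i" if "i < 2 * l" "p i > 0" for i
    using S that by (intro Min_le) (auto simp: S_def)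
  ultimately show ?thesis by blast
qed

lemma word_mass_pos: "set w \<subseteq> {..<l} \<Longrightarrow> wm w > 0"
proof (induction "length w" arbitrary: w)
  case (Suc n)
  then obtain j v where w: "w = j # v" "length v = n" by (metis length_Suc_conv)
  then have v: "set v \<subseteq> {..<l}" "j < l" using Suc.prems by auto
  have "wm v > 0" "wm (reflect_word l v) > 0"
    using Suc.hyps(1)[of v] Suc.hyps(1)[of "reflect_word l v"] w v set_reflect_word[OF v(1)] by auto
  then show ?case using pos[OF v(2)] p_nonneg[of "j + l"] v(2) w by (simp add: add_pos_nonneg)
qed simp

lemma sym_mass_pos: "set w \<subseteq> {..<l} \<Longrightarrow> sm w > 0"
  unfolding sym_mass_def
  using word_mass_pos[of w] word_mass_pos[OF set_reflect_word, of w] by simp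

lemma word_mass_le_sym_mass: "set w \<subseteq> {..<l} \<Longrightarrow> wm w \<le> 2 * sm w"
  using word_mass_pos[OF set_reflect_word, of w] unfolding sym_mass_def by simp

lemma adic_digits: "set (adic_word l x n) \<subseteq> {..<l}" by (rule set_adic_word[OF l2])

lemma ln_l_pos: "ln (real l) > 0" using l2 by simp

lemma level_set_mu_iff:
  "x \<in> level_set l \<mu> \<alpha> \<longleftrightarrow> x \<in> {0..1} \<and>
    (\<lambda>n. - ln (wm (adic_word l x n)) / (real n * ln (real l))) \<longlonglongrightarrow> \<alpha>"
proof -
  have "local_exponent l \<mu> x = (\<lambda>n. ereal (- ln (wm (adic_word l x n)) / (real n * ln (real l))))"
    if "x \<in> {0..1}"
    using word_mass_pos[OF adic_digits, of x]
    by (auto simp: fun_eq_iff local_exponent_def Let_def measure_adic_interval(2)[OF that] less_imp_neq[symmetric])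
  then show ?thesis by (auto simp: level_set_def lim_ereal)
qed

lemma level_set_nu_iff:
  "x \<in> level_set l (symmetrized \<mu>) \<alpha> \<longleftrightarrow> x \<in> {0..1} \<and>
    (\<lambda>n. - ln (sm (adic_word l x n)) / (real n * ln (real l))) \<longlonglongrightarrow> \<alpha>"
proof -
  have "local_exponent l (symmetrized \<mu>) x = (\<lambda>n. ereal (- ln (sm (adic_word l x n)) / (real n * ln (real l))))"
    if "x \<in> {0..1}"
    using sym_mass_pos[OF adic_digits, of x]
    by (auto simp: fun_eq_iff local_exponent_def Let_def measure_symmetrized_adic_interval[OF that] less_imp_neq[symmetric])
  then show ?thesis by (auto simp: level_set_def lim_ereal)
qed

text \<open>The points all of whose digits belong to \<open>B\<close>. By the convention for digits, 1 is one of them if and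
  only if \<open>l - 1 \<in> B\<close>.\<close>

definition unflipped_points :: "real set" where
  "unflipped_points = {x \<in> {0..1}. \<forall>k. adic_digit l x k \<in> B}"

lemma finite_B: "finite B" by (simp add: unflipped_def)

lemma B_less: "i \<in> B \<Longrightarrow> i < l" by (simp add: unflipped_def)

lemma p_pos_not_unflipped: "j < l \<Longrightarrow> j \<notin> B \<Longrightarrow> p (j + l) > 0"
  using p_nonneg[of "j + l"] by (force simp: unflipped_def)

lemma word_mass_unflipped: "set w \<subseteq> B \<Longrightarrow> wm w = prod_list (map p w)"
  by (induction w) (auto simp: unflipped_def)

lemma word_mass_lower:
  assumes c: "c > 0" "c \<le> 1" "\<And>i. i < 2 * l \<Longrightarrow> p i > 0 \<Longrightarrow> c \<le> p i"
  shows "set w \<subseteq> {..<l} \<Longrightarrow> w = j # v \<Longrightarrow> wm w \<ge> c * wm v"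
    and "set w \<subseteq> {..<l} \<Longrightarrow> w = j # v \<Longrightarrow> j \<notin> B \<Longrightarrow> wm w \<ge> 2 * c * sm v"
proof -
  assume w: "set w \<subseteq> {..<l}" "w = j # v"
  then have j: "j < l" and v: "set v \<subseteq> {..<l}" by auto
  have a: "wm v > 0" "wm (reflect_word l v) > 0"
    using word_mass_pos[OF v] word_mass_pos[OF set_reflect_word[OF v]] by auto
  have pj: "c \<le> p j" using c(3)[of j] pos[OF j] j by simp
  then have 1: "c * wm v \<le> p j * wm v" using a by (intro mult_right_mono) auto
  have "0 \<le> p (j + l) * wm (reflect_word l v)" using p_nonneg[of "j + l"] j a by simp
  with 1 show "wm w \<ge> c * wm v" by (simp add: w)
  assume "j \<notin> B"
  then have "c \<le> p (j + l)" using c(3)[of "j + l"] p_pos_not_unflipped[OF j] j by simp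
  then have "c * wm (reflect_word l v) \<le> p (j + l) * wm (reflect_word l v)"
    using a by (intro mult_right_mono) auto
  with 1 show "wm w \<ge> 2 * c * sm v" by (simp add: w sym_mass_def algebra_simps)
qed

end

text \<open>The additional hypothesis that \<open>B\<close> does not meet its reflection.\<close>

locale disjoint_ifs = reflected_ifs +
  assumes disj: "unflipped l p \<inter> reflected l (unflipped l p) = {}"
begin

lemma reflect_not_unflipped: "j \<in> B \<Longrightarrow> l - Suc j \<notin> B"
proof
  assume "j \<in> B" "l - Suc j \<in> B"
  then have "j = l - 1 - (l - Suc j)" using B_less[of j] by auto
  then have "j \<in> reflected l B" unfolding reflected_def using \<open>l - Suc j \<in> B\<close> by (rule image_eqI)
  with disj \<open>j \<in> B\<close> show False by blast
qed

lemma exists_flipped_digit: "\<exists>j<l. j \<notin> B"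
proof (cases "0 \<in> B")
  case True
  then show ?thesis using reflect_not_unflipped[of 0] l2 by (intro exI[of _ "l - 1"]) auto
qed (use l2 in \<open>auto intro!: exI[of _ 0]\<close>)

text \<open>Removing the leading digit changes the symmetrized mass by a bounded factor. Here disjointness
  enters: the flipped branch is present for \<open>j\<close> or for its reflection, so both masses that make up
  \<open>sym_mass l p w\<close> contribute.\<close>

lemma sym_mass_Cons:
  assumes c: "c > 0" "c \<le> 1" "\<And>i. i < 2 * l \<Longrightarrow> p i > 0 \<Longrightarrow> c \<le> p i"
    and w: "j < l" "set w \<subseteq> {..<l}"
  shows "c * sm w \<le> sm (j # w)" "sm (j # w) \<le> 2 * sm w"
proof -
  define j' where "j' = l - Suc j"
  define a where "a = wm w"
  define b where "b = wm (reflect_word l w)"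
  have ab: "a > 0" "b > 0"
    unfolding a_def b_def using word_mass_pos[OF w(2)] word_mass_pos[OF set_reflect_word[OF w(2)]] by auto
  have j': "j' < l" using w(1) by (simp add: j'_def)
  have e: "wm (j # w) = p j * a + p (j + l) * b"
    "wm (reflect_word l (j # w)) = p j' * b + p (j' + l) * a"
    using reflect_reflect_word[OF w(2)] by (simp_all add: a_def b_def j'_def del: map_map)
  have s: "sm w = (a + b) / 2" by (simp add: sym_mass_def a_def b_def)
  have s': "sm (j # w) = (p j * a + p (j + l) * b + (p j' * b + p (j' + l) * a)) / 2"
    unfolding sym_mass_def e ..
  have nn: "0 \<le> p i * x" if "i < 2 * l" "x > 0" for i x
    using p_nonneg[OF that(1)] that(2) by simp
  have le1: "p i * x \<le> x" if "i < 2 * l" "x > 0" for i x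
    using p_le_1[OF that(1)] that(2) by (simp add: mult_left_le_one_le p_nonneg that(1))
  have lec: "c * x \<le> p i * x" if "i < 2 * l" "p i > 0" "x > 0" for i x
    using c(3)[OF that(1,2)] that(3) by (intro mult_right_mono) auto
  have idx: "j < 2 * l" "j + l < 2 * l" "j' < 2 * l" "j' + l < 2 * l" using w(1) j' by auto
  show "sm (j # w) \<le> 2 * sm w"
    using le1[OF idx(1) ab(1)] le1[OF idx(2) ab(2)] le1[OF idx(3) ab(2)] le1[OF idx(4) ab(1)]
    unfolding s s' by simp
  show "c * sm w \<le> sm (j # w)"
  proof (cases "j \<in> B")
    case False
    show ?thesis
      using lec[OF idx(1) pos[OF w(1)] ab(1)] lec[OF idx(2) p_pos_not_unflipped[OF w(1) False] ab(2)]
        nn[OF idx(3) ab(2)] nn[OF idx(4) ab(1)]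
      unfolding s s' by (simp add: algebra_simps)
  next
    case True
    then have "j' \<notin> B" unfolding j'_def by (rule reflect_not_unflipped)
    then show ?thesis
      using lec[OF idx(3) pos[OF j'] ab(2)] lec[OF idx(4) p_pos_not_unflipped[OF j'] ab(1)]
        nn[OF idx(1) ab(1)] nn[OF idx(2) ab(2)]
      unfolding s s' by (simp add: algebra_simps)
  qed
qed

text \<open>A digit outside \<open>B\<close> at a fixed position makes the mass comparable to the symmetrized mass, with a
  constant that depends on the position only.\<close>

lemma sym_mass_le_word_mass:
  "\<exists>C>0. \<forall>w. set w \<subseteq> {..<l} \<and> N < length w \<and> w ! N \<notin> B \<longrightarrow> C * sm w \<le> wm w"
proof -
  obtain c where c: "c > 0" "c \<le> 1" "\<And>i. i < 2 * l \<Longrightarrow> p i > 0 \<Longrightarrow> c \<le> p i"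
    using min_weight by blast
  show ?thesis
  proof (induction N)
    case 0
    show ?case
    proof (intro exI[of _ c] conjI allI impI)
      fix w assume w: "set w \<subseteq> {..<l} \<and> 0 < length w \<and> w ! 0 \<notin> B"
      then obtain j v where v: "w = j # v" by (cases w) auto
      with w have jv: "j < l" "set v \<subseteq> {..<l}" "j \<notin> B" by auto
      have "c * sm w \<le> c * (2 * sm v)"
        using sym_mass_Cons(2)[OF c jv(1,2)] c(1) v by (intro mult_left_mono) auto
      also have "\<dots> \<le> wm w" using word_mass_lower(2)[OF c, of w j v] w v jv by simp
      finally show "c * sm w \<le> wm w" .
    qed (use c in auto)
  next
    case (Suc N)
    then obtain C where C: "C > 0" "\<And>w. set w \<subseteq> {..<l} \<Longrightarrow> N < length w \<Longrightarrow> w ! N \<notin> B \<Longrightarrow> C * sm w \<le> wm w"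
      by blast
    show ?case
    proof (intro exI[of _ "c * C / 2"] conjI allI impI)
      fix w assume w: "set w \<subseteq> {..<l} \<and> Suc N < length w \<and> w ! Suc N \<notin> B"
      then obtain j v where v: "w = j # v" by (cases w) auto
      with w have jv: "j < l" "set v \<subseteq> {..<l}" "N < length v" "v ! N \<notin> B" by auto
      have "c * C / 2 * sm w \<le> c * C / 2 * (2 * sm v)"
        using sym_mass_Cons(2)[OF c jv(1,2)] c(1) C(1) v by (intro mult_left_mono) auto
      also have "\<dots> = c * (C * sm v)" by simp
      also have "\<dots> \<le> c * wm v" using C(2)[OF jv(2-4)] c(1) by (intro mult_left_mono) auto
      also have "\<dots> \<le> wm w" using word_mass_lower(1)[OF c, of w j v] w v by simp
      finally show "c * C / 2 * sm w \<le> wm w" .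
    qed (use c C in auto)
  qed
qed

lemma level_sets_agree:
  "level_set l \<mu> \<alpha> - unflipped_points = level_set l (symmetrized \<mu>) \<alpha> - unflipped_points"
proof -
  have "x \<in> level_set l \<mu> \<alpha> \<longleftrightarrow> x \<in> level_set l (symmetrized \<mu>) \<alpha>"
    if x: "x \<in> {0..1}" "x \<notin> unflipped_points" for x
  proof -
    obtain N where N: "adic_digit l x N \<notin> B" using x by (auto simp: unflipped_points_def)
    obtain C where C: "C > 0" "\<And>w. set w \<subseteq> {..<l} \<Longrightarrow> N < length w \<Longrightarrow> w ! N \<notin> B \<Longrightarrow> C * sm w \<le> wm w"
      using sym_mass_le_word_mass[of N] by blast
    have "0 < sm (adic_word l x n) \<and> C * sm (adic_word l x n) \<le> wm (adic_word l x n) \<and>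
        wm (adic_word l x n) \<le> 2 * sm (adic_word l x n)" if "n \<ge> Suc N" for n
      using C(2)[OF adic_digits, of x n] N that sym_mass_pos[OF adic_digits]
        word_mass_le_sym_mass[OF adic_digits]
      by (simp add: adic_word_def)
    from exponent_tendsto_cong[of C 2 "Suc N" "\<lambda>n. sm (adic_word l x n)" "\<lambda>n. wm (adic_word l x n)", OF C(1) _ this]
    show ?thesis unfolding level_set_mu_iff level_set_nu_iff by simp
  qed
  moreover have "level_set l m \<alpha> \<subseteq> {0..1}" for m by (auto simp: level_set_def)
  ultimately show ?thesis by blast
qed

lemma level_set_nu_prepend:
  assumes "x \<in> level_set l (symmetrized \<mu>) \<alpha>" "x \<noteq> 1" "j < l"
  shows "(x + real j) / real l \<in> level_set l (symmetrized \<mu>) \<alpha>"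
proof -
  define y where "y = (x + real j) / real l"
  have x: "x \<in> {0..<1}" using assms(1,2) by (auto simp: level_set_nu_iff)
  note y = adic_word_prepend[OF l2 x assms(3), folded y_def]
  obtain c where c: "c > 0" "c \<le> 1" "\<And>i. i < 2 * l \<Longrightarrow> p i > 0 \<Longrightarrow> c \<le> p i"
    using min_weight by blast
  have "(\<lambda>n. - ln (sm (adic_word l y (Suc n))) / (real n * ln (real l))) \<longlonglongrightarrow> \<alpha> \<longleftrightarrow>
      (\<lambda>n. - ln (sm (adic_word l x n)) / (real n * ln (real l))) \<longlonglongrightarrow> \<alpha>"
    by (rule exponent_tendsto_cong[of c 2 0])
       (use c sym_mass_Cons[OF c assms(3) adic_digits[of x]] sym_mass_pos[OF adic_digits] in \<open>auto simp: y(2)\<close>)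
  then have "(\<lambda>n. - ln (sm (adic_word l y (Suc n))) / (real n * ln (real l))) \<longlonglongrightarrow> \<alpha>"
    using assms(1) by (simp add: level_set_nu_iff)
  then have "(\<lambda>n. - ln (sm (adic_word l y n)) / (real n * ln (real l))) \<longlonglongrightarrow> \<alpha>"
    by (rule exponent_tendsto_Suc)
  then show ?thesis using y(1) by (simp add: level_set_nu_iff y_def)
qed

lemma prepend_not_unflipped:
  assumes "x \<in> {0..<1}" "j < l" "j \<notin> B"
  shows "(x + real j) / real l \<notin> unflipped_points"
proof -
  have "adic_digit l ((x + real j) / real l) 0 = adic_word l ((x + real j) / real l) (Suc 0) ! 0"
    by (simp add: adic_word_def)
  also have "\<dots> = j" using adic_word_prepend(2)[OF l2 assms(1,2), of 0] by simp
  finally have "adic_digit l ((x + real j) / real l) 0 \<notin> B" using assms(3) by simp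
  then show ?thesis unfolding unflipped_points_def by blast
qed

text \<open>The point 1 needs a separate treatment: for \<open>j < l - 1\<close> the digits of \<open>(1 + j) / l\<close> are not \<open>j\<close>
  followed by those of 1, but end in 0. By symmetry 1 can be replaced by 0.\<close>

lemma level_set_nu_flipped_nonempty:
  assumes "level_set l (symmetrized \<mu>) \<alpha> \<noteq> {}"
  shows "level_set l (symmetrized \<mu>) \<alpha> - unflipped_points \<noteq> {}"
proof -
  obtain x where x: "x \<in> level_set l (symmetrized \<mu>) \<alpha>" using assms by blast
  obtain y where y: "y \<in> level_set l (symmetrized \<mu>) \<alpha>" "y \<noteq> 1"
  proof (cases "x = 1")
    case True
    have "reflect_word l (adic_word l 1 n) = adic_word l 0 n" "reflect_word l (adic_word l 0 n) = adic_word l 1 n" for n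
      using l2 by (auto simp: adic_word_one[OF l2] adic_word_zero map_replicate)
    then have "sm (adic_word l 0 n) = sm (adic_word l 1 n)" for n
      by (simp add: sym_mass_def add.commute)
    then have "0 \<in> level_set l (symmetrized \<mu>) \<alpha>" using x True by (simp add: level_set_nu_iff)
    then show thesis by (rule that) simp
  qed (use x that in blast)
  obtain j where j: "j < l" "j \<notin> B" using exists_flipped_digit by blast
  have "y \<in> {0..<1}" using y by (auto simp: level_set_nu_iff)
  then show ?thesis using level_set_nu_prepend[OF y j(1)] prepend_not_unflipped[of y j] j by blast
qed

text \<open>Prepending a digit outside \<open>B\<close> embeds the part of the level set inside \<open>unflipped_points\<close>, up to
  the point 1, into the part outside.\<close>

lemma hausdorff_dim_level_set_nu:
  "hausdorff_dim (level_set l (symmetrized \<mu>) \<alpha>) =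
    hausdorff_dim (level_set l (symmetrized \<mu>) \<alpha> - unflipped_points)"
proof (rule antisym)
  define E where "E = level_set l (symmetrized \<mu>) \<alpha>"
  obtain j where j: "j < l" "j \<notin> B" using exists_flipped_digit by blast
  define S where "S = (\<lambda>x. (x + real j) / real l)"
  define F where "F = (E \<inter> unflipped_points) - {1}"
  have l0: "real l > 0" using l2 by simp
  have "hausdorff_dim F = hausdorff_dim ((\<lambda>y. real l * y - real j) ` (S ` F))"
    using l0 by (simp add: image_image S_def)
  also have "\<dots> \<le> hausdorff_dim (S ` F)"
  proof (rule hausdorff_dim_lipschitz_image[OF _ l0])
    fix x y :: real
    have "\<bar>real l * (x - y)\<bar> = real l * \<bar>x - y\<bar>" by (simp add: abs_mult)
    then show "dist (real l * x - real j) (real l * y - real j) \<le> real l * dist x y"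
      by (simp add: dist_real_def algebra_simps)
  qed
  also have "\<dots> \<le> hausdorff_dim (E - unflipped_points)"
  proof (rule hausdorff_dim_mono)
    show "S ` F \<subseteq> E - unflipped_points"
    proof
      fix y assume "y \<in> S ` F"
      then obtain x where x: "x \<in> E" "x \<noteq> 1" "y = S x" by (auto simp: F_def)
      have "x \<in> {0..<1}" using x by (auto simp: E_def level_set_nu_iff)
      then show "y \<in> E - unflipped_points"
        using level_set_nu_prepend[of x \<alpha> j] prepend_not_unflipped[of x j] j x by (auto simp: E_def S_def)
    qed
  qed
  finally have F: "hausdorff_dim F \<le> hausdorff_dim (E - unflipped_points)" .
  have "E \<subseteq> (E - unflipped_points) \<union> F \<union> {1}" by (auto simp: F_def)
  then have "hausdorff_dim E \<le> hausdorff_dim ((E - unflipped_points) \<union> F \<union> {1})" by (rule hausdorff_dim_mono)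
  also have "\<dots> \<le> hausdorff_dim (E - unflipped_points)"
    using F hausdorff_dim_nonneg[of "E - unflipped_points"] 
    unfolding hausdorff_dim_Un hausdorff_dim_singleton by simp
  finally show "hausdorff_dim (level_set l (symmetrized \<mu>) \<alpha>) \<le>
      hausdorff_dim (level_set l (symmetrized \<mu>) \<alpha> - unflipped_points)" by (simp add: E_def)
qed (auto intro: hausdorff_dim_mono)

end

section \<open>Upper bound on the unflipped points\<close>

lemma sum_prod_list_words:
  fixes g :: "'a \<Rightarrow> real"
  assumes "finite Z"
  shows "(\<Sum>w\<in>{w. set w \<subseteq> Z \<and> length w = n}. prod_list (map g w)) = (\<Sum>i\<in>Z. g i) ^ n"
proof (induction n)
  case (Suc n)
  let ?W = "{w. set w \<subseteq> Z \<and> length w = n}"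
  have "(\<Sum>w\<in>{w. set w \<subseteq> Z \<and> length w = Suc n}. prod_list (map g w)) =
      (\<Sum>(w, i)\<in>?W \<times> Z. g i * prod_list (map g w))"
    unfolding lists_length_Suc_eq
    by (subst sum.reindex) (auto simp: inj_on_def case_prod_unfold)
  also have "\<dots> = (\<Sum>w\<in>?W. \<Sum>i\<in>Z. g i * prod_list (map g w))" by (simp add: sum.cartesian_product)
  also have "\<dots> = (\<Sum>w\<in>?W. (\<Sum>i\<in>Z. g i) * prod_list (map g w))" by (simp add: sum_distrib_right)
  also have "\<dots> = (\<Sum>i\<in>Z. g i) * (\<Sum>w\<in>?W. prod_list (map g w))" by (simp add: sum_distrib_left)
  finally show ?case by (simp add: Suc)
qed (simp add: Collect_conv_if)

context reflected_ifs
begin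

text \<open>On the unflipped points the exponent \<open>\<alpha>\<close> means that the averages of this function over the digits
  tend to 0. In terms of it the expression \<open>\<alpha> * q + tau_tilde l p q\<close>
  is, for nonempty \<open>B\<close>, \<open>ln (\<Sum>i\<in>B. exp (q * digit_excess \<alpha> i)) / ln l\<close> (lemma \<open>legendre_eq\<close> below).\<close>

definition digit_excess :: "real \<Rightarrow> nat \<Rightarrow> real" where
  "digit_excess \<alpha> i = \<alpha> * ln (real l) + ln (p i)"

text \<open>The exponent interval consists of those \<open>\<alpha>\<close> for which 0 is between the extreme values of
  \<open>digit_excess \<alpha>\<close> on \<open>B\<close>.\<close>

lemma exponent_range_iff:
  "\<alpha> \<in> exponent_range l p B \<longleftrightarrow> (\<exists>i\<in>B. digit_excess \<alpha> i \<le> 0) \<and> (\<exists>i\<in>B. digit_excess \<alpha> i \<ge> 0)"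
proof (cases "B = {}")
  case False
  have fin: "finite (p ` B)" "p ` B \<noteq> {}" using finite_B False by auto
  have p0: "p i > 0" if "i \<in> B" for i using pos B_less that by blast
  have max0: "Max (p ` B) > 0" and min0: "Min (p ` B) > 0"
    using Max_in[OF fin] Min_in[OF fin] p0 by auto
  have up: "- log (real l) x \<le> \<alpha> \<longleftrightarrow> - (\<alpha> * ln (real l)) \<le> ln x"
    and lo: "\<alpha> \<le> - log (real l) x \<longleftrightarrow> ln x \<le> - (\<alpha> * ln (real l))" for x
    using ln_l_pos by (auto simp: log_def field_simps)
  have "- (\<alpha> * ln (real l)) \<le> ln (Max (p ` B)) \<longleftrightarrow> exp (- (\<alpha> * ln (real l))) \<le> Max (p ` B)"
    using ln_ge_iff[OF max0] .
  also have "\<dots> \<longleftrightarrow> (\<exists>i\<in>B. exp (- (\<alpha> * ln (real l))) \<le> p i)" using Max_ge_iff[OF fin] by auto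
  also have "\<dots> \<longleftrightarrow> (\<exists>i\<in>B. digit_excess \<alpha> i \<ge> 0)"
    by (intro bex_cong refl) (auto simp: ln_ge_iff[OF p0, symmetric] digit_excess_def)
  finally have 1: "- log (real l) (Max (p ` B)) \<le> \<alpha> \<longleftrightarrow> (\<exists>i\<in>B. digit_excess \<alpha> i \<ge> 0)" unfolding up .
  have le: "ln x \<le> y \<longleftrightarrow> x \<le> exp y" if "x > 0" for x y :: real
    using that by (metis exp_gt_zero ln_exp ln_le_cancel_iff)
  have "ln (Min (p ` B)) \<le> - (\<alpha> * ln (real l)) \<longleftrightarrow> Min (p ` B) \<le> exp (- (\<alpha> * ln (real l)))"
    using le[OF min0] .
  also have "\<dots> \<longleftrightarrow> (\<exists>i\<in>B. p i \<le> exp (- (\<alpha> * ln (real l))))" using Min_le_iff[OF fin] by auto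
  also have "\<dots> \<longleftrightarrow> (\<exists>i\<in>B. digit_excess \<alpha> i \<le> 0)"
    by (intro bex_cong refl) (auto simp: le[OF p0, symmetric] digit_excess_def)
  finally have 2: "\<alpha> \<le> - log (real l) (Min (p ` B)) \<longleftrightarrow> (\<exists>i\<in>B. digit_excess \<alpha> i \<le> 0)" unfolding lo .
  show ?thesis using False 1 2 by (auto simp: exponent_range_def)
qed (simp add: exponent_range_def)

lemma legendre_eq:
  assumes "B \<noteq> {}"
  shows "legendre (tau_tilde l p) \<alpha> =
    (INF q. ereal (ln (\<Sum>i\<in>B. exp (q * digit_excess \<alpha> i)) / ln (real l)))"
proof -
  have "ereal (\<alpha> * q) + tau_tilde l p q = ereal (ln (\<Sum>i\<in>B. exp (q * digit_excess \<alpha> i)) / ln (real l))" for q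
  proof -
    have p0: "p i \<noteq> 0" if "i \<in> B" for i using pos[OF B_less[OF that]] by simp
    have "(\<Sum>i\<in>B. exp (q * digit_excess \<alpha> i)) = (\<Sum>i\<in>B. exp (\<alpha> * q * ln (real l)) * p i powr q)"
      by (intro sum.cong refl) (simp add: p0 digit_excess_def powr_def exp_add[symmetric] algebra_simps)
    also have "\<dots> = exp (\<alpha> * q * ln (real l)) * (\<Sum>i\<in>B. p i powr q)" by (simp add: sum_distrib_left)
    finally have e: "(\<Sum>i\<in>B. exp (q * digit_excess \<alpha> i)) = exp (\<alpha> * q * ln (real l)) * (\<Sum>i\<in>B. p i powr q)" .
    have "(\<Sum>i\<in>B. p i powr q) > 0" using assms finite_B p0 by (intro sum_pos) auto
    then have "ln (\<Sum>i\<in>B. exp (q * digit_excess \<alpha> i)) = \<alpha> * q * ln (real l) + ln (\<Sum>i\<in>B. p i powr q)"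
      unfolding e by (simp add: ln_mult)
    then show ?thesis using assms ln_l_pos by (simp add: tau_tilde_def log_def add_divide_distrib)
  qed
  then show ?thesis by (simp add: legendre_def)
qed

text \<open>If all values of \<open>digit_excess \<alpha>\<close> have the same strict sign, \<open>q\<close> can be taken to plus or minus
  infinity, and the exponential sum tends to 0.\<close>

lemma legendre_nonpos_outside_range:
  assumes "\<alpha> \<notin> exponent_range l p B"
  shows "legendre (tau_tilde l p) \<alpha> \<le> 0"
proof (cases "B = {}")
  case True
  have "legendre (tau_tilde l p) \<alpha> \<le> ereal (\<alpha> * 0) + tau_tilde l p 0"
    unfolding legendre_def by (rule INF_lower) simp
  also have "\<dots> \<le> 0" using True by (simp add: tau_tilde_def)
  finally show ?thesis .
next
  case False
  have decay: "\<exists>n::nat. (\<Sum>i\<in>B. exp (real n * u i)) \<le> 1" if "\<And>i. i \<in> B \<Longrightarrow> u i < 0" for u :: "nat \<Rightarrow> real"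
  proof -
    have "(\<lambda>n. \<Sum>i\<in>B. exp (u i) ^ n) \<longlonglongrightarrow> (\<Sum>i\<in>B. 0)"
      using that by (intro tendsto_sum LIMSEQ_realpow_zero) auto
    then have "eventually (\<lambda>n. (\<Sum>i\<in>B. exp (u i) ^ n) < 1) sequentially"
      by (intro order_tendstoD(2)) auto
    then obtain n where "(\<Sum>i\<in>B. exp (u i) ^ n) < 1" by (auto simp: eventually_sequentially)
    then show ?thesis by (intro exI[of _ n]) (simp add: exp_of_nat_mult)
  qed
  have "\<exists>q. (\<Sum>i\<in>B. exp (q * digit_excess \<alpha> i)) \<le> 1"
  proof (cases "\<exists>i\<in>B. digit_excess \<alpha> i \<le> 0")
    case True
    then have "digit_excess \<alpha> i < 0" if "i \<in> B" for i
      using assms that unfolding exponent_range_iff by force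
    from decay[of "digit_excess \<alpha>", OF this] show ?thesis by blast
  next
    case False
    then have "- digit_excess \<alpha> i < 0" if "i \<in> B" for i using that by force
    from decay[of "\<lambda>i. - digit_excess \<alpha> i", OF this] obtain n :: nat
      where "(\<Sum>i\<in>B. exp (real n * - digit_excess \<alpha> i)) \<le> 1" by blast
    then show ?thesis by (intro exI[of _ "- real n"]) simp
  qed
  then obtain q where q: "(\<Sum>i\<in>B. exp (q * digit_excess \<alpha> i)) \<le> 1" by blast
  have "(\<Sum>i\<in>B. exp (q * digit_excess \<alpha> i)) > 0" using False finite_B by (intro sum_pos) auto
  then have "ln (\<Sum>i\<in>B. exp (q * digit_excess \<alpha> i)) / ln (real l) \<le> 0"
    using q ln_l_pos by (simp add: divide_nonpos_pos)
  moreover have "legendre (tau_tilde l p) \<alpha> \<le> ereal (ln (\<Sum>i\<in>B. exp (q * digit_excess \<alpha> i)) / ln (real l))"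
    unfolding legendre_eq[OF False] by (rule INF_lower) simp
  ultimately show ?thesis by (metis ereal_less_eq(3) order_trans zero_ereal_def)
qed

lemma level_set_unflipped_iff:
  assumes "x \<in> unflipped_points"
  shows "x \<in> level_set l \<mu> \<alpha> \<longleftrightarrow>
    (\<lambda>n. (\<Sum>k<n. digit_excess \<alpha> (adic_digit l x k)) / real n) \<longlonglongrightarrow> 0"
proof -
  have x: "x \<in> {0..1}" and d: "adic_digit l x k \<in> B" for k using assms by (auto simp: unflipped_points_def)
  have p0: "p (adic_digit l x k) > 0" for k using pos B_less d by blast
  define S where "S n = (\<Sum>k<n. digit_excess \<alpha> (adic_digit l x k))" for n
  have wm: "ln (wm (adic_word l x n)) = S n - real n * \<alpha> * ln (real l)" for n
  proof (induction n)
    case (Suc n)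
    have "set (adic_word l x m) \<subseteq> B" for m using d by (auto simp: adic_word_def)
    then have W: "wm (adic_word l x m) = prod_list (map p (adic_word l x m))" for m
      by (rule word_mass_unflipped)
    have "wm (adic_word l x (Suc n)) = wm (adic_word l x n) * p (adic_digit l x n)"
      unfolding W by (simp add: adic_word_def)
    then have "ln (wm (adic_word l x (Suc n))) = ln (wm (adic_word l x n)) + ln (p (adic_digit l x n))"
      using word_mass_pos[OF adic_digits, of x n] p0[of n] by (simp add: ln_mult)
    then show ?case using Suc by (simp add: S_def digit_excess_def algebra_simps)
  qed (simp add: S_def adic_word_def)
  have L: "ln (real l) \<noteq> 0" using ln_l_pos by simp
  have eq: "\<forall>\<^sub>F n in sequentially. - ln (wm (adic_word l x n)) / (real n * ln (real l)) =
      \<alpha> - (S n / real n) / ln (real l)"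
    using eventually_gt_at_top[of 0]
  proof eventually_elim
    case (elim n)
    then show ?case using L unfolding wm by (simp add: field_simps)
  qed
  have "x \<in> level_set l \<mu> \<alpha> \<longleftrightarrow> (\<lambda>n. \<alpha> - (S n / real n) / ln (real l)) \<longlonglongrightarrow> \<alpha>"
    unfolding level_set_mu_iff using x tendsto_cong[OF eq] by simp
  also have "\<dots> \<longleftrightarrow> (\<lambda>n. S n / real n) \<longlonglongrightarrow> 0"
  proof
    assume "(\<lambda>n. \<alpha> - (S n / real n) / ln (real l)) \<longlonglongrightarrow> \<alpha>"
    then have "(\<lambda>n. (\<alpha> - (\<alpha> - (S n / real n) / ln (real l))) * ln (real l)) \<longlonglongrightarrow> (\<alpha> - \<alpha>) * ln (real l)"
      by (intro tendsto_intros)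
    then show "(\<lambda>n. S n / real n) \<longlonglongrightarrow> 0" using L by simp
  next
    assume "(\<lambda>n. S n / real n) \<longlonglongrightarrow> 0"
    then have "(\<lambda>n. \<alpha> - (S n / real n) / ln (real l)) \<longlonglongrightarrow> \<alpha> - 0 / ln (real l)"
      using L by (intro tendsto_intros)
    then show "(\<lambda>n. \<alpha> - (S n / real n) / ln (real l)) \<longlonglongrightarrow> \<alpha>" by simp
  qed
  finally show ?thesis by (simp add: S_def)
qed

lemma unflipped_level_set_exponent_range:
  assumes "x \<in> level_set l \<mu> \<alpha> \<inter> unflipped_points"
  shows "\<alpha> \<in> exponent_range l p B"
proof -
  have d: "adic_digit l x k \<in> B" for k using assms by (auto simp: unflipped_points_def)
  then have "B \<noteq> {}" by blast
  have no: False if m: "m > 0" "\<And>i. i \<in> B \<Longrightarrow> m \<le> s * digit_excess \<alpha> i" for m s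
  proof -
    have lim: "(\<lambda>n. (\<Sum>k<n. digit_excess \<alpha> (adic_digit l x k)) / real n) \<longlonglongrightarrow> 0"
      using assms level_set_unflipped_iff by blast
    have "(\<lambda>n. s * ((\<Sum>k<n. digit_excess \<alpha> (adic_digit l x k)) / real n)) \<longlonglongrightarrow> s * 0"
      by (intro tendsto_mult tendsto_const lim)
    moreover have "\<forall>\<^sub>F n in sequentially. m \<le> s * ((\<Sum>k<n. digit_excess \<alpha> (adic_digit l x k)) / real n)"
      using eventually_gt_at_top[of 0]
    proof eventually_elim
      case (elim n)
      have "real n * m = (\<Sum>k<n. m)" by simp
      also have "\<dots> \<le> (\<Sum>k<n. s * digit_excess \<alpha> (adic_digit l x k))" by (intro sum_mono m(2) d)
      finally show ?case using elim by (simp add: field_simps sum_distrib_left)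
    qed
    ultimately have "m \<le> s * 0" by (intro tendsto_lowerbound) auto
    with m(1) show False by simp
  qed
  have min: "\<exists>m>0. \<forall>i\<in>B. m \<le> f i" if "\<And>i. i \<in> B \<Longrightarrow> f i > 0" for f :: "nat \<Rightarrow> real"
    using that finite_B \<open>B \<noteq> {}\<close> by (intro exI[of _ "Min (f ` B)"]) auto
  show ?thesis
  proof (rule ccontr)
    assume "\<alpha> \<notin> exponent_range l p B"
    then have "(\<forall>i\<in>B. digit_excess \<alpha> i > 0) \<or> (\<forall>i\<in>B. - digit_excess \<alpha> i > 0)"
      unfolding exponent_range_iff by force
    then consider "\<And>i. i \<in> B \<Longrightarrow> digit_excess \<alpha> i > 0" | "\<And>i. i \<in> B \<Longrightarrow> - digit_excess \<alpha> i > 0" by blast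
    then show False
    proof cases
      case 1
      then obtain m where "m > 0" "\<And>i. i \<in> B \<Longrightarrow> m \<le> digit_excess \<alpha> i" using min by blast
      then show False using no[of m 1] by simp
    next
      case 2
      then obtain m where "m > 0" "\<And>i. i \<in> B \<Longrightarrow> m \<le> - digit_excess \<alpha> i"
        using min[of "\<lambda>i. - digit_excess \<alpha> i"] by blast
      then show False using no[of m "-1"] by simp
    qed
  qed
qed

text \<open>For a word \<open>w\<close> over \<open>B\<close> of length \<open>n\<close> whose excess sum is at most \<open>\<epsilon> * n\<close> in absolute value, the product of the
  \<open>exp (q * digit_excess \<alpha> i)\<close> over its digits is at least \<open>exp (- \<bar>q\<bar> * \<epsilon> * n)\<close>, while these products
  sum up to the \<open>n\<close>-th power of \<open>\<Sum>i\<in>B. exp (q * digit_excess \<alpha> i)\<close>. This bounds the number of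
  intervals of level \<open>n\<close> that are needed.\<close>

lemma null_unflipped_deviation_set:
  assumes small: "ln (\<Sum>i\<in>B. exp (q * digit_excess \<alpha> i)) + \<bar>q\<bar> * \<epsilon> < t * ln (real l)"
    and "t > 0" "B \<noteq> {}"
  shows "hausdorff_measure t {x \<in> unflipped_points.
    \<forall>n\<ge>N. \<bar>\<Sum>k<n. digit_excess \<alpha> (adic_digit l x k)\<bar> \<le> \<epsilon> * real n} = 0" (is "hausdorff_measure t ?A = 0")
proof (rule hausdorff_null_finite_covers)
  fix \<delta> e :: real assume "\<delta> > 0" "e > 0"
  define F where "F = (\<Sum>i\<in>B. exp (q * digit_excess \<alpha> i))"
  have "F > 0" unfolding F_def using \<open>B \<noteq> {}\<close> finite_B by (intro sum_pos) auto
  define r where "r = exp (ln F + \<bar>q\<bar> * \<epsilon> - t * ln (real l))"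
  have r: "0 < r" "r < 1" using small by (auto simp: r_def F_def)
  have "(\<lambda>n. r ^ n) \<longlonglongrightarrow> 0" using r by (intro LIMSEQ_realpow_zero) auto
  then have "\<forall>\<^sub>F n in sequentially. r ^ n < e" using \<open>e > 0\<close> by (intro order_tendstoD(2))
  moreover have "(\<lambda>n. (1 / real l) ^ n) \<longlonglongrightarrow> 0" using l2 by (intro LIMSEQ_realpow_zero) auto
  then have "\<forall>\<^sub>F n in sequentially. (1 / real l) ^ n < \<delta>" using \<open>\<delta> > 0\<close> by (intro order_tendstoD(2))
  ultimately have "\<forall>\<^sub>F n in sequentially. r ^ n < e \<and> (1 / real l) ^ n < \<delta> \<and> N \<le> n"
    using eventually_ge_at_top[of N] by eventually_elim auto
  then obtain n where n: "r ^ n < e" "(1 / real l) ^ n < \<delta>" "N \<le> n"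
    by (auto simp: eventually_sequentially)
  define W where "W = {w. set w \<subseteq> B \<and> length w = n}"
  define V where "V = {w \<in> W. \<bar>sum_list (map (digit_excess \<alpha>) w)\<bar> \<le> \<epsilon> * real n}"
  \<comment> \<open>Closed intervals, so that the point 1 is covered as well.\<close>
  define I where "I w = {real (word_index l w) / real l ^ n .. (real (word_index l w) + 1) / real l ^ n}" for w
  have finW: "finite W" unfolding W_def using finite_lists_length_eq[OF finite_B] by simp
  then have finV: "finite V" by (simp add: V_def)
  have pw: "real l ^ n > 0" using l2 by simp
  have diam: "diameter (I w) = (1 / real l) ^ n" for w
  proof -
    have "diameter (I w) = (real (word_index l w) + 1) / real l ^ n - real (word_index l w) / real l ^ n"
      unfolding I_def using divide_right_mono[of "real (word_index l w)" "real (word_index l w) + 1" "real l ^ n"] pw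
      by (simp del: zero_less_power)
    then show ?thesis by (simp add: add_divide_distrib power_one_over)
  qed
  have "real (card V) \<le> exp (\<bar>q\<bar> * \<epsilon> * real n) * F ^ n"
  proof -
    have le: "1 \<le> exp (\<bar>q\<bar> * \<epsilon> * real n) * prod_list (map (\<lambda>i. exp (q * digit_excess \<alpha> i)) w)" if "w \<in> V" for w
    proof -
      have "prod_list (map (\<lambda>i. exp (q * digit_excess \<alpha> i)) w) = exp (q * sum_list (map (digit_excess \<alpha>) w))"
        by (induction w) (auto simp: exp_add algebra_simps)
      moreover have "\<bar>q * sum_list (map (digit_excess \<alpha>) w)\<bar> \<le> \<bar>q\<bar> * (\<epsilon> * real n)"
        using that unfolding abs_mult by (intro mult_left_mono) (auto simp: V_def)
      then have "0 \<le> \<bar>q\<bar> * \<epsilon> * real n + q * sum_list (map (digit_excess \<alpha>) w)" by (simp add: mult.assoc abs_le_iff)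
      ultimately show ?thesis by (simp add: exp_add[symmetric])
    qed
    have "real (card V) = (\<Sum>w\<in>V. 1)" by simp
    also have "\<dots> \<le> (\<Sum>w\<in>V. exp (\<bar>q\<bar> * \<epsilon> * real n) * prod_list (map (\<lambda>i. exp (q * digit_excess \<alpha> i)) w))"
      by (intro sum_mono le)
    also have "\<dots> \<le> (\<Sum>w\<in>W. exp (\<bar>q\<bar> * \<epsilon> * real n) * prod_list (map (\<lambda>i. exp (q * digit_excess \<alpha> i)) w))"
      by (intro sum_mono2 finW) (auto simp: V_def intro!: mult_nonneg_nonneg prod_list_nonneg)
    also have "\<dots> = exp (\<bar>q\<bar> * \<epsilon> * real n) * F ^ n"
      unfolding W_def F_def sum_distrib_left[symmetric] sum_prod_list_words[OF finite_B] ..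
    finally show ?thesis .
  qed
  note card = this
  have total: "real (card V) * ((1 / real l) ^ n) powr t \<le> e"
  proof -
    have "((1 / real l) ^ n) powr t = exp (- (real n * t * ln (real l)))"
      using l2 by (simp add: powr_def ln_realpow ln_div)
    moreover have "F ^ n = exp (real n * ln F)" using \<open>F > 0\<close> by (simp add: exp_of_nat_mult)
    ultimately have "real (card V) * ((1 / real l) ^ n) powr t \<le>
        exp (\<bar>q\<bar> * \<epsilon> * real n) * exp (real n * ln F) * exp (- (real n * t * ln (real l)))"
      using card by (simp add: mult_right_mono)
    also have "\<dots> = r ^ n"
      by (simp add: r_def exp_of_nat_mult[symmetric] exp_add[symmetric] algebra_simps)
    finally show ?thesis using n(1) by linarith
  qed
  have "?A \<subseteq> \<Union>(I ` V)"
  proof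
    fix x assume x: "x \<in> ?A"
    then have x01: "x \<in> {0..1}" and d: "adic_digit l x k \<in> B" for k by (auto simp: unflipped_points_def)
    define w where "w = adic_word l x n"
    have "sum_list (map (digit_excess \<alpha>) w) = (\<Sum>k<n. digit_excess \<alpha> (adic_digit l x k))"
      by (simp add: w_def adic_word_def sum_list_sum_nth atLeast0LessThan)
    then have "w \<in> V" using x d n(3) by (auto simp: V_def W_def w_def adic_word_def)
    moreover have "x \<in> I w"
      unfolding I_def w_def word_index_adic_word[OF l2 x01]
      using adic_index_bounds(1,2)[OF l2 x01, of n] pw by (simp add: field_simps)
    ultimately show "x \<in> \<Union>(I ` V)" by blast
  qed
  moreover have "\<forall>U\<in>I ` V. bounded U \<and> diameter U \<le> \<delta>"
  proof safe
    show "bounded (I w)" for w unfolding I_def by (rule bounded_closed_interval)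
    show "diameter (I w) \<le> \<delta>" for w using n(2) by (simp add: diam)
  qed
  moreover have "(\<Sum>U\<in>I ` V. diam_power t U) \<le> ennreal e"
  proof -
    have "(\<Sum>U\<in>I ` V. diam_power t U) = (\<Sum>U\<in>I ` V. ennreal (((1 / real l) ^ n) powr t))"
    proof (rule sum.cong)
      fix U assume "U \<in> I ` V"
      then obtain w where w: "U = I w" by blast
      have "(real (word_index l w) + 1) / real l ^ n \<ge> real (word_index l w) / real l ^ n"
        using pw by (intro divide_right_mono) auto
      then have "I w \<noteq> {}" by (simp add: I_def del: divide_le_cancel)
      then show "diam_power t U = ennreal (((1 / real l) ^ n) powr t)"
        using \<open>t > 0\<close> by (simp add: diam_power_def diam w)
    qed simp
    also have "\<dots> = of_nat (card (I ` V)) * ennreal (((1 / real l) ^ n) powr t)" by simp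
    also have "\<dots> \<le> of_nat (card V) * ennreal (((1 / real l) ^ n) powr t)"
      using card_image_le[OF finV, of I] by (intro mult_right_mono) auto
    also have "\<dots> = ennreal (real (card V) * ((1 / real l) ^ n) powr t)"
      by (simp add: ennreal_of_nat_eq_real_of_nat ennreal_mult)
    also have "\<dots> \<le> ennreal e" by (rule ennreal_leI[OF total])
    finally show ?thesis .
  qed
  ultimately show "\<exists>\<F>. finite \<F> \<and> ?A \<subseteq> \<Union>\<F> \<and>
      (\<forall>U\<in>\<F>. bounded U \<and> diameter U \<le> \<delta>) \<and> (\<Sum>U\<in>\<F>. diam_power t U) \<le> ennreal e"
    using finV by (intro exI[of _ "I ` V"]) simp
qed

lemma hausdorff_dim_unflipped_le_legendre:
  assumes range: "\<alpha> \<in> exponent_range l p B"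
  shows "hausdorff_dim (level_set l \<mu> \<alpha> \<inter> unflipped_points) \<le> legendre (tau_tilde l p) \<alpha>"
proof -
  have "B \<noteq> {}" using range by (auto simp: exponent_range_def split: if_splits)
  show ?thesis unfolding legendre_eq[OF \<open>B \<noteq> {}\<close>]
  proof (rule INF_greatest)
    fix q :: real
    define f where "f = ln (\<Sum>i\<in>B. exp (q * digit_excess \<alpha> i)) / ln (real l)"
    obtain i where i: "i \<in> B" "0 \<le> q * digit_excess \<alpha> i"
    proof (cases "q \<ge> 0")
      case True
      obtain i where "i \<in> B" "digit_excess \<alpha> i \<ge> 0" using range unfolding exponent_range_iff by blast
      with True show thesis by (intro that) auto
    next
      case False
      obtain i where "i \<in> B" "digit_excess \<alpha> i \<le> 0" using range unfolding exponent_range_iff by blast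
      with False show thesis by (intro that) (auto intro: mult_nonpos_nonpos)
    qed
    have "1 \<le> exp (q * digit_excess \<alpha> i)" using i(2) by simp
    also have "\<dots> \<le> (\<Sum>i\<in>B. exp (q * digit_excess \<alpha> i))"
      using i(1) finite_B by (intro member_le_sum) auto
    finally have "f \<ge> 0" using ln_l_pos by (simp add: f_def)
    show "hausdorff_dim (level_set l \<mu> \<alpha> \<inter> unflipped_points) \<le> ereal f"
    proof (rule ereal_le_epsilon2)
      fix e :: real assume "e > 0"
      define t where "t = f + e"
      have t: "t > 0" using \<open>f \<ge> 0\<close> \<open>e > 0\<close> by (simp add: t_def)
      define \<epsilon> where "\<epsilon> = e * ln (real l) / (2 * (\<bar>q\<bar> + 1))"
      have "\<epsilon> > 0" using \<open>e > 0\<close> ln_l_pos by (auto simp: \<epsilon>_def intro!: divide_pos_pos)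
      have "\<bar>q\<bar> * \<epsilon> < (2 * (\<bar>q\<bar> + 1)) * \<epsilon>" using \<open>\<epsilon> > 0\<close> by (intro mult_strict_right_mono) auto
      also have "\<dots> = e * ln (real l)" by (simp add: \<epsilon>_def)
      finally have "\<bar>q\<bar> * \<epsilon> < e * ln (real l)" .
      moreover have "f * ln (real l) = ln (\<Sum>i\<in>B. exp (q * digit_excess \<alpha> i))" using ln_l_pos by (simp add: f_def)
      ultimately have small: "ln (\<Sum>i\<in>B. exp (q * digit_excess \<alpha> i)) + \<bar>q\<bar> * \<epsilon> < t * ln (real l)"
        by (simp add: t_def algebra_simps)
      define A where "A (N::nat) = {x \<in> unflipped_points. \<forall>n\<ge>N.
        \<bar>\<Sum>k<n. digit_excess \<alpha> (adic_digit l x k)\<bar> \<le> \<epsilon> * real n}" for N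
      have "hausdorff_measure t (\<Union>N. A N) = 0"
        unfolding A_def using t
        by (intro hausdorff_null_UN null_unflipped_deviation_set[OF small t \<open>B \<noteq> {}\<close>])
      moreover have "level_set l \<mu> \<alpha> \<inter> unflipped_points \<subseteq> (\<Union>N. A N)"
      proof
        fix x assume x: "x \<in> level_set l \<mu> \<alpha> \<inter> unflipped_points"
        then have "(\<lambda>n. (\<Sum>k<n. digit_excess \<alpha> (adic_digit l x k)) / real n) \<longlonglongrightarrow> 0"
          using level_set_unflipped_iff by blast
        from tendstoD[OF this \<open>\<epsilon> > 0\<close>] obtain N where
          N: "\<And>n. n \<ge> N \<Longrightarrow> \<bar>(\<Sum>k<n. digit_excess \<alpha> (adic_digit l x k)) / real n\<bar> < \<epsilon>"
          by (auto simp: eventually_sequentially dist_real_def)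
        have "\<bar>\<Sum>k<n. digit_excess \<alpha> (adic_digit l x k)\<bar> \<le> \<epsilon> * real n" if "n \<ge> N" for n
          using N[OF that] by (cases "n = 0") (auto simp: field_simps)
        then have "x \<in> A N" using x by (simp add: A_def)
        then show "x \<in> (\<Union>N. A N)" by blast
      qed
      ultimately have "hausdorff_measure t (level_set l \<mu> \<alpha> \<inter> unflipped_points) = 0"
        by (rule hausdorff_null_mono)
      then show "hausdorff_dim (level_set l \<mu> \<alpha> \<inter> unflipped_points) \<le> ereal f + ereal e"
        using hausdorff_dim_le[of t] t by (simp add: t_def)
    qed
  qed
qed

end

section \<open>Lower bound on the unflipped points\<close>

lemma word_index_inj:
  "length w = length v \<Longrightarrow> set w \<subseteq> {..<l} \<Longrightarrow> set v \<subseteq> {..<l} \<Longrightarrow> word_index l w = word_index l v \<Longrightarrow> w = v"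
proof (induction w v rule: list_induct2)
  case (Cons i w j v)
  have lt: "word_index l w < l ^ length w" "word_index l v < l ^ length w"
    using word_index_less[of w l] word_index_less[of v l] Cons by auto
  have e: "i * l ^ length w + word_index l w = j * l ^ length w + word_index l v"
    using Cons by simp
  have L: "l ^ length w \<noteq> 0" using lt(1) by linarith
  have "i = (i * l ^ length w + word_index l w) div l ^ length w" using lt(1) L by (simp del: power_not_zero power_eq_0_iff)
  also have "\<dots> = j" unfolding e using lt(2) L by (simp del: power_not_zero power_eq_0_iff)
  finally have "i = j" .
  then show ?case using e Cons by simp
qed simp

lemma power_between:
  fixes y :: real
  assumes "l \<ge> 2" "real l ^ N \<le> y"
  obtains n where "N \<le> n" "real l ^ n \<le> y" "y < real l ^ Suc n"
proof -
  obtain m where m: "y < real l ^ m" using real_arch_pow[of "real l" y] assms(1) by auto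
  define k where "k = (LEAST m. y < real l ^ m)"
  have k: "y < real l ^ k" unfolding k_def using m by (rule LeastI)
  have low: "real l ^ m \<le> y" if "m < k" for m
    using not_less_Least[of m "\<lambda>m. y < real l ^ m"] that by (simp add: k_def)
  have "N < k"
  proof (rule ccontr)
    assume "\<not> N < k"
    then have "real l ^ k \<le> real l ^ N" using assms(1) by (intro power_increasing) auto
    with k assms(2) show False by linarith
  qed
  then have "Suc (k - 1) = k" by simp
  then show thesis using that[of "k - 1"] low[of "k - 1"] k \<open>N < k\<close> by simp
qed

lemma expectation_finite_support:
  assumes "finite Z" "set_pmf R \<subseteq> Z"
  shows "measure_pmf.expectation R f = (\<Sum>i\<in>Z. f i * pmf R i)"
  using assms by (intro integral_measure_pmf_real) auto

context reflected_ifs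
begin

lemma emeasure_word_event:
  fixes R :: "nat pmf" and \<omega>\<^sub>0 :: "nat \<Rightarrow> nat"
  defines "M \<equiv> PiM (UNIV :: nat set) (\<lambda>_. measure_pmf R)"
  assumes "\<And>k. \<omega>\<^sub>0 k \<in> set_pmf R"
  shows "{\<omega> \<in> space M. \<forall>k\<in>{..<n}. \<omega> k \<in> {\<omega>\<^sub>0 k}} \<in> sets M"
    "emeasure M {\<omega> \<in> space M. \<forall>k\<in>{..<n}. \<omega> k \<in> {\<omega>\<^sub>0 k}} = ennreal (exp (\<Sum>k<n. ln (pmf R (\<omega>\<^sub>0 k))))"
proof -
  interpret product_prob_space "\<lambda>_. measure_pmf R" "UNIV :: nat set" ..
  show "{\<omega> \<in> space M. \<forall>k\<in>{..<n}. \<omega> k \<in> {\<omega>\<^sub>0 k}} \<in> sets M"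
    unfolding M_def by (intro sets.sets_Collect_finite_All sets_Collect_single') auto
  have "emeasure M {\<omega> \<in> space M. \<forall>k\<in>{..<n}. \<omega> k \<in> {\<omega>\<^sub>0 k}} = (\<Prod>k<n. emeasure (measure_pmf R) {\<omega>\<^sub>0 k})"
    unfolding M_def by (rule emeasure_PiM_Collect) auto
  also have "\<dots> = ennreal (\<Prod>k<n. pmf R (\<omega>\<^sub>0 k))"
    by (simp add: emeasure_pmf_single prod_ennreal)
  also have "(\<Prod>k<n. pmf R (\<omega>\<^sub>0 k)) = (\<Prod>k<n. exp (ln (pmf R (\<omega>\<^sub>0 k))))"
    using assms(2) by (intro prod.cong refl) (simp add: pmf_positive)
  also have "\<dots> = exp (\<Sum>k<n. ln (pmf R (\<omega>\<^sub>0 k)))" by (simp add: exp_sum)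
  finally show "emeasure M {\<omega> \<in> space M. \<forall>k\<in>{..<n}. \<omega> k \<in> {\<omega>\<^sub>0 k}} = ennreal (exp (\<Sum>k<n. ln (pmf R (\<omega>\<^sub>0 k))))" .
qed

lemma unflipped_level_set_digit_sum:
  assumes "\<And>k. \<omega> k \<in> B" "\<And>n. \<exists>k\<ge>n. \<omega> k \<noteq> l - 1"
    and "(\<lambda>n. (\<Sum>k<n. digit_excess \<alpha> (\<omega> k)) / real n) \<longlonglongrightarrow> 0"
  shows "digit_sum l \<omega> \<in> level_set l \<mu> \<alpha> \<inter> unflipped_points"
proof -
  have lt: "\<omega> k < l" for k using B_less assms(1) by blast
  note D = adic_word_digit_sum[of l \<omega>, OF l2 lt assms(2)]
  have "adic_digit l (digit_sum l \<omega>) k = \<omega> k" for k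
  proof -
    have "adic_digit l (digit_sum l \<omega>) k = adic_word l (digit_sum l \<omega>) (Suc k) ! k"
      by (simp add: adic_word_def del: upt_Suc)
    also have "\<dots> = \<omega> k" unfolding D(2) by (simp del: upt_Suc)
    finally show ?thesis .
  qed
  then show ?thesis
    using D(1) assms(1,3) level_set_unflipped_iff[of "digit_sum l \<omega>" \<alpha>] by (auto simp: unflipped_points_def)
qed

text \<open>The sequence with all digits equal to \<open>l - 1\<close> is realised by the point 1.\<close>

lemma constant_digit_unflipped_level_set:
  assumes "b \<in> B" "digit_excess \<alpha> b = 0"
  shows "level_set l \<mu> \<alpha> \<inter> unflipped_points \<noteq> {}"
proof (cases "b = l - 1")
  case True
  have "adic_digit l 1 k = b" for k
  proof -
    have "adic_digit l 1 k = adic_word l 1 (Suc k) ! k" by (simp add: adic_word_def del: upt_Suc)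
    also have "\<dots> = b" unfolding adic_word_one[OF l2] True by (simp del: replicate_Suc)
    finally show ?thesis .
  qed
  then have "1 \<in> level_set l \<mu> \<alpha> \<inter> unflipped_points"
    using assms level_set_unflipped_iff[of 1 \<alpha>] by (auto simp: unflipped_points_def)
  then show ?thesis by blast
next
  case False
  have "digit_sum l (\<lambda>_. b) \<in> level_set l \<mu> \<alpha> \<inter> unflipped_points"
    by (rule unflipped_level_set_digit_sum) (use assms False in auto)
  then show ?thesis by blast
qed

text \<open>Choose the digits independently with distribution \<open>R\<close>, whose entropy appears on the right-hand side
  of the condition on \<open>t\<close>. Excluding point masses ensures that almost surely the digits are not
  eventually \<open>l - 1\<close>, so that they are the digits of their \<open>digit_sum\<close>. The set \<open>G\<close> collects the
  sequences for which the relevant averages converge, and \<open>H N\<close> those whose cylinders have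
  probability at most \<open>l powr (- n * t)\<close> for all \<open>n \<ge> N\<close>.\<close>

lemma unflipped_level_set_lower:
  assumes R: "set_pmf R \<subseteq> B" "(\<Sum>i\<in>B. pmf R i * digit_excess \<alpha> i) = 0" "\<And>b. pmf R b \<noteq> 1"
  shows "level_set l \<mu> \<alpha> \<inter> unflipped_points \<noteq> {}"
    and "t > 0 \<Longrightarrow> t * ln (real l) < - (\<Sum>i\<in>B. pmf R i * ln (pmf R i)) \<Longrightarrow>
      ereal t \<le> hausdorff_dim (level_set l \<mu> \<alpha> \<inter> unflipped_points)"
proof -
  define E where "E = level_set l \<mu> \<alpha> \<inter> unflipped_points"
  interpret product_prob_space "\<lambda>_. measure_pmf R" "UNIV :: nat set" ..
  define M where "M = PiM (UNIV :: nat set) (\<lambda>_. measure_pmf R)"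
  interpret PM: prob_space M unfolding M_def by (rule P.prob_space_axioms)
  have comp[measurable]: "(\<lambda>\<omega>. \<omega> i) \<in> measurable M (count_space UNIV)" for i
    unfolding M_def using measurable_component_singleton[of i UNIV "\<lambda>_. measure_pmf R"] by simp
  have finR: "finite (set_pmf R)" using finite_subset[OF R(1) finite_B] .
  note slln = AE_average_tendsto_expectation[OF finR, folded M_def]
  have mean: "measure_pmf.expectation R (digit_excess \<alpha>) = 0"
    using R(2) by (simp add: expectation_finite_support[OF finite_B R(1)] mult.commute)
  have ent: "measure_pmf.expectation R (\<lambda>i. ln (pmf R i)) = (\<Sum>i\<in>B. pmf R i * ln (pmf R i))"
    by (simp add: expectation_finite_support[OF finite_B R(1)] mult.commute)
  have freq: "measure_pmf.expectation R (indicat_real {l - 1}) = pmf R (l - 1)"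
    by (simp add: measure_pmf_single)
  have supp: "AE \<omega> in M. \<forall>k. \<omega> k \<in> set_pmf R"
    unfolding AE_all_countable M_def by (intro allI AE_component) (auto simp: AE_measure_pmf_iff)
  define good where "good \<omega> \<longleftrightarrow> (\<forall>k. \<omega> k \<in> set_pmf R) \<and>
    (\<lambda>n. (\<Sum>k<n. digit_excess \<alpha> (\<omega> k)) / real n) \<longlonglongrightarrow> 0 \<and>
    (\<lambda>n. (\<Sum>k<n. ln (pmf R (\<omega> k))) / real n) \<longlonglongrightarrow> (\<Sum>i\<in>B. pmf R i * ln (pmf R i)) \<and>
    (\<lambda>n. (\<Sum>k<n. indicat_real {l - 1} (\<omega> k)) / real n) \<longlonglongrightarrow> pmf R (l - 1)" for \<omega>
  have "AE \<omega> in M. good \<omega>"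
    using supp slln[of "digit_excess \<alpha>", unfolded mean] slln[of "\<lambda>i. ln (pmf R i)", unfolded ent]
      slln[of "indicat_real {l - 1}", unfolded freq]
    by eventually_elim (simp add: good_def)
  then obtain N0 where N0: "{\<omega> \<in> space M. \<not> good \<omega>} \<subseteq> N0" "N0 \<in> null_sets M" by (auto elim!: AE_E)
  define G where "G = space M - N0"
  have G: "G \<in> sets M" "\<And>\<omega>. \<omega> \<in> G \<Longrightarrow> good \<omega>" "\<And>\<omega>. \<omega> \<in> G \<Longrightarrow> \<omega> \<in> space M" using N0 by (auto simp: G_def)
  have Gpos: "emeasure M G = 1"
    using emeasure_Diff_null_set[OF N0(2), of "space M"] PM.emeasure_space_1 by (simp add: G_def)
  have inB: "\<omega> k \<in> B" if "\<omega> \<in> G" for \<omega> k using G(2)[OF that] R(1) by (auto simp: good_def)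
  have lt: "\<omega> k < l" if "\<omega> \<in> G" for \<omega> k using B_less inB that by blast
  have io: "\<exists>k\<ge>n. \<omega> k \<noteq> l - 1" if "\<omega> \<in> G" for \<omega> n
  proof (rule ccontr)
    assume "\<not> ?thesis"
    then have tail: "\<omega> k = l - 1" if "k \<ge> n" for k using that by auto
    have lim: "(\<lambda>m. (\<Sum>k<m. indicat_real {l - 1} (\<omega> k)) / real m) \<longlonglongrightarrow> pmf R (l - 1)"
      using G(2)[OF \<open>\<omega> \<in> G\<close>] by (simp add: good_def)
    have "(\<lambda>m. 1 - real n * (1 / real m)) \<longlonglongrightarrow> 1 - real n * 0"
      by (intro tendsto_intros lim_1_over_n)
    moreover have "\<forall>\<^sub>F m in sequentially. 1 - real n * (1 / real m) \<le> (\<Sum>k<m. indicat_real {l - 1} (\<omega> k)) / real m"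
      using eventually_gt_at_top[of n]
    proof eventually_elim
      case (elim m)
      have "real m - real n = (\<Sum>k\<in>{n..<m}. indicat_real {l - 1} (\<omega> k))" using elim tail by simp
      also have "\<dots> \<le> (\<Sum>k<m. indicat_real {l - 1} (\<omega> k))" by (intro sum_mono2) auto
      finally have "(real m - real n) / real m \<le> (\<Sum>k<m. indicat_real {l - 1} (\<omega> k)) / real m"
        by (rule divide_right_mono) simp
      then show ?case using elim by (simp add: diff_divide_distrib)
    qed
    ultimately have "1 - real n * 0 \<le> pmf R (l - 1)"
      by (rule tendsto_le[OF trivial_limit_sequentially lim])
    then show False using R(3)[of "l - 1"] pmf_le_1[of R "l - 1"] by simp
  qed
  have inE: "digit_sum l \<omega> \<in> E" if "\<omega> \<in> G" for \<omega>
    unfolding E_def using G(2)[OF that] inB[OF that] io[OF that]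
    by (intro unflipped_level_set_digit_sum) (auto simp: good_def)
  have "G \<noteq> {}" using Gpos by auto
  then show "level_set l \<mu> \<alpha> \<inter> unflipped_points \<noteq> {}" using inE unfolding E_def by blast
  assume "t > 0" and t: "t * ln (real l) < - (\<Sum>i\<in>B. pmf R i * ln (pmf R i))"
  define c where "c = t * ln (real l)"
  define H where "H N = {\<omega> \<in> G. \<forall>n\<in>{N..}. (\<Sum>k<n. ln (pmf R (\<omega> k))) \<le> - (real n * c)}" for N
  have Hsub: "H N \<subseteq> G" for N by (auto simp: H_def)
  have Hmeas: "H N \<in> sets M" for N
  proof -
    have [measurable]: "(\<lambda>\<omega>. ln (pmf R (\<omega> k))) \<in> borel_measurable M" for k
      by (rule measurable_compose[OF comp]) simp
    have "{\<omega> \<in> space M. \<forall>n\<in>{N..}. (\<Sum>k<n. ln (pmf R (\<omega> k))) \<le> - (real n * c)} \<in> sets M" by measurable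
    moreover have "H N = G \<inter> {\<omega> \<in> space M. \<forall>n\<in>{N..}. (\<Sum>k<n. ln (pmf R (\<omega> k))) \<le> - (real n * c)}"
      using G(3) by (auto simp: H_def)
    ultimately show ?thesis using G(1) by simp
  qed
  have "G \<subseteq> (\<Union>N. H N)"
  proof
    fix \<omega> assume \<omega>: "\<omega> \<in> G"
    then have "(\<lambda>n. (\<Sum>k<n. ln (pmf R (\<omega> k))) / real n) \<longlonglongrightarrow> (\<Sum>i\<in>B. pmf R i * ln (pmf R i))"
      using G(2) by (simp add: good_def)
    moreover have "(\<Sum>i\<in>B. pmf R i * ln (pmf R i)) < - c" using t by (simp add: c_def)
    ultimately have "\<forall>\<^sub>F n in sequentially. (\<Sum>k<n. ln (pmf R (\<omega> k))) / real n < - c"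
      by (rule order_tendstoD)
    then obtain N where N: "\<And>n. n \<ge> N \<Longrightarrow> (\<Sum>k<n. ln (pmf R (\<omega> k))) / real n < - c"
      by (auto simp: eventually_sequentially)
    have "(\<Sum>k<n. ln (pmf R (\<omega> k))) \<le> - (real n * c)" if "n \<ge> N" for n
      using N[OF that] by (cases "n = 0") (auto simp: field_simps)
    then have "\<omega> \<in> H N" using \<omega> by (simp add: H_def)
    then show "\<omega> \<in> (\<Union>N. H N)" by blast
  qed
  moreover have "\<exists>N. emeasure M (H N) > 0"
  proof (rule ccontr)
    assume "\<not> ?thesis"
    then have "emeasure M (\<Union>N. H N) = 0" using Hmeas by (intro emeasure_UN_eq_0) auto
    moreover have "emeasure M G \<le> emeasure M (\<Union>N. H N)"
      using \<open>G \<subseteq> (\<Union>N. H N)\<close> Hmeas by (intro emeasure_mono) auto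
    ultimately show False using Gpos by simp
  qed
  ultimately obtain N where Npos: "emeasure M (H N) > 0" by blast
  have "ereal t \<le> hausdorff_dim E"
  proof (rule mass_distribution_principle[where f = "digit_sum l" and G = "H N" and M = M
        and \<delta>\<^sub>0 = "1 / real l ^ N" and C = "3 * real l powr t"])
    show "finite_measure M" by (rule PM.finite_measure_axioms)
    show "AE \<omega> in M. \<omega> \<in> H N \<longrightarrow> digit_sum l \<omega> \<in> E" using inE Hsub by auto
    show "0 < 1 / real l ^ N" "0 < 3 * real l powr t" using l2 by auto
    fix U :: "real set" and d :: real
    assume U: "bounded U" "diameter U \<le> d" and d: "0 < d" "d \<le> 1 / real l ^ N"
    have "real l ^ N \<le> 1 / d" using d l2 by (simp add: field_simps)
    then obtain n where n: "N \<le> n" "real l ^ n \<le> 1 / d" "1 / d < real l ^ Suc n"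
      using power_between[OF l2] by blast
    define idx where "idx \<omega> = word_index l (map \<omega> [0..<n])" for \<omega>
    have idx: "adic_index l n (digit_sum l \<omega>) = idx \<omega>" "digit_sum l \<omega> \<in> {0..<1}" if "\<omega> \<in> G" for \<omega>
      using adic_word_digit_sum(1,3)[of l \<omega>, OF l2 lt[OF that] io[OF that]] by (simp_all add: idx_def)
    define cyl where "cyl \<omega>\<^sub>0 = {\<omega> \<in> space M. \<forall>k\<in>{..<n}. \<omega> k \<in> {\<omega>\<^sub>0 k}}" for \<omega>\<^sub>0 :: "nat \<Rightarrow> nat"
    have cyl: "\<exists>V\<in>sets M. {\<omega> \<in> H N. idx \<omega> = m} \<subseteq> V \<and> emeasure M V \<le> ennreal (real l powr t * d powr t)" for m
    proof (cases "\<exists>\<omega>\<^sub>0\<in>H N. idx \<omega>\<^sub>0 = m")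
      case True
      then obtain \<omega>\<^sub>0 where w0: "\<omega>\<^sub>0 \<in> H N" "idx \<omega>\<^sub>0 = m" by blast
      have supp0: "\<omega>\<^sub>0 k \<in> set_pmf R" for k using w0(1) Hsub G(2) by (auto simp: good_def)
      have meas0: "cyl \<omega>\<^sub>0 \<in> sets M" and em0: "emeasure M (cyl \<omega>\<^sub>0) = ennreal (exp (\<Sum>k<n. ln (pmf R (\<omega>\<^sub>0 k))))"
        unfolding cyl_def M_def by (rule emeasure_word_event[of \<omega>\<^sub>0 R n, OF supp0])+
      have le0: "exp (\<Sum>k<n. ln (pmf R (\<omega>\<^sub>0 k))) \<le> real l powr t * d powr t"
      proof -
        have "(\<Sum>k<n. ln (pmf R (\<omega>\<^sub>0 k))) \<le> - (real n * c)" using w0(1) n(1) by (auto simp: H_def)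
        then have "exp (\<Sum>k<n. ln (pmf R (\<omega>\<^sub>0 k))) \<le> exp (- (real n * c))" by simp
        also have "\<dots> = (1 / real l ^ n) powr t"
          using l2 by (simp add: c_def powr_def ln_div ln_realpow algebra_simps)
        also have "\<dots> \<le> (real l * d) powr t"
        proof (rule powr_mono2)
          have "1 / d * d < real l ^ Suc n * d" using n(3) d(1) by (rule mult_strict_right_mono)
          then have "1 \<le> real l * d * real l ^ n" using d(1) by (simp add: mult_ac)
          moreover have "real l ^ n > 0" using l2 by simp
          ultimately show "1 / real l ^ n \<le> real l * d" by (subst pos_divide_le_eq)
        qed (use \<open>t > 0\<close> l2 in auto)
        finally show ?thesis using l2 d by (simp add: powr_mult)
      qed
      have "{\<omega> \<in> H N. idx \<omega> = m} \<subseteq> cyl \<omega>\<^sub>0"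
      proof
        fix \<omega> assume "\<omega> \<in> {\<omega> \<in> H N. idx \<omega> = m}"
        then have w: "\<omega> \<in> H N" "idx \<omega> = idx \<omega>\<^sub>0" using w0 by auto
        have "map \<omega> [0..<n] = map \<omega>\<^sub>0 [0..<n]"
        proof (rule word_index_inj)
          show "word_index l (map \<omega> [0..<n]) = word_index l (map \<omega>\<^sub>0 [0..<n])" using w(2) by (simp add: idx_def)
        qed (use lt w(1) w0(1) Hsub in auto)
        then show "\<omega> \<in> cyl \<omega>\<^sub>0" using w(1) Hsub G(3) by (auto simp: cyl_def)
      qed
      moreover have "emeasure M (cyl \<omega>\<^sub>0) \<le> ennreal (real l powr t * d powr t)"
        unfolding em0 by (rule ennreal_leI[OF le0])
      ultimately show ?thesis using meas0 by blast
    next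
      case False
      then show ?thesis by (intro bexI[of _ "{}"]) auto
    qed
    have "\<forall>m. \<exists>V. V \<in> sets M \<and> {\<omega> \<in> H N. idx \<omega> = m} \<subseteq> V \<and>
        emeasure M V \<le> ennreal (real l powr t * d powr t)" using cyl unfolding Bex_def by (rule allI)
    from choice[OF this] obtain V where V': "\<forall>m. V m \<in> sets M \<and> {\<omega> \<in> H N. idx \<omega> = m} \<subseteq> V m \<and>
        emeasure M (V m) \<le> ennreal (real l powr t * d powr t)" ..
    have V: "V m \<in> sets M" "{\<omega> \<in> H N. idx \<omega> = m} \<subseteq> V m"
      "emeasure M (V m) \<le> ennreal (real l powr t * d powr t)" for m
      using spec[OF V', of m] by simp_all
    show "\<exists>V\<in>sets M. {\<omega> \<in> H N. digit_sum l \<omega> \<in> U} \<subseteq> V \<and> emeasure M V \<le> ennreal (3 * real l powr t * d powr t)"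
    proof (cases "\<exists>\<omega>\<^sub>0\<in>H N. digit_sum l \<omega>\<^sub>0 \<in> U")
      case True
      then obtain \<omega>\<^sub>0 where w0: "\<omega>\<^sub>0 \<in> H N" "digit_sum l \<omega>\<^sub>0 \<in> U" by blast
      define k where "k = idx \<omega>\<^sub>0"
      \<comment> \<open>A set of diameter at most \<open>l\<^bsup>-n\<^esup>\<close> meets at most three neighbouring intervals of level \<open>n\<close>; for
        \<open>k = 0\<close> the truncated \<open>k - 1\<close> is harmless.\<close>
      have sub: "{\<omega> \<in> H N. digit_sum l \<omega> \<in> U} \<subseteq> V (k - 1) \<union> V k \<union> V (k + 1)"
      proof
        fix \<omega> assume "\<omega> \<in> {\<omega> \<in> H N. digit_sum l \<omega> \<in> U}"
        then have w: "\<omega> \<in> H N" "digit_sum l \<omega> \<in> U" by auto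
        have bounds: "real (idx \<omega>) \<le> digit_sum l \<omega> * real l ^ n"
          "digit_sum l \<omega> * real l ^ n < real (idx \<omega>) + 1" if "\<omega> \<in> H N" for \<omega>
        proof -
          have g: "\<omega> \<in> G" using that Hsub by blast
          have x: "digit_sum l \<omega> \<in> {0..1}" "digit_sum l \<omega> \<noteq> 1" using idx(2)[OF g] by auto
          show "real (idx \<omega>) \<le> digit_sum l \<omega> * real l ^ n" "digit_sum l \<omega> * real l ^ n < real (idx \<omega>) + 1"
            using adic_index_bounds(1,3)[OF l2 x(1), of n] x(2) idx(1)[OF g] by auto
        qed
        have "\<bar>digit_sum l \<omega> - digit_sum l \<omega>\<^sub>0\<bar> \<le> d"
          using diameter_bounded_bound[OF U(1) w(2) w0(2)] U(2) by (simp add: dist_real_def)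
        then have "\<bar>digit_sum l \<omega> - digit_sum l \<omega>\<^sub>0\<bar> * real l ^ n \<le> d * (1 / d)"
          using n(2) d by (intro mult_mono) auto
        then have "\<bar>digit_sum l \<omega> * real l ^ n - digit_sum l \<omega>\<^sub>0 * real l ^ n\<bar> \<le> 1"
          using d by (simp add: abs_mult left_diff_distrib[symmetric])
        then have "\<bar>real (idx \<omega>) - real k\<bar> < 2"
          using bounds[OF w(1)] bounds[OF w0(1)] unfolding k_def by linarith
        then have "idx \<omega> = k - 1 \<or> idx \<omega> = k \<or> idx \<omega> = k + 1" by linarith
        then show "\<omega> \<in> V (k - 1) \<union> V k \<union> V (k + 1)" using V(2) w(1) by blast
      qed
      have "emeasure M (V (k - 1) \<union> V k \<union> V (k + 1)) \<le> emeasure M (V (k - 1) \<union> V k) + emeasure M (V (k + 1))"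
        using V(1) by (intro emeasure_subadditive) auto
      also have "\<dots> \<le> emeasure M (V (k - 1)) + emeasure M (V k) + emeasure M (V (k + 1))"
        using V(1) by (intro add_right_mono emeasure_subadditive) auto
      also have "\<dots> \<le> ennreal (real l powr t * d powr t) + ennreal (real l powr t * d powr t) + ennreal (real l powr t * d powr t)"
        by (intro add_mono V(3))
      also have "\<dots> = ennreal (3 * real l powr t * d powr t)"
        by (simp add: ennreal_plus[symmetric] del: ennreal_plus)
      finally have em: "emeasure M (V (k - 1) \<union> V k \<union> V (k + 1)) \<le> ennreal (3 * real l powr t * d powr t)" .
      show ?thesis
      proof (intro bexI[of _ "V (k - 1) \<union> V k \<union> V (k + 1)"] conjI)
        show "V (k - 1) \<union> V k \<union> V (k + 1) \<in> sets M" by (intro sets.Un V(1))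
      qed (fact sub em)+
    next
      case False
      then show ?thesis by (intro bexI[of _ "{}"]) auto
    qed
  qed (use Hmeas Npos \<open>t > 0\<close> in auto)
  then show "ereal t \<le> hausdorff_dim (level_set l \<mu> \<alpha> \<inter> unflipped_points)" by (simp add: E_def)
qed

text \<open>For suitable weights of mean 0 the entropy divided by \<open>ln l\<close> is at least the Legendre transform. If the weights are concentrated on a
  single digit, the entropy is 0 and only the existence of a point is at stake.\<close>

lemma unflipped_level_set_in_range:
  assumes range: "\<alpha> \<in> exponent_range l p B"
  shows "level_set l \<mu> \<alpha> \<inter> unflipped_points \<noteq> {}"
    and "legendre (tau_tilde l p) \<alpha> \<le> hausdorff_dim (level_set l \<mu> \<alpha> \<inter> unflipped_points)"
proof -
  have ne: "B \<noteq> {}" using range by (auto simp: exponent_range_def split: if_splits)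
  obtain m m' where m: "m \<in> B" "digit_excess \<alpha> m \<ge> 0" "m' \<in> B" "digit_excess \<alpha> m' \<le> 0"
    using range unfolding exponent_range_iff by blast
  obtain \<rho> where \<rho>: "\<forall>i\<in>B. \<rho> i \<ge> 0" "sum \<rho> B = 1" "(\<Sum>i\<in>B. \<rho> i * digit_excess \<alpha> i) = 0"
    "\<And>r. (\<forall>q. r \<le> ln (\<Sum>i\<in>B. exp (q * digit_excess \<alpha> i))) \<Longrightarrow> r \<le> - (\<Sum>i\<in>B. \<rho> i * ln (\<rho> i))"
    using gibbs_weights[OF finite_B m] by blast
  obtain R where R: "set_pmf R \<subseteq> B" "\<And>i. i \<in> B \<Longrightarrow> pmf R i = \<rho> i"
    using pmf_of_weights[OF finite_B, of \<rho>] \<rho>(1,2) by blast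
  define h where "h = - (\<Sum>i\<in>B. \<rho> i * ln (\<rho> i))"
  have hR: "- (\<Sum>i\<in>B. pmf R i * ln (pmf R i)) = h" using R(2) by (simp add: h_def)
  have exR: "(\<Sum>i\<in>B. pmf R i * digit_excess \<alpha> i) = 0" using R(2) \<rho>(3) by simp
  have leg: "legendre (tau_tilde l p) \<alpha> \<le> ereal (h / ln (real l))"
  proof (cases "legendre (tau_tilde l p) \<alpha>")
    case (real r)
    have "r * ln (real l) \<le> ln (\<Sum>i\<in>B. exp (q * digit_excess \<alpha> i))" for q
    proof -
      have "legendre (tau_tilde l p) \<alpha> \<le> ereal (ln (\<Sum>i\<in>B. exp (q * digit_excess \<alpha> i)) / ln (real l))"
        unfolding legendre_eq[OF ne] by (rule INF_lower) simp
      then show ?thesis using ln_l_pos real by (simp add: field_simps)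
    qed
    then have "r * ln (real l) \<le> h" unfolding h_def using \<rho>(4) by blast
    then show ?thesis using ln_l_pos real by (simp add: field_simps)
  next
    case PInf
    have "legendre (tau_tilde l p) \<alpha> \<le> ereal (ln (\<Sum>i\<in>B. exp (0 * digit_excess \<alpha> i)) / ln (real l))"
      unfolding legendre_eq[OF ne] by (rule INF_lower) simp
    then show ?thesis using PInf by simp
  qed simp
  have "level_set l \<mu> \<alpha> \<inter> unflipped_points \<noteq> {} \<and>
    ereal (h / ln (real l)) \<le> hausdorff_dim (level_set l \<mu> \<alpha> \<inter> unflipped_points)"
  proof (cases "\<exists>b. pmf R b = 1")
    case True
    then obtain b where b: "pmf R b = 1" by blast
    then have "b \<in> B" using R(1) by (metis pmf_eq_0_set_pmf subsetD zero_neq_one)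
    have zero: "\<rho> i = 0" if "i \<in> B" "i \<noteq> b" for i
    proof -
      have "sum \<rho> B = \<rho> b + sum \<rho> (B - {b})" using finite_B \<open>b \<in> B\<close> by (rule sum.remove)
      then have "sum \<rho> (B - {b}) = 0" using \<rho>(2) b R(2)[OF \<open>b \<in> B\<close>] by simp
      then show ?thesis using that \<rho>(1) finite_B by (subst (asm) sum_nonneg_eq_0_iff) auto
    qed
    have single: "(\<Sum>i\<in>B. \<rho> i * f i) = f b" for f :: "nat \<Rightarrow> real"
    proof -
      have "(\<Sum>i\<in>B. \<rho> i * f i) = (\<Sum>i\<in>{b}. \<rho> i * f i)"
        using \<open>b \<in> B\<close> zero finite_B by (intro sum.mono_neutral_right) auto
      then show ?thesis using b R(2)[OF \<open>b \<in> B\<close>] by simp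
    qed
    have "digit_excess \<alpha> b = 0" using \<rho>(3) single by simp
    moreover have "h = 0" unfolding h_def single using b R(2)[OF \<open>b \<in> B\<close>] by simp
    ultimately show ?thesis
      using constant_digit_unflipped_level_set[OF \<open>b \<in> B\<close>] hausdorff_dim_nonneg by (simp add: zero_ereal_def[symmetric])
  next
    case False
    then have nd: "\<And>b. pmf R b \<noteq> 1" by blast
    have "level_set l \<mu> \<alpha> \<inter> unflipped_points \<noteq> {}"
      by (rule unflipped_level_set_lower(1)[OF R(1) exR nd])
    moreover have "ereal (h / ln (real l)) \<le> hausdorff_dim (level_set l \<mu> \<alpha> \<inter> unflipped_points)"
    proof (rule ccontr)
      assume "\<not> ?thesis"
      then have "hausdorff_dim (level_set l \<mu> \<alpha> \<inter> unflipped_points) < ereal (h / ln (real l))"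
        by (simp only: not_le)
      from ereal_dense2[OF this] obtain t where
        t: "hausdorff_dim (level_set l \<mu> \<alpha> \<inter> unflipped_points) < ereal t" "ereal t < ereal (h / ln (real l))"
        by blast
      have "0 < ereal t" using hausdorff_dim_nonneg t(1) by (rule order_le_less_trans)
      then have "t > 0" by simp
      moreover have "t * ln (real l) < h" using t(2) ln_l_pos by (simp add: field_simps)
      ultimately have "ereal t \<le> hausdorff_dim (level_set l \<mu> \<alpha> \<inter> unflipped_points)"
        using unflipped_level_set_lower(2)[OF R(1) exR nd, of t] hR by simp
      with t(1) show False by simp
    qed
    ultimately show ?thesis by blast
  qed
  then show "level_set l \<mu> \<alpha> \<inter> unflipped_points \<noteq> {}"
    "legendre (tau_tilde l p) \<alpha> \<le> hausdorff_dim (level_set l \<mu> \<alpha> \<inter> unflipped_points)"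
    using leg by (auto intro: order_trans)
qed

end

section \<open>Decomposition of the level sets\<close>

context disjoint_ifs
begin

lemma level_domain_mu_decomposition:
  "level_domain l \<mu> = level_domain l (symmetrized \<mu>) \<union> exponent_range l p B"
proof (intro equalityI subsetI)
  fix \<alpha> assume "\<alpha> \<in> level_domain l \<mu>"
  then obtain x where x: "x \<in> level_set l \<mu> \<alpha>" by (auto simp: level_domain_def)
  show "\<alpha> \<in> level_domain l (symmetrized \<mu>) \<union> exponent_range l p B"
  proof (cases "x \<in> unflipped_points")
    case True
    then show ?thesis using unflipped_level_set_exponent_range x by blast
  next
    case False
    then show ?thesis using x level_sets_agree[of \<alpha>] unfolding level_domain_def by blast
  qed
next
  fix \<alpha> assume "\<alpha> \<in> level_domain l (symmetrized \<mu>) \<union> exponent_range l p B"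
  then consider "level_set l (symmetrized \<mu>) \<alpha> \<noteq> {}" | "\<alpha> \<in> exponent_range l p B"
    unfolding level_domain_def by blast
  then have "level_set l \<mu> \<alpha> \<noteq> {}"
  proof cases
    case 1
    then show ?thesis using level_set_nu_flipped_nonempty level_sets_agree[of \<alpha>] by blast
  next
    case 2
    then show ?thesis using unflipped_level_set_in_range(1) by blast
  qed
  then show "\<alpha> \<in> level_domain l \<mu>" by (simp add: level_domain_def)
qed

lemma hausdorff_dim_level_set_mu:
  "hausdorff_dim (level_set l \<mu> \<alpha>) =
    max (hausdorff_dim (level_set l (symmetrized \<mu>) \<alpha>)) (legendre (tau_tilde l p) \<alpha>)"
proof -
  define K where "K = level_set l \<mu> \<alpha> \<inter> unflipped_points"
  have "level_set l \<mu> \<alpha> = (level_set l \<mu> \<alpha> - unflipped_points) \<union> K" by (auto simp: K_def)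
  also have "hausdorff_dim \<dots> = max (hausdorff_dim (level_set l \<mu> \<alpha> - unflipped_points)) (hausdorff_dim K)"
    by (rule hausdorff_dim_Un)
  also have "hausdorff_dim (level_set l \<mu> \<alpha> - unflipped_points) = hausdorff_dim (level_set l (symmetrized \<mu>) \<alpha>)"
    by (simp only: level_sets_agree hausdorff_dim_level_set_nu[symmetric])
  also have "max (hausdorff_dim (level_set l (symmetrized \<mu>) \<alpha>)) (hausdorff_dim K) =
      max (hausdorff_dim (level_set l (symmetrized \<mu>) \<alpha>)) (legendre (tau_tilde l p) \<alpha>)"
  proof (cases "\<alpha> \<in> exponent_range l p B")
    case True
    have "hausdorff_dim K = legendre (tau_tilde l p) \<alpha>"
      unfolding K_def
      using hausdorff_dim_unflipped_le_legendre[OF True] unflipped_level_set_in_range(2)[OF True]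
      by (rule antisym)
    then show ?thesis by simp
  next
    case False
    then have "K = {}" unfolding K_def using unflipped_level_set_exponent_range by blast
    then have "hausdorff_dim K = 0" by (simp add: hausdorff_dim_empty)
    moreover have "legendre (tau_tilde l p) \<alpha> \<le> hausdorff_dim (level_set l (symmetrized \<mu>) \<alpha>)"
      using legendre_nonpos_outside_range[OF False] hausdorff_dim_nonneg by (rule order_trans)
    ultimately show ?thesis
      using hausdorff_dim_nonneg[of "level_set l (symmetrized \<mu>) \<alpha>"] by (simp add: max_absorb1)
  qed
  finally show ?thesis .
qed

end

theorem theorem5p2:
  fixes l :: nat and p :: "nat \<Rightarrow> real" and \<mu> \<nu> :: "real measure" and B :: "nat set"
  assumes "l \<ge> 2"
    and "probability_weight l p"
    and "\<And>i. i < l \<Longrightarrow> p i > 0"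
    and "self_similar_measure l p \<mu>"
    and "\<nu> = symmetrized \<mu>"
    and "B = unflipped l p"
    and "B \<inter> reflected l B = {}"
  shows "level_domain l \<mu> = level_domain l \<nu> \<union> exponent_range l p B
    \<and> (\<forall>\<alpha> \<in> level_domain l \<mu>.
         hausdorff_dim (level_set l \<mu> \<alpha>) =
           max (hausdorff_dim (level_set l \<nu> \<alpha>)) (legendre (tau_tilde l p) \<alpha>))"
proof -
  interpret disjoint_ifs l p \<mu>
    using assms by unfold_locales auto
  show ?thesis
    unfolding assms(5,6) using level_domain_mu_decomposition hausdorff_dim_level_set_mu by blast
qed

end
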